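(* Let $\mu\ge4$ and $d\ge2$ be integers, $m=\mu^d$, $\alpha=(d-1)/d$, and let $$W_{\mathrm{div}}=\Big\{g\in V\otimes\mathbb{C}^d:\ \forall x\in(\mathbb{Z}_\mu)^d\quad \sum_{j=1}^d\big(g_j(x+e_j)-g_j(x)\big)=0\Big\}.$$ Let $\varphi$ be the translation invariant operator on $W=W_{\mathrm{div}}$ given by $$\varphi[f](x)=\sum_{y\in(\mathbb{Z}_\mu)^d}\langle K(x-y),f(y)\rangle,\qquad x\in(\mathbb{Z}_\mu)^d,$$ where $K=(K_1,\dots,K_d)\colon(\mathbb{Z}_\mu)^d\to\mathbb{C}^d$ satisfies $\sum_xK(x)=0$. Then the inequality $$\int_{\mathbb{T}}|\mathbb{I}_\alpha[F]|\,d\nu\leq C\Big(\sup_{n\ge0,\ \omega\in\mathcal{AF}_n}m^{(1-\alpha)n}\nu(\omega)\Big)\|F\|_{L_1}$$ holds with some constant $C$ for all simple martingales $F\in\mathbb{W}$ and all finite non-negative Borel measures $\nu$ on $\mathbb{T}$ with finite supremum if and only if both of the following conditions hold: $$\forall j\in\{1,\dots,d\}\qquad\sum_{y\in\mathbb{Z}_\mu}K_j(ye_j)=0;$$ $$\forall i\neq j\in\{1,\dots,d\}\qquad\sum_{y\in\mathbb{Z}_\mu}\Big(K_j\big(y(e_j-e_i)\big)-K_i\big(y(e_j-e_i)\big)\Big)=0.$$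
   Context: $(\mathbb{Z}_\mu)^d$ is the group of $d$-tuples of residues mod $\mu$; $e_1,\dots,e_d$ are its standard generators. $\langle z,w\rangle=\sum_{j}z_jw_j$ on $\mathbb{C}^d$. The set $\{1,\dots,m\}$, $m=\mu^d$, which indexes the kids of an atom, is identified with $(\mathbb{Z}_\mu)^d$. $V$ is the space of real-valued functions on $(\mathbb{Z}_\mu)^d$ with zero sum; $V\otimes\mathbb{C}^d$ is the space of functions $g=(g_1,\dots,g_d)\colon(\mathbb{Z}_\mu)^d\to\mathbb{C}^d$ with zero sum. $\mathbb{T}$ is the space of sequences $\gamma=(\gamma(0),\gamma(1),\dots)$ with digits in $(\mathbb{Z}_\mu)^d$ (product topology). $\mathcal{AF}_n$ is the set of atoms of level $n$: the $m^n$ cylinder sets obtained by prescribing the first $n$ digits ($\mathcal{AF}_0=\{\mathbb{T}\}$). The $x$-th kid $\omega_x\in\mathcal{AF}_{n+1}$ of $\omega\in\mathcal{AF}_n$ is obtained by prescribing the next digit to be $x$. $\mathcal{F}_n$ is the finite algebra generated by $\mathcal{AF}_n$; $\mathbb{T}$ carries the probability measure giving mass $m^{-n}$ to each atom of level $n$. Martingales $F=\{F_n\}_{n\ge0}$ are $\mathbb{C}^d$-valued and adapted to $\{\mathcal F_n\}$; $dF_{n+1}=F_{n+1}-F_n$; $\|F\|_{L_1}=\sup_n\mathbb{E}|F_n|$; $F$ is simple if $F_n=F_N$ for all $n\ge N$, for some $N$. For $\omega\in\mathcal{AF}_n$, $dF_{n+1}[\omega]\in V\otimes\mathbb{C}^d$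 is the function $x\mapsto dF_{n+1}|_{\omega_x}$. $\mathbb{W}$ is the set of such martingales with $\|F\|_{L_1}<\infty$ and $dF_{n+1}[\omega]\in W$ for all $n\ge0$, $\omega\in\mathcal{AF}_n$. Finally $$\mathbb{I}_\alpha[F]=\sum_{n\ge0}m^{-\alpha n}\sum_{\omega\in\mathcal{AF}_n}\ \sum_{x\in(\mathbb{Z}_\mu)^d}\varphi\big(dF_{n+1}[\omega]\big)(x)\,\chi_{\omega_x}.$$ *)

theory Defs
  imports "HOL-Probability.Probability"
begin

text \<open>Residues are represented by integers in \<open>{0..<\<mu>}\<close>, the index set \<open>{1, ..., d}\<close> by a finite
  type with \<open>d\<close> elements. The standard generator \<open>e\<^sub>j\<close> is \<open>axis j 1\<close>; integer vectors are
  brought back to the carrier by \<open>red\<close>. A function on the group is a function on all integer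
  vectors of which only the values on the carrier are used.\<close>

definition Zmu :: "nat \<Rightarrow> (int^'d) set" where
  "Zmu \<mu> = {x. \<forall>j. x $ j \<in> {0..<int \<mu>}}"

definition red :: "nat \<Rightarrow> int^'d \<Rightarrow> int^'d" where
  "red \<mu> x = (\<chi> j. x $ j mod int \<mu>)"

text \<open>The complex bilinear (not sesquilinear) pairing.\<close>

definition pairing :: "complex^'d \<Rightarrow> complex^'d \<Rightarrow> complex" where
  "pairing z w = (\<Sum>j\<in>UNIV. z $ j * w $ j)"

definition zero_sum :: "nat \<Rightarrow> (int^'d \<Rightarrow> complex^'d) set" where
  "zero_sum \<mu> = {g. (\<Sum>x\<in>Zmu \<mu>. g x) = 0}"

definition W_div :: "nat \<Rightarrow> (int^'d \<Rightarrow> complex^'d) set" where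
  "W_div \<mu> = {g \<in> zero_sum \<mu>.
     \<forall>x\<in>Zmu \<mu>. (\<Sum>j\<in>UNIV. g (red \<mu> (x + axis j 1)) $ j - g x $ j) = 0}"

definition conv_op ::
    "nat \<Rightarrow> (int^'d \<Rightarrow> complex^'d) \<Rightarrow> (int^'d \<Rightarrow> complex^'d) \<Rightarrow> int^'d \<Rightarrow> complex" where
  "conv_op \<mu> K f x = (\<Sum>y\<in>Zmu \<mu>. pairing (K (red \<mu> (x - y))) (f y))"

definition TT_top :: "nat \<Rightarrow> (nat \<Rightarrow> int^'d) topology" where
  "TT_top \<mu> = product_topology (\<lambda>_. discrete_topology (Zmu \<mu>)) UNIV"

abbreviation TT :: "nat \<Rightarrow> (nat \<Rightarrow> int^'d) set" where
  "TT \<mu> \<equiv> topspace (TT_top \<mu>)"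

definition TT_borel :: "nat \<Rightarrow> (nat \<Rightarrow> int^'d) measure" where
  "TT_borel \<mu> = sigma (TT \<mu>) {U. openin (TT_top \<mu>) U}"

definition TT_prob :: "nat \<Rightarrow> (nat \<Rightarrow> int^'d) measure" where
  "TT_prob \<mu> = PiM UNIV (\<lambda>_. uniform_count_measure (Zmu \<mu>))"

definition AF :: "nat \<Rightarrow> nat \<Rightarrow> (nat \<Rightarrow> int^'d) set set" where
  "AF \<mu> n = {{\<gamma>\<in>TT \<mu>. \<forall>k<n. \<gamma> k = \<delta> k} |\<delta>. \<delta> \<in> TT \<mu>}"

definition kid :: "nat \<Rightarrow> (nat \<Rightarrow> int^'d) set \<Rightarrow> int^'d \<Rightarrow> (nat \<Rightarrow> int^'d) set" where
  "kid n \<omega> x = {\<gamma>\<in>\<omega>. \<gamma> n = x}"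

definition filt :: "nat \<Rightarrow> nat \<Rightarrow> (nat \<Rightarrow> int^'d) measure" where
  "filt \<mu> n = sigma (TT \<mu>) (AF \<mu> n)"

text \<open>The equality of integrals over the sets of \<open>filt \<mu> n\<close> is the defining property of
  \<open>F\<^sub>n = E (F\<^sub>n\<^sub>+\<^sub>1 | filt \<mu> n)\<close>; the library's conditional expectation is only real-valued.\<close>

definition is_martingale :: "nat \<Rightarrow> (nat \<Rightarrow> (nat \<Rightarrow> int^'d) \<Rightarrow> complex^'d) \<Rightarrow> bool" where
  "is_martingale \<mu> F \<longleftrightarrow>
     (\<forall>n. F n \<in> borel_measurable (filt \<mu> n) \<and> integrable (TT_prob \<mu>) (F n) \<and>
       (\<forall>A\<in>sets (filt \<mu> n).
          set_lebesgue_integral (TT_prob \<mu>) A (F (Suc n)) =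
          set_lebesgue_integral (TT_prob \<mu>) A (F n)))"

definition L1_norm :: "nat \<Rightarrow> (nat \<Rightarrow> (nat \<Rightarrow> int^'d) \<Rightarrow> complex^'d) \<Rightarrow> ennreal" where
  "L1_norm \<mu> F = (SUP n. \<integral>\<^sup>+ \<gamma>. ennreal (norm (F n \<gamma>)) \<partial>TT_prob \<mu>)"

definition simple_martingale :: "nat \<Rightarrow> (nat \<Rightarrow> (nat \<Rightarrow> int^'d) \<Rightarrow> complex^'d) \<Rightarrow> bool" where
  "simple_martingale \<mu> F \<longleftrightarrow>
     is_martingale \<mu> F \<and> (\<exists>N. \<forall>n\<ge>N. \<forall>\<gamma>\<in>TT \<mu>. F n \<gamma> = F N \<gamma>)"

text \<open>\<open>mdiff F n \<omega>\<close> is \<open>dF\<^sub>n\<^sub>+\<^sub>1[\<omega>]\<close>: its value at \<open>x\<close> is the constant value of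
  \<open>F\<^sub>n\<^sub>+\<^sub>1 - F\<^sub>n\<close> on the \<open>x\<close>-th kid of \<open>\<omega>\<close>.\<close>

definition mdiff ::
    "(nat \<Rightarrow> (nat \<Rightarrow> int^'d) \<Rightarrow> complex^'d) \<Rightarrow> nat \<Rightarrow> (nat \<Rightarrow> int^'d) set
      \<Rightarrow> int^'d \<Rightarrow> complex^'d" where
  "mdiff F n \<omega> x = the_elem ((\<lambda>\<gamma>. F (Suc n) \<gamma> - F n \<gamma>) ` kid n \<omega> x)"

definition WW ::
    "nat \<Rightarrow> (int^'d \<Rightarrow> complex^'d) set \<Rightarrow> (nat \<Rightarrow> (nat \<Rightarrow> int^'d) \<Rightarrow> complex^'d) set" where
  "WW \<mu> W = {F. is_martingale \<mu> F \<and> L1_norm \<mu> F < \<infinity> \<and>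
                 (\<forall>n. \<forall>\<omega>\<in>AF \<mu> n. mdiff F n \<omega> \<in> W)}"

definition riesz_potential ::
    "nat \<Rightarrow> ((int^'d \<Rightarrow> complex^'d) \<Rightarrow> int^'d \<Rightarrow> complex) \<Rightarrow> real
      \<Rightarrow> (nat \<Rightarrow> (nat \<Rightarrow> int^'d) \<Rightarrow> complex^'d) \<Rightarrow> (nat \<Rightarrow> int^'d) \<Rightarrow> complex" where
  "riesz_potential \<mu> \<phi> \<alpha> F \<gamma> =
     (\<Sum>n. of_real (real (\<mu> ^ CARD('d)) powr (- \<alpha> * real n)) *
        (\<Sum>\<omega>\<in>AF \<mu> n. \<Sum>x\<in>Zmu \<mu>. \<phi> (mdiff F n \<omega>) x * indicator (kid n \<omega> x) \<gamma>))"

end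

theory Submission
  imports Defs
begin

text \<open>View \<open>F\<close> as a vector measure on the tree, with mass \<open>a(\<omega>) = m\<^sup>-\<^sup>n F\<^sub>n\<close> on an atom \<open>\<omega>\<close> of level \<open>n\<close>.
  Since \<open>m\<close> to the power \<open>-\<alpha>n\<close> is \<open>\<mu>\<^sup>n / m\<^sup>n\<close>, level \<open>n\<close> contributes
  \<open>m\<^sup>-\<^sup>n \<Sum>\<omega> \<Sum>x \<mu>\<^sup>n \<nu>(\<omega>\<^sub>x) |\<phi>(dF[\<omega>])(x)|\<close>. Each level is trivially \<open>O(\<parallel>F\<parallel>)\<close>, and the point is to
  sum over all levels.

  \<^bold>\<open>Symmetric coordinates.\<close> Put \<open>a\<^sub>0 = - \<Sum>a\<^sub>j\<close> and \<open>e\<^sub>0 = 0\<close>. The values of \<open>F\<close> on the kids of an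
  atom then become a flow \<open>G\<close> with values in \<open>\<complex>\<^sup>d\<^sup>+\<^sup>1\<close> such that \<open>\<Sum>\<^sub>k G\<^sub>k(x) = 0\<close> and
  \<open>\<Sum>\<^sub>k G\<^sub>k(x + e\<^sub>k) = 0\<close>. In this form all \<open>d + 1\<close> indices play the same role, and the two families of
  conditions on \<open>K\<close> are one condition on the lines in the directions \<open>e\<^sub>i - e\<^sub>j\<close>.

  \<^bold>\<open>Concentration.\<close> Let \<open>A = \<Sum>G\<close>, \<open>N = \<Sum>|G|\<close>, and let \<open>\<delta> = N - |A|\<close> be the growth of the \<open>L\<^sub>1\<close> norm
  over the atom. The flux of \<open>G\<^sub>k\<close> through the slice \<open>x\<^sub>k = t\<close> does not depend on \<open>t\<close>, so
  \<open>\<mu>|G(x)|\<close> can hardly exceed \<open>|A|\<close>, and \<open>E(x) = |A| - \<mu>|G(x)| + \<mu>\<delta>\<close> bounds the mass of \<open>G\<close> on the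
  rest of the slices through \<open>x\<close> (\<open>spread_ge\<close>). As the coordinates of \<open>A\<close> add up to zero, two of them,
  \<open>i\<close> and \<open>j\<close>, are comparable to \<open>|A|\<close>. If \<open>E(x)\<close> is small, conservation forces \<open>G\<close> to
  run from \<open>x\<close> straight on to \<open>x + e\<^sub>i - e\<^sub>j\<close>. Going once around the line,
  \<open>G\<close> is a constant multiple of \<open>e\<^sub>i - e\<^sub>j\<close> on it and zero elsewhere, up to an error linear in the sum
  of \<open>E\<close> over the line. The condition on \<open>K\<close> says that \<open>\<phi>\<close> of the ideal flow vanishes on the line,
  hence \<open>|\<phi>(G)(x)| = O(\<Sum> E)\<close> (\<open>conv_le_line_spread\<close>).

  \<^bold>\<open>The potential.\<close> The value \<open>\<phi>(G)(x)\<close> may be of the order of \<open>E\<close> at another point of the line,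
  which \<open>\<nu>\<close> need not charge. This is repaired by the potential
  \<open>|a(\<omega>)| (\<mu>\<^sup>n \<nu>(\<omega>))\<^sup>1\<^sup>/\<^sup>2\<close>. By the Cauchy-Schwarz inequality with its deficit, the loss of the potential
  from an atom to its kids pays both for \<open>\<Sum>\<^sub>x t\<^sub>x E(x)\<close>, where \<open>t\<^sub>x = \<mu>\<^sup>n \<nu>(\<omega>\<^sub>x)\<close>, and for the variation of
  \<open>t\<close> between points that carry much of \<open>G\<close> (\<open>excess_master\<close>). Either \<open>t\<close> is comparable to \<open>t\<^sub>x\<close>
  along the line, so that the bound on \<open>|\<phi>(G)(x)|\<close> is paid, or \<open>t\<close> drops by a factor of 4
  at some step and the variation pays for everything (\<open>walk\<close>). The local inequality
  (\<open>flow_estimate\<close>) telescopes over the tree, together with the \<open>L\<^sub>1\<close> norm, to the claim.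

  \<^bold>\<open>Necessity.\<close> If the sum of \<open>K\<close> along one of the lines \<open>L\<close> is not zero, take the cascade that at each of
  the first \<open>N\<close> levels puts all its mass uniformly on \<open>L\<close>, with the direction of \<open>L\<close> as constant
  value, and let \<open>\<nu>\<close> be its total variation. Norm and supremum stay
  bounded, but each of these levels adds the same number to \<open>I\<^sub>\<alpha>[F]\<close> on the support of \<open>\<nu>\<close>, so that the
  left side grows like \<open>N\<close>.\<close>

section \<open>Arithmetic on the discrete torus\<close>

lemma red_nth [simp]: "red \<mu> x $ j = x $ j mod int \<mu>"
  by (simp add: red_def)

lemma red_in_Zmu [simp]: "\<mu> > 0 \<Longrightarrow> red \<mu> x \<in> Zmu \<mu>"
  by (simp add: Zmu_def)

lemma red_Zmu: "x \<in> Zmu \<mu> \<Longrightarrow> red \<mu> x = x"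
  by (auto simp: Zmu_def vec_eq_iff)

lemma red_red [simp]: "red \<mu> (red \<mu> x) = red \<mu> x"
  by (simp add: vec_eq_iff)

lemma red_add_left [simp]: "red \<mu> (red \<mu> x + y) = red \<mu> (x + y)"
  and red_diff_left [simp]: "red \<mu> (red \<mu> x - y) = red \<mu> (x - y)"
  and red_diff_right [simp]: "red \<mu> (x - red \<mu> y) = red \<mu> (x - y)"
  by (simp_all add: vec_eq_iff mod_simps)

lemma red_eq_iff: "red \<mu> x = red \<mu> y \<longleftrightarrow> (\<forall>j. int \<mu> dvd x $ j - y $ j)"
  by (simp add: vec_eq_iff mod_eq_dvd_iff)

lemma bij_Zmu_PiE:
  "bij_betw vec_nth (Zmu \<mu> :: (int^'d) set) (UNIV \<rightarrow>\<^sub>E {0..<int \<mu>})"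
proof -
  have "f \<in> vec_nth ` Zmu \<mu>" if "f \<in> UNIV \<rightarrow>\<^sub>E {0..<int \<mu>}" for f :: "'d \<Rightarrow> int"
    using that by (intro image_eqI [where x = "\<chi> j. f j"]) (auto simp: Zmu_def PiE_iff)
  then show ?thesis
    by (auto simp: bij_betw_def inj_on_def vec_eq_iff Zmu_def PiE_iff)
qed

lemma finite_Zmu [simp]: "finite (Zmu \<mu> :: (int^'d) set)"
  using bij_betw_finite [OF bij_Zmu_PiE] finite_PiE
  by (metis finite_code finite_atLeastLessThan_int)

lemma card_Zmu: "card (Zmu \<mu> :: (int^'d) set) = \<mu> ^ CARD('d)"
  using bij_betw_same_card [OF bij_Zmu_PiE] by (simp add: card_PiE)

lemma sum_Zmu_reflect:
  assumes "\<mu> > 0"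
  shows "(\<Sum>x\<in>Zmu \<mu>. f (red \<mu> (z - x))) = (\<Sum>x\<in>Zmu \<mu>. f x)"
  by (rule sum.reindex_bij_witness
      [of _ "\<lambda>x. red \<mu> (z - x)" "\<lambda>x. red \<mu> (z - x)"])
     (use assms in \<open>auto simp: red_Zmu\<close>)

text \<open>The index \<open>None\<close> is the additional zeroth one. With \<open>coord None x = - \<Sum> x\<^sub>j\<close> the \<open>d + 1\<close>
  coordinates of a point add up to zero, and a step by \<open>gen k - gen l\<close> raises the coordinate \<open>k\<close>,
  lowers the coordinate \<open>l\<close> and fixes all others, also when \<open>k\<close> or \<open>l\<close> is \<open>None\<close>.\<close>

definition gen :: "'d option \<Rightarrow> int^'d" where
  "gen k = (case k of None \<Rightarrow> 0 | Some j \<Rightarrow> axis j 1)"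

definition coord :: "'d option \<Rightarrow> int^'d \<Rightarrow> int" where
  "coord k x = (case k of None \<Rightarrow> - (\<Sum>j\<in>UNIV. x $ j) | Some j \<Rightarrow> x $ j)"

lemma coord_add: "coord k (x + y) = coord k x + coord k y"
  and coord_diff: "coord k (x - y) = coord k x - coord k y"
  and coord_scale: "coord k (c *s x) = c * coord k x"
  by (auto simp: coord_def sum.distrib sum_subtractf sum_distrib_left split: option.splits)

lemma coord_gen: "coord k (gen l) = of_bool (k = l) - of_bool (k = None)"
  by (auto simp: coord_def gen_def axis_def split: option.splits)

lemma coord_red: "coord k (red \<mu> x) mod int \<mu> = coord k x mod int \<mu>"
proof (cases k)
  case None
  have "(\<Sum>j\<in>UNIV. x $ j mod int \<mu>) mod int \<mu> = (\<Sum>j\<in>UNIV. x $ j) mod int \<mu>"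
    by (rule mod_sum_eq)
  then have "(- (\<Sum>j\<in>UNIV. x $ j mod int \<mu>)) mod int \<mu> = (- (\<Sum>j\<in>UNIV. x $ j)) mod int \<mu>"
    by (rule mod_minus_cong)
  then show ?thesis
    by (simp add: coord_def None)
qed (simp add: coord_def)

lemma sum_coord_classes:
  assumes "\<mu> > 0"
  shows "(\<Sum>t\<in>{0..<int \<mu>}. \<Sum>x | x \<in> Zmu \<mu> \<and> coord k x mod int \<mu> = t. f x) = (\<Sum>x\<in>Zmu \<mu>. f x)"
proof -
  have "(\<Sum>t\<in>{0..<int \<mu>}. sum f {x \<in> Zmu \<mu>. coord k x mod int \<mu> = t}) = sum f (Zmu \<mu>)"
    by (rule sum.group) (use assms in auto)
  then show ?thesis
    by simp
qed

section \<open>Divergence-free flows on the torus\<close>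

locale torus_flow =
  fixes \<mu> :: nat and G :: "int^'d \<Rightarrow> complex^('d option)" and q :: real
  assumes mu: "\<mu> \<ge> 2"
    and q: "q = real CARD('d option)"
    and per: "G (red \<mu> x) = G x"
    and zero: "(\<Sum>k\<in>UNIV. G x $ k) = 0"
    and divfree: "(\<Sum>k\<in>UNIV. G (x + gen k) $ k) = 0"
begin

definition total :: "complex^('d option)" where "total = (\<Sum>x\<in>Zmu \<mu>. G x)"
definition mass :: real where "mass = (\<Sum>x\<in>Zmu \<mu>. norm (G x))"
definition defect :: real where "defect = mass - norm total"
definition spread :: "int^'d \<Rightarrow> real" where
  "spread x = norm total - \<mu> * norm (G x) + \<mu> * defect"

lemma defect_nonneg: "defect \<ge> 0"
  unfolding defect_def mass_def total_def using norm_sum [of G "Zmu \<mu>"] by simp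

lemma G_cong: "red \<mu> x = red \<mu> y \<Longrightarrow> G x = G y"
  by (metis per)

lemma spread_cong: "red \<mu> x = red \<mu> y \<Longrightarrow> spread x = spread y"
  by (simp add: spread_def G_cong [of x y])

definition slice_flux :: "'d option \<Rightarrow> int \<Rightarrow> 'd option \<Rightarrow> complex" where
  "slice_flux k t l = (\<Sum>x | x \<in> Zmu \<mu> \<and> coord k x mod int \<mu> = t mod int \<mu>. G x $ l)"

lemma slice_flux_shift:
  "(\<Sum>x | x \<in> Zmu \<mu> \<and> coord k x mod int \<mu> = t mod int \<mu>. G (x + gen l) $ l)
     = slice_flux k (t + of_bool (k = l) - of_bool (k = None)) l"
proof -
  let ?s = "of_bool (k = l) - of_bool (k = None) :: int"
  have pos: "\<mu> > 0" using mu by simp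
  have c: "coord k (red \<mu> (x + gen l)) mod int \<mu> = (coord k x + ?s) mod int \<mu>" for x
    by (simp add: coord_red coord_add coord_gen algebra_simps)
  have c': "coord k (red \<mu> (x - gen l)) mod int \<mu> = (coord k x - ?s) mod int \<mu>" for x
    by (simp add: coord_red coord_diff coord_gen algebra_simps)
  show ?thesis
    unfolding slice_flux_def
  proof (rule sum.reindex_bij_witness
      [of _ "\<lambda>x. red \<mu> (x - gen l)" "\<lambda>x. red \<mu> (x + gen l)"], goal_cases)
    case (1 a) then show ?case by (simp add: red_Zmu)
  next
    case (2 a)
    then have "coord k a mod int \<mu> = t mod int \<mu>" by simp
    then have "(coord k a + ?s) mod int \<mu> = (t + ?s) mod int \<mu>" by (rule mod_add_cong) simp
    then show ?case using pos c [of a] by (simp add: algebra_simps)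
  next
    case (3 a) then show ?case by (simp add: red_Zmu)
  next
    case (4 a)
    then have "coord k a mod int \<mu> = (t + ?s) mod int \<mu>" by (simp add: algebra_simps)
    then have "(coord k a - ?s) mod int \<mu> = (t + ?s - ?s) mod int \<mu>" by (rule mod_diff_cong) simp
    then show ?case using pos c' [of a] by simp
  next
    case (5 a) then show ?case by (simp add: per)
  qed
qed

text \<open>Summing the divergence equation over a slice of the coordinate \<open>k\<close> leaves every component in
  its slice, except that the component \<open>k\<close> is compared with the neighbouring slice: the flux of \<open>G\<^sub>k\<close>
  through the slices of the coordinate \<open>k\<close> is constant, hence equal to the total divided by \<open>\<mu>\<close>.\<close>

lemma slice_flux_Suc: "slice_flux k (t + 1) k = slice_flux k t k"
proof -
  \<comment> \<open>for \<open>k = None\<close> all the other components move one slice down instead, whence the offset\<close>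
  define s where "s = t + of_bool (k = None)"
  have "(\<Sum>l\<in>UNIV. slice_flux k (s + of_bool (k = l) - of_bool (k = None)) l) = 0"
    unfolding slice_flux_shift [symmetric] using divfree
    by (subst sum.swap) simp
  moreover have "(\<Sum>l\<in>UNIV. slice_flux k t l) = 0"
    unfolding slice_flux_def using zero by (subst sum.swap) simp
  ultimately have "(\<Sum>l\<in>UNIV. slice_flux k (t + of_bool (k = l)) l) = (\<Sum>l\<in>UNIV. slice_flux k t l)"
    by (simp add: s_def algebra_simps)
  moreover have "(\<Sum>l\<in>UNIV-{k}. slice_flux k (t + of_bool (k = l)) l) = (\<Sum>l\<in>UNIV-{k}. slice_flux k t l)"
    by (rule sum.cong) auto
  ultimately show ?thesis
    by (simp add: sum.remove [of UNIV k])
qed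

lemma slice_flux_const: "slice_flux k t k = slice_flux k 0 k"
proof -
  have n: "slice_flux k (int n) k = slice_flux k 0 k" for n
    by (induction n) (use slice_flux_Suc [of k "int n" for n] in \<open>auto simp: algebra_simps\<close>)
  have "slice_flux k t k = slice_flux k (t mod int \<mu>) k"
    by (simp add: slice_flux_def)
  also have "t mod int \<mu> = int (nat (t mod int \<mu>))"
    using mu by simp
  finally show ?thesis using n by metis
qed

lemma slice_flux_eq: "of_nat \<mu> * slice_flux k t k = total $ k"
proof -
  have "total $ k = (\<Sum>x\<in>Zmu \<mu>. G x $ k)" by (simp add: total_def)
  also have "\<dots> = (\<Sum>s\<in>{0..<int \<mu>}. slice_flux k s k)"
    unfolding slice_flux_def using mu
    by (subst sum_coord_classes [symmetric, of _ _ k]) (auto intro!: sum.cong)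
  also have "\<dots> = (\<Sum>s\<in>{0..<int \<mu>}. slice_flux k t k)"
    by (intro sum.cong) (metis slice_flux_const)+
  finally show ?thesis by simp
qed

end

definition restr :: "'i set \<Rightarrow> complex^'i \<Rightarrow> complex^'i" where
  "restr S a = (\<chi> k. if k \<in> S then a $ k else 0)"

lemma inner_restr: "v \<bullet> restr S a = (\<Sum>k\<in>S. v $ k \<bullet> a $ k)" for a :: "complex^'i::finite"
  by (simp add: inner_vec_def restr_def if_distrib [of "inner _"] sum.If_cases cong: if_cong)

lemma norm_restr: "(norm (restr S a))\<^sup>2 = (\<Sum>k\<in>S. (norm (a $ k))\<^sup>2)" for a :: "complex^'i::finite"
  unfolding power2_norm_eq_inner inner_restr by (rule sum.cong) (simp_all add: restr_def)

lemma inner_restr_self: "a \<bullet> restr S a = (norm (restr S a))\<^sup>2" for a :: "complex^'i::finite"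
  unfolding norm_restr inner_restr by (simp add: power2_norm_eq_inner)

text \<open>Only the coordinates in \<open>S\<close> are available, so transverse parts of \<open>v\<close> do not cancel. They are of the
  order of the square root of the gap \<open>|v| - \<langle>v, a\<rangle>\<close>, but they are tested against the part of \<open>a\<close> in \<open>S\<close>
  only, so the arithmetic-geometric mean inequality absorbs them into half of the main term.\<close>

lemma partial_inner_ge:
  fixes a v :: "complex^'i::finite"
  assumes "norm a = 1"
  shows "v \<bullet> restr S a \<ge> norm v * (norm (restr S a))\<^sup>2 / 2 - (norm v - v \<bullet> a)"
proof -
  define w where "w = norm (restr S a)"
  define r where "r = norm (v - norm v *\<^sub>R a)"
  have aa: "a \<bullet> a = 1" using assms by (simp add: norm_eq_1)
  have r2: "r\<^sup>2 = 2 * norm v * (norm v - v \<bullet> a)"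
    unfolding r_def power2_norm_eq_inner
    by (simp add: inner_diff inner_commute aa algebra_simps power2_eq_square [symmetric])
       (simp add: power2_norm_eq_inner [symmetric] power2_eq_square)
  have dn: "norm v - v \<bullet> a \<ge> 0"
    using norm_cauchy_schwarz [of v a] assms by simp
  have "v \<bullet> restr S a = norm v * w\<^sup>2 + (v - norm v *\<^sub>R a) \<bullet> restr S a"
    by (simp add: inner_diff inner_restr_self w_def)
  moreover have "\<bar>(v - norm v *\<^sub>R a) \<bullet> restr S a\<bar> \<le> r * w"
    unfolding r_def w_def by (rule Cauchy_Schwarz_ineq2)
  moreover have "r * w \<le> norm v * w\<^sup>2 / 2 + (norm v - v \<bullet> a)"
  proof (rule power2_le_imp_le)
    have "(r * w)\<^sup>2 = 4 * (norm v * w\<^sup>2 / 2) * (norm v - v \<bullet> a)"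
      by (simp add: power_mult_distrib r2)
    also have "\<dots> \<le> (norm v * w\<^sup>2 / 2 + (norm v - v \<bullet> a))\<^sup>2"
      using zero_le_power2 [of "norm v * w\<^sup>2 / 2 - (norm v - v \<bullet> a)"]
      by (simp add: power2_eq_square algebra_simps)
    finally show "(r * w)\<^sup>2 \<le> (norm v * w\<^sup>2 / 2 + (norm v - v \<bullet> a))\<^sup>2" .
  qed (use dn in auto)
  ultimately show ?thesis by (simp add: w_def)
qed

context torus_flow
begin

definition common :: "int^'d \<Rightarrow> int^'d \<Rightarrow> 'd option set" where
  "common x z = {k. coord k z mod int \<mu> = coord k x mod int \<mu>}"

text \<open>The norm of the total, expanded through the slices through a fixed point \<open>x\<close>: the
  coordinate \<open>k\<close> of the total is read off the \<open>k\<close>-slice of \<open>x\<close>, so a point \<open>z\<close> enters with the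
  coordinates that it has in common with \<open>x\<close>.\<close>

lemma total_inner:
  "total \<bullet> a = \<mu> * (\<Sum>z\<in>Zmu \<mu>. G z \<bullet> restr (common x z) a)"
proof -
  have "total \<bullet> a = (\<Sum>k\<in>UNIV. (of_nat \<mu> * slice_flux k (coord k x) k) \<bullet> a $ k)"
    by (simp add: inner_vec_def slice_flux_eq)
  also have "\<dots> = (\<Sum>k\<in>UNIV. \<mu> * (\<Sum>z | z \<in> Zmu \<mu> \<and> k \<in> common x z. G z $ k \<bullet> a $ k))"
  proof (rule sum.cong)
    fix k
    have "(of_nat \<mu> * c) \<bullet> a $ k = \<mu> * (c \<bullet> a $ k)" for c :: complex
      using inner_scaleR_left [of "real \<mu>" c "a $ k"] by (simp add: scaleR_conv_of_real)
    then show "(of_nat \<mu> * slice_flux k (coord k x) k) \<bullet> a $ k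
        = \<mu> * (\<Sum>z | z \<in> Zmu \<mu> \<and> k \<in> common x z. G z $ k \<bullet> a $ k)"
      by (simp add: slice_flux_def common_def inner_sum_left)
  qed simp
  also have "\<dots> = \<mu> * (\<Sum>k\<in>UNIV. \<Sum>z | z \<in> Zmu \<mu> \<and> k \<in> common x z. G z $ k \<bullet> a $ k)"
    by (simp add: sum_distrib_left)
  also have "\<dots> = \<mu> * (\<Sum>z\<in>Zmu \<mu>. \<Sum>k | k \<in> UNIV \<and> k \<in> common x z. G z $ k \<bullet> a $ k)"
    by (subst sum.swap_restrict) auto
  finally show ?thesis by (simp add: inner_restr)
qed

text \<open>In \<open>total_inner\<close> the point \<open>x\<close> itself enters with all of its coordinates and accounts for
  \<open>\<mu>|G(x)|\<close>; what remains of \<open>|A|\<close> bounds the mass on the other points of the slices.\<close>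

lemma spread_ge:
  assumes a: "total = norm total *\<^sub>R a" "norm a = 1" and x: "x \<in> Zmu \<mu>"
  shows "spread x \<ge> \<mu> / 2 * (\<Sum>z\<in>Zmu \<mu> - {x}. norm (G z) * (norm (restr (common x z) a))\<^sup>2)"
proof -
  define gap where "gap z = norm (G z) - G z \<bullet> a" for z
  let ?W = "\<lambda>z. norm (G z) * (norm (restr (common x z) a))\<^sup>2"
  let ?Z = "Zmu \<mu> - {x}"
  have ta: "total \<bullet> a = norm total"
    by (subst a(1)) (use a(2) in \<open>simp add: norm_eq_1\<close>)
  have gs: "(\<Sum>z\<in>Zmu \<mu>. gap z) = defect"
    unfolding gap_def defect_def mass_def ta [symmetric]
    by (simp add: sum_subtractf total_def inner_sum_left)
  have whole: "restr (common x x) a = a"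
    by (simp add: restr_def common_def vec_eq_iff)
  have "norm total = \<mu> * (G x \<bullet> a + (\<Sum>z\<in>?Z. G z \<bullet> restr (common x z) a))"
    using total_inner [of a x] ta x
      sum.remove [of "Zmu \<mu>" x "\<lambda>z. G z \<bullet> restr (common x z) a"] by (simp add: whole)
  also have "\<dots> \<ge> \<mu> * (G x \<bullet> a + (\<Sum>z\<in>?Z. ?W z / 2 - gap z))"
    unfolding gap_def using partial_inner_ge [OF a(2)]
    by (intro mult_left_mono add_left_mono sum_mono) auto
  also have "G x \<bullet> a + (\<Sum>z\<in>?Z. ?W z / 2 - gap z) = norm (G x) + (\<Sum>z\<in>?Z. ?W z) / 2 - defect"
  proof -
    have "sum gap ?Z = defect - gap x"
      using gs x sum.remove [of "Zmu \<mu>" x gap] by simp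
    then show ?thesis
      by (simp add: sum_subtractf sum_divide_distrib [symmetric] gap_def [of x])
  qed
  finally have "\<mu> * (norm (G x) + sum ?W ?Z / 2 - defect) \<le> norm total" .
  moreover have dist: "\<mu> * (p + s / 2 - e) = \<mu> * p + \<mu> / 2 * s - \<mu> * e" for p s e :: real
    by (simp add: algebra_simps)
  ultimately show ?thesis
    unfolding spread_def dist by linarith
qed

end

section \<open>Flows that are concentrated at a point\<close>

text \<open>The largest coordinate is the negative of the sum of the others, so one of these is comparable to it.\<close>

lemma two_big_coordinates:
  fixes a :: "complex^'i::finite"
  assumes "norm a = 1" and z: "(\<Sum>k\<in>UNIV. a $ k) = 0"
  obtains i j where "i \<noteq> j" "(norm (a $ i))\<^sup>2 \<ge> 1 / real CARD('i) ^ 3"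
    "(norm (a $ j))\<^sup>2 \<ge> 1 / real CARD('i) ^ 3"
proof -
  let ?n = "real CARD('i)"
  have n: "?n \<ge> 1" by simp
  obtain i where i: "norm (a $ k) \<le> norm (a $ i)" for k
  proof -
    have "Max (range (\<lambda>k. norm (a $ k))) \<in> range (\<lambda>k. norm (a $ k))"
      by (rule Max_in) auto
    then obtain i where "Max (range (\<lambda>k. norm (a $ k))) = norm (a $ i)" by blast
    then have "norm (a $ k) \<le> norm (a $ i)" for k
      using Max_ge [of "range (\<lambda>k. norm (a $ k))" "norm (a $ k)"] by simp
    then show ?thesis by (rule that)
  qed
  have "1 = (\<Sum>k\<in>UNIV. (norm (a $ k))\<^sup>2)"
    using assms(1) norm_restr [of UNIV a] by (simp add: restr_def)
  also have "\<dots> \<le> ?n * (norm (a $ i))\<^sup>2"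
    by (rule sum_bounded_above) (use i in \<open>auto intro: power_mono\<close>)
  finally have i2: "(norm (a $ i))\<^sup>2 \<ge> 1 / ?n"
    by (simp add: field_simps)
  then have ipos: "norm (a $ i) > 0"
    using n by (cases "a $ i = 0") auto
  have neg: "- a $ i = (\<Sum>k\<in>UNIV - {i}. a $ k)"
    using z sum.remove [of UNIV i "($) a"] by (simp add: add_eq_0_iff)
  have "\<exists>j. j \<noteq> i \<and> norm (a $ j) \<ge> norm (a $ i) / ?n"
  proof (rule ccontr)
    assume "\<not> ?thesis"
    then have less: "k \<in> UNIV - {i} \<Longrightarrow> norm (a $ k) \<le> norm (a $ i) / ?n" for k
      by force
    have "norm (a $ i) \<le> (\<Sum>k\<in>UNIV - {i}. norm (a $ k))"
      using neg norm_sum [of "($) a" "UNIV - {i}"] by (metis norm_minus_cancel)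
    also have "\<dots> \<le> real (card (UNIV - {i})) * (norm (a $ i) / ?n)"
      by (rule sum_bounded_above) (use less in auto)
    also have "\<dots> < ?n * (norm (a $ i) / ?n)"
      using ipos n by (intro mult_strict_right_mono) (auto simp: card_Diff_subset card_gt_0_iff)
    finally show False using n by simp
  qed
  then obtain j where j: "j \<noteq> i" "norm (a $ j) \<ge> norm (a $ i) / ?n" by blast
  have "(norm (a $ j))\<^sup>2 \<ge> (norm (a $ i) / ?n)\<^sup>2"
    using j by (intro power_mono) auto
  also have "(norm (a $ i) / ?n)\<^sup>2 = (norm (a $ i))\<^sup>2 / ?n\<^sup>2"
    by (simp add: power_divide)
  also have "\<dots> \<ge> (1 / ?n) / ?n\<^sup>2"
    using i2 by (intro divide_right_mono) auto
  finally have j2: "(norm (a $ j))\<^sup>2 \<ge> 1 / ?n ^ 3"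
    by (simp add: power2_eq_square power3_eq_cube)
  have "1 / ?n ^ 3 \<le> 1 / ?n"
    using n power_increasing [of 1 3 ?n] by (intro divide_left_mono) auto
  then show ?thesis
    using that [of i j] i2 j2 j(1) by auto
qed

definition kernel_norm :: "nat \<Rightarrow> (int^'d \<Rightarrow> complex^'i) \<Rightarrow> real" where
  "kernel_norm \<mu> K = (\<Sum>z\<in>Zmu \<mu>. \<Sum>k\<in>UNIV. norm (K z $ k))"

lemma kernel_norm_nonneg: "kernel_norm \<mu> K \<ge> 0"
  by (simp add: kernel_norm_def sum_nonneg)

context torus_flow
begin

text \<open>What the next lemmas use of the two big coordinates of the total: the bound of \<open>spread_ge\<close> with weights
  bounded below, on the slices of the coordinates \<open>i\<close> and \<open>j\<close> through any point \<open>x\<close>.\<close>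

definition pinned :: "'d option \<Rightarrow> 'd option \<Rightarrow> bool" where
  "pinned i j \<longleftrightarrow> i \<noteq> j \<and> (\<forall>x. spread x \<ge> 0) \<and>
     (\<forall>x z. red \<mu> z \<noteq> red \<mu> x \<longrightarrow> i \<in> common x z \<or> j \<in> common x z
        \<longrightarrow> norm (G z) \<le> q ^ 3 * spread x)"

lemma q_ge1: "q \<ge> 1" by (simp add: q)

lemma common_red: "common (red \<mu> x) (red \<mu> z) = common x z"
  by (simp add: common_def coord_red)

lemma ex_pinned:
  assumes "total \<noteq> 0"
  obtains i j where "pinned i j"
proof -
  define a where "a = total /\<^sub>R norm total"
  have a: "total = norm total *\<^sub>R a" "norm a = 1"
    using assms by (simp_all add: a_def)
  have "(\<Sum>k\<in>UNIV. total $ k) = 0"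
    using zero by (simp add: total_def) (subst sum.swap, simp)
  then have "(\<Sum>k\<in>UNIV. a $ k) = 0"
    by (simp add: a_def scaleR_sum_right [symmetric])
  with a(2) q obtain i j where ij: "i \<noteq> j" "(norm (a $ i))\<^sup>2 \<ge> 1 / q ^ 3" "(norm (a $ j))\<^sup>2 \<ge> 1 / q ^ 3"
    by (metis two_big_coordinates)
  let ?W = "\<lambda>x z. norm (G z) * (norm (restr (common x z) a))\<^sup>2"
  have sp: "spread x \<ge> \<mu> / 2 * (\<Sum>z\<in>Zmu \<mu> - {red \<mu> x}. ?W (red \<mu> x) z)" for x
    using spread_ge [OF a, of "red \<mu> x"] mu spread_cong [of "red \<mu> x" x] by simp
  have sp0: "spread x \<ge> 0" for x
    by (rule order_trans [OF _ sp]) (auto intro!: mult_nonneg_nonneg sum_nonneg)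
  have "norm (G z) \<le> q ^ 3 * spread x"
    if "red \<mu> z \<noteq> red \<mu> x" and c: "i \<in> common x z \<or> j \<in> common x z" for x z
  proof -
    have ge: "(norm (restr S a))\<^sup>2 \<ge> (norm (a $ k))\<^sup>2" if "k \<in> S" for k S
      unfolding norm_restr by (rule member_le_sum) (use that in auto)
    have w: "(norm (restr (common x z) a))\<^sup>2 \<ge> 1 / q ^ 3"
      using c order_trans [OF ij(2) ge] order_trans [OF ij(3) ge] by blast
    have "norm (G z) / q ^ 3 \<le> ?W x z"
      using mult_left_mono [OF w, of "norm (G z)"] by simp
    also have "\<dots> = ?W (red \<mu> x) (red \<mu> z)"
      by (simp add: common_red per)
    also have "\<dots> \<le> (\<Sum>z\<in>Zmu \<mu> - {red \<mu> x}. ?W (red \<mu> x) z)"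
      by (rule member_le_sum) (use that mu in auto)
    also have "\<dots> \<le> \<mu> / 2 * (\<Sum>z\<in>Zmu \<mu> - {red \<mu> x}. ?W (red \<mu> x) z)"
      using mu mult_right_mono [of 1 "\<mu> / 2" "\<Sum>z\<in>Zmu \<mu> - {red \<mu> x}. ?W (red \<mu> x) z"]
      by (simp add: sum_nonneg)
    finally have "norm (G z) / q ^ 3 \<le> spread x" using sp [of x] by linarith
    then show ?thesis using q_ge1 by (simp add: divide_le_eq mult.commute)
  qed
  then show ?thesis
    using that [of i j] ij(1) sp0 by (auto simp: pinned_def)
qed

lemma shift_coord: "coord c (x - gen k + gen l) = coord c x - of_bool (c = k) + of_bool (c = l)"
  by (simp add: coord_add coord_diff coord_gen)

lemma shift_neq:
  assumes "l \<noteq> k"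
  shows "red \<mu> (x - gen k + gen l) \<noteq> red \<mu> x"
proof
  assume "red \<mu> (x - gen k + gen l) = red \<mu> x"
  then have "coord k (x - gen k + gen l) mod int \<mu> = coord k x mod int \<mu>"
    by (metis coord_red)
  then have "int \<mu> dvd - 1"
    using assms by (simp add: shift_coord mod_eq_dvd_iff)
  then show False using mu by auto
qed

lemma norm_G_coord: "norm (G x $ k) \<le> norm (G x)"
  by (rule Finite_Cartesian_Product.norm_nth_le)

context
  fixes i j assumes p: "pinned i j"
begin

lemma ij: "i \<noteq> j" using p by (simp add: pinned_def)
lemma spread_nonneg: "spread x \<ge> 0" using p by (simp add: pinned_def)
lemma pinned_le:
  "red \<mu> z \<noteq> red \<mu> x \<Longrightarrow> i \<in> common x z \<or> j \<in> common x z \<Longrightarrow> norm (G z) \<le> q ^ 3 * spread x"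
  using p unfolding pinned_def by blast

lemma shift_small:
  assumes "l \<noteq> k" "i \<notin> {k, l} \<or> j \<notin> {k, l}"
  shows "norm (G (x - gen k + gen l) $ l) \<le> q ^ 3 * spread x"
  using assms
  by (intro order_trans [OF norm_G_coord pinned_le] shift_neq)
     (auto simp: common_def shift_coord)

lemma sum_small:
  fixes f :: "'d option \<Rightarrow> complex"
  assumes "\<And>l. l \<in> S \<Longrightarrow> norm (f l) \<le> c" "c \<ge> 0"
  shows "norm (\<Sum>l\<in>S. f l) \<le> q * c"
proof -
  have "norm (\<Sum>l\<in>S. f l) \<le> real (card S) * c"
    by (rule order_trans [OF norm_sum sum_bounded_above]) (use assms in auto)
  also have "\<dots> \<le> q * c"
    unfolding q using assms(2) by (intro mult_right_mono of_nat_mono card_mono) auto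
  finally show ?thesis .
qed

text \<open>In the divergence equation at \<open>x - gen k\<close> every term but \<open>G\<^sub>k(x)\<close> is taken at a point that shares
  the coordinate \<open>i\<close> or \<open>j\<close> with \<open>x\<close>. The same equation at \<open>x - gen j\<close> leaves two terms
  (\<open>along_coord\<close>): what enters \<open>x\<close> through \<open>j\<close> leaves towards \<open>x + gen i - gen j\<close>.\<close>

lemma off_coord:
  assumes "k \<noteq> i" "k \<noteq> j"
  shows "norm (G x $ k) \<le> q ^ 4 * spread x"
proof -
  have "G x $ k = - (\<Sum>l\<in>UNIV - {k}. G (x - gen k + gen l) $ l)"
    using divfree [of "x - gen k"] sum.remove [of UNIV k "\<lambda>l. G (x - gen k + gen l) $ l"]
    by (simp add: eq_neg_iff_add_eq_0)
  moreover have "norm (\<Sum>l\<in>UNIV - {k}. G (x - gen k + gen l) $ l) \<le> q * (q ^ 3 * spread x)"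
    by (rule sum_small) (use assms ij spread_nonneg q_ge1 in \<open>auto intro!: shift_small\<close>)
  ultimately show ?thesis by (simp add: power_numeral_reduce mult_ac)
qed

lemma along_coord: "norm (G (x + gen i - gen j) $ i + G x $ j) \<le> q ^ 4 * spread x"
proof -
  have "G (x + gen i - gen j) $ i + G x $ j = - (\<Sum>l\<in>UNIV - {j} - {i}. G (x - gen j + gen l) $ l)"
    using divfree [of "x - gen j"] sum.remove [of UNIV j "\<lambda>l. G (x - gen j + gen l) $ l"]
      sum.remove [of "UNIV - {j}" i "\<lambda>l. G (x - gen j + gen l) $ l"] ij
    by (simp add: eq_neg_iff_add_eq_0 algebra_simps)
  moreover have "norm (\<Sum>l\<in>UNIV - {j} - {i}. G (x - gen j + gen l) $ l) \<le> q * (q ^ 3 * spread x)"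
    by (rule sum_small) (use ij spread_nonneg q_ge1 in \<open>auto intro!: shift_small\<close>)
  ultimately show ?thesis by (simp add: power_numeral_reduce mult_ac)
qed

lemma opposite_coord: "norm (G x $ i + G x $ j) \<le> q ^ 5 * spread x"
proof -
  have "G x $ i + G x $ j = - (\<Sum>l\<in>UNIV - {j} - {i}. G x $ l)"
    using zero [of x] sum.remove [of UNIV j "\<lambda>l. G x $ l"]
      sum.remove [of "UNIV - {j}" i "\<lambda>l. G x $ l"] ij
    by (simp add: eq_neg_iff_add_eq_0 algebra_simps)
  moreover have "norm (\<Sum>l\<in>UNIV - {j} - {i}. G x $ l) \<le> q * (q ^ 4 * spread x)"
    by (rule sum_small) (use spread_nonneg q_ge1 in \<open>auto intro!: off_coord\<close>)
  ultimately show ?thesis by (simp add: power_numeral_reduce mult_ac)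
qed

lemma pow_spread_mono: "a \<le> b \<Longrightarrow> q ^ a * spread x \<le> q ^ b * spread x"
  using spread_nonneg by (intro mult_right_mono power_increasing) (use q_ge1 in auto)

lemma advance_coord: "norm (G (x + gen i - gen j) $ i - G x $ i) \<le> 2 * q ^ 5 * spread x"
proof -
  have "G (x + gen i - gen j) $ i - G x $ i
      = (G (x + gen i - gen j) $ i + G x $ j) - (G x $ i + G x $ j)" by simp
  then have "norm (G (x + gen i - gen j) $ i - G x $ i) \<le> q ^ 4 * spread x + q ^ 5 * spread x"
    using along_coord [of x] opposite_coord [of x] norm_triangle_ineq4 by (smt (verit))
  then show ?thesis using pow_spread_mono [of 4 5 x] by simp
qed

text \<open>The next point of the line carries a fixed part of the total. This is what
  turns a drop of the weights between consecutive points into a loss of the potential.\<close>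

lemma advance_big:
  assumes "spread x * (2 + 16 * \<mu> * q ^ 5) \<le> norm total"
  shows "\<mu> * norm (G x) \<ge> norm total / 4" "\<mu> * norm (G (x + gen i - gen j)) \<ge> norm total / 4"
proof -
  let ?c = "q ^ 5 * spread x"
  let ?x' = "x + gen i - gen j"
  have c: "?c \<ge> 0" using spread_nonneg q_ge1 by simp
  have A: "norm total \<ge> 2 * spread x + 16 * (\<mu> * ?c)"
    using assms by (simp add: algebra_simps)
  have Gx: "\<mu> * norm (G x) = norm total + \<mu> * defect - spread x"
    by (simp add: spread_def)
  have "\<mu> * defect \<ge> 0" using defect_nonneg by simp
  moreover have "\<mu> * ?c \<ge> 0" using c by simp
  ultimately show "\<mu> * norm (G x) \<ge> norm total / 4"
    using A Gx spread_nonneg [of x] by linarith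
  have "norm (G x) \<le> (\<Sum>k\<in>UNIV. norm (G x $ k))"
    unfolding norm_vec_def by (rule L2_set_le_sum) simp
  also have "\<dots> = norm (G x $ i) + norm (G x $ j) + (\<Sum>k\<in>UNIV - {i} - {j}. norm (G x $ k))"
    using sum.remove [of UNIV i "\<lambda>k. norm (G x $ k)"]
      sum.remove [of "UNIV - {i}" j "\<lambda>k. norm (G x $ k)"] ij by simp
  also have "(\<Sum>k\<in>UNIV - {i} - {j}. norm (G x $ k)) \<le> real (card (UNIV - {i} - {j})) * (q ^ 4 * spread x)"
    by (rule sum_bounded_above) (auto intro!: off_coord)
  also have "\<dots> \<le> q * (q ^ 4 * spread x)"
    unfolding q using spread_nonneg [of x] by (intro mult_right_mono of_nat_mono card_mono) auto
  also have "\<dots> = ?c" by (simp add: power_numeral_reduce mult_ac)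
  finally have "norm (G x) \<le> norm (G x $ i) + norm (G x $ j) + ?c" by simp
  moreover have "norm (G x $ j) \<le> norm (G x $ i) + ?c"
    using opposite_coord [of x] norm_triangle_ineq4 [of "G x $ i + G x $ j" "G x $ i"] by simp
  moreover have "norm (G x $ i) \<le> norm (G ?x') + 2 * ?c"
    using advance_coord [of x] norm_G_coord [of ?x' i]
      norm_triangle_ineq3 [of "G ?x' $ i" "G x $ i"] by simp
  ultimately have "norm (G x) \<le> 2 * norm (G ?x') + 6 * ?c" by linarith
  then have "\<mu> * norm (G x) \<le> \<mu> * (2 * norm (G ?x') + 6 * ?c)"
    by (intro mult_left_mono) auto
  then have "\<mu> * norm (G x) \<le> 2 * (\<mu> * norm (G ?x')) + 6 * (\<mu> * ?c)"
    by (simp only: distrib_left mult.left_commute)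
  then show "\<mu> * norm (G ?x') \<ge> norm total / 4"
    using A Gx \<open>\<mu> * defect \<ge> 0\<close> \<open>\<mu> * ?c \<ge> 0\<close> spread_nonneg [of x] by linarith
qed

definition line :: "int^'d \<Rightarrow> nat \<Rightarrow> int^'d" where
  "line x y = x + int y *s (gen i - gen j)"

lemma line_0 [simp]: "line x 0 = x" by (simp add: line_def)
lemma line_Suc: "line x (Suc y) = line x y + gen i - gen j"
  by (simp add: line_def vec_eq_iff algebra_simps)

lemma coord_line: "coord i (line x y) = coord i x + int y"
  using ij by (simp add: line_def coord_add coord_scale coord_diff coord_gen)

definition line_spread :: "int^'d \<Rightarrow> real" where
  "line_spread x = (\<Sum>y<\<mu>. spread (line x y))"

lemma spread_le_line: "y < \<mu> \<Longrightarrow> spread (line x y) \<le> line_spread x"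
  unfolding line_spread_def by (rule member_le_sum) (use spread_nonneg in auto)

lemma line_spread_nonneg: "line_spread x \<ge> 0"
  unfolding line_spread_def by (simp add: sum_nonneg spread_nonneg)

lemma along_line:
  assumes "y < \<mu>"
  shows "norm (G (line x y) $ i - G x $ i) \<le> 2 * q ^ 5 * line_spread x"
proof -
  have "norm (G (line x y) $ i - G x $ i) \<le> 2 * q ^ 5 * (\<Sum>y'<y. spread (line x y'))"
  proof (induction y)
    case (Suc y)
    have "norm (G (line x (Suc y)) $ i - G x $ i)
        \<le> norm (G (line x (Suc y)) $ i - G (line x y) $ i) + norm (G (line x y) $ i - G x $ i)"
      using norm_triangle_ineq [of "G (line x (Suc y)) $ i - G (line x y) $ i" "G (line x y) $ i - G x $ i"]
      by simp
    also have "\<dots> \<le> 2 * q ^ 5 * spread (line x y) + 2 * q ^ 5 * (\<Sum>y'<y. spread (line x y'))"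
      unfolding line_Suc by (intro add_mono advance_coord Suc.IH)
    finally show ?case by (simp add: algebra_simps)
  qed simp
  also have "\<dots> \<le> 2 * q ^ 5 * line_spread x"
    unfolding line_spread_def using assms spread_nonneg q_ge1
    by (intro mult_left_mono sum_mono2) auto
  finally show ?thesis .
qed

text \<open>The ideal flow to which \<open>G\<close> is compared: a multiple of \<open>e\<^sub>i - e\<^sub>j\<close> on the line through \<open>x\<close>.\<close>

definition ray :: "int^'d \<Rightarrow> int^'d \<Rightarrow> complex^('d option)" where
  "ray x z = (if red \<mu> z \<in> (\<lambda>y. red \<mu> (line x y)) ` {..<\<mu>}
     then (\<chi> k. G x $ i * (of_bool (k = i) - of_bool (k = j))) else 0)"

text \<open>On the line this follows by walking along it. A point off the line lies in exactly one slice of the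
  coordinate \<open>i\<close>, which meets the line in some other point, and there \<open>pinned\<close> applies.\<close>

lemma near_ray: "norm (G z $ k - ray x z $ k) \<le> 3 * q ^ 5 * line_spread x"
proof (cases "red \<mu> z \<in> (\<lambda>y. red \<mu> (line x y)) ` {..<\<mu>}")
  case True
  then obtain y where y: "y < \<mu>" "red \<mu> z = red \<mu> (line x y)" by blast
  let ?z = "line x y"
  have zz: "G z = G ?z" using y(2) by (rule G_cong)
  have s: "q ^ a * spread ?z \<le> q ^ 5 * line_spread x" if "a \<le> 5" for a
    using spread_le_line [OF y(1)] that spread_nonneg q_ge1 by (intro mult_mono power_increasing) auto
  have T: "q ^ 5 * line_spread x \<ge> 0" using line_spread_nonneg q_ge1 by simp
  consider "k = i" | "k = j" | "k \<noteq> i" "k \<noteq> j" by blast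
  then show ?thesis
  proof cases
    case 1
    then show ?thesis using along_line [OF y(1), of x] True ij T by (simp add: ray_def zz)
  next
    case 2
    have "norm (G ?z $ j + G x $ i) \<le> norm (G ?z $ i + G ?z $ j) + norm (G ?z $ i - G x $ i)"
      by (rule order_trans [OF _ norm_triangle_ineq4]) simp
    then show ?thesis using along_line [OF y(1), of x] opposite_coord [of ?z] s [of 5] True ij 2
      by (simp add: ray_def zz)
  next
    case 3
    then show ?thesis using off_coord [of k ?z] s [of 4] T True by (simp add: ray_def zz)
  qed
next
  case False
  define y where "y = nat ((coord i z - coord i x) mod int \<mu>)"
  have y: "y < \<mu>" "int y = (coord i z - coord i x) mod int \<mu>"
    using mu by (simp_all add: y_def nat_less_iff)
  have "coord i (line x y) mod int \<mu> = coord i z mod int \<mu>"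
    by (simp add: coord_line y(2) mod_simps)
  then have "norm (G z) \<le> q ^ 3 * spread (line x y)"
    using False y by (intro pinned_le) (auto simp: common_def)
  also have "\<dots> \<le> q ^ 5 * line_spread x"
    using spread_le_line [OF y(1)] spread_nonneg q_ge1 by (intro mult_mono power_increasing) auto
  finally have "norm (G z) \<le> q ^ 5 * line_spread x" .
  moreover have "q ^ 5 * line_spread x \<ge> 0" using line_spread_nonneg q_ge1 by simp
  ultimately show ?thesis
    using False norm_G_coord [of z k] unfolding ray_def by simp
qed

lemma inj_line: "inj_on (\<lambda>y. red \<mu> (line x y)) {..<\<mu>}"
proof (rule inj_onI)
  fix y y' assume y: "y \<in> {..<\<mu>}" "y' \<in> {..<\<mu>}" and "red \<mu> (line x y) = red \<mu> (line x y')"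
  then have "coord i (line x y) mod int \<mu> = coord i (line x y') mod int \<mu>"
    by (metis coord_red)
  then have "int y mod int \<mu> = int y' mod int \<mu>"
    unfolding coord_line by (simp add: mod_eq_dvd_iff)
  then show "y = y'" using y by simp
qed

text \<open>The convolution of the kernel with the ideal flow at \<open>x\<close> is a multiple of the sum in \<open>cancel\<close>, as \<open>x\<close>
  lies on the line; only the distance to the ideal flow remains.\<close>

lemma conv_le_line_spread:
  fixes K :: "int^'d \<Rightarrow> complex^('d option)"
  assumes cancel: "(\<Sum>y<\<mu>. K (red \<mu> (int y *s (gen j - gen i))) $ i
                         - K (red \<mu> (int y *s (gen j - gen i))) $ j) = 0"
  shows "norm (\<Sum>z\<in>Zmu \<mu>. \<Sum>k\<in>UNIV. K (red \<mu> (x - z)) $ k * G z $ k)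
    \<le> kernel_norm \<mu> K * (3 * q ^ 5 * line_spread x)"
proof -
  have pos: "\<mu> > 0" using mu by simp
  let ?S = "(\<lambda>y. red \<mu> (line x y)) ` {..<\<mu>}"
  have "(\<Sum>z\<in>Zmu \<mu>. \<Sum>k\<in>UNIV. K (red \<mu> (x - z)) $ k * ray x z $ k)
      = (\<Sum>z\<in>Zmu \<mu>. if z \<in> ?S then G x $ i * (K (red \<mu> (x - z)) $ i - K (red \<mu> (x - z)) $ j) else 0)"
  proof (rule sum.cong [OF refl])
    fix z :: "int^'d" assume "z \<in> Zmu \<mu>"
    then have z: "red \<mu> z = z" by (rule red_Zmu)
    have "(\<Sum>k\<in>UNIV. f k * (g * (of_bool (k = i) - of_bool (k = j)))) = g * (f i - f j)"
      for f :: "'d option \<Rightarrow> complex" and g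
      by (simp add: algebra_simps sum_subtractf of_bool_def if_distrib [of "\<lambda>c. _ * c"] sum.delta' cong: if_cong)
    then show "(\<Sum>k\<in>UNIV. K (red \<mu> (x - z)) $ k * ray x z $ k)
        = (if z \<in> ?S then G x $ i * (K (red \<mu> (x - z)) $ i - K (red \<mu> (x - z)) $ j) else 0)"
      by (simp add: ray_def z)
  qed
  also have "\<dots> = (\<Sum>z\<in>?S. G x $ i * (K (red \<mu> (x - z)) $ i - K (red \<mu> (x - z)) $ j))"
    by (rule sum.mono_neutral_cong_right) (use pos in auto)
  also have "\<dots> = (\<Sum>y<\<mu>. G x $ i * (K (red \<mu> (x - line x y)) $ i - K (red \<mu> (x - line x y)) $ j))"
    by (subst sum.reindex [OF inj_line]) simp
  also have "\<dots> = G x $ i * (\<Sum>y<\<mu>. K (red \<mu> (int y *s (gen j - gen i))) $ i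
                         - K (red \<mu> (int y *s (gen j - gen i))) $ j)"
  proof -
    have "x - line x y = int y *s (gen j - gen i)" for y
      by (simp add: line_def vec_eq_iff algebra_simps)
    then show ?thesis by (simp add: sum_distrib_left)
  qed
  finally have ray0: "(\<Sum>z\<in>Zmu \<mu>. \<Sum>k\<in>UNIV. K (red \<mu> (x - z)) $ k * ray x z $ k) = 0"
    unfolding cancel by simp
  have "norm (\<Sum>z\<in>Zmu \<mu>. \<Sum>k\<in>UNIV. K (red \<mu> (x - z)) $ k * G z $ k)
      = norm (\<Sum>z\<in>Zmu \<mu>. \<Sum>k\<in>UNIV. K (red \<mu> (x - z)) $ k * (G z $ k - ray x z $ k))"
    using ray0 by (simp add: right_diff_distrib sum_subtractf)
  also have "\<dots> \<le> (\<Sum>z\<in>Zmu \<mu>. \<Sum>k\<in>UNIV. norm (K (red \<mu> (x - z)) $ k) * (3 * q ^ 5 * line_spread x))"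
    by (intro sum_norm_le order_trans [OF norm_mult_ineq] mult_left_mono near_ray) auto
  also have "\<dots> = kernel_norm \<mu> K * (3 * q ^ 5 * line_spread x)"
    unfolding kernel_norm_def sum_distrib_right [symmetric]
    by (subst sum_Zmu_reflect [OF pos, of "\<lambda>z. \<Sum>k\<in>UNIV. norm (K z $ k)"]) simp
  finally show ?thesis .
qed

end

lemma conv_le_mass:
  fixes K :: "int^'d \<Rightarrow> complex^('d option)"
  shows "norm (\<Sum>z\<in>Zmu \<mu>. \<Sum>k\<in>UNIV. K (red \<mu> (x - z)) $ k * G z $ k) \<le> kernel_norm \<mu> K * mass"
proof -
  have pos: "\<mu> > 0" using mu by simp
  have "norm (G z $ k) \<le> mass" if "z \<in> Zmu \<mu>" for z k
    unfolding mass_def using that member_le_sum [of z "Zmu \<mu>" "\<lambda>z. norm (G z)"]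
    by (intro order_trans [OF norm_G_coord]) auto
  then have "norm (\<Sum>z\<in>Zmu \<mu>. \<Sum>k\<in>UNIV. K (red \<mu> (x - z)) $ k * G z $ k)
      \<le> (\<Sum>z\<in>Zmu \<mu>. \<Sum>k\<in>UNIV. norm (K (red \<mu> (x - z)) $ k) * mass)"
    by (intro sum_norm_le order_trans [OF norm_mult_ineq] mult_left_mono) auto
  also have "\<dots> = kernel_norm \<mu> K * mass"
    unfolding kernel_norm_def sum_distrib_right [symmetric]
    by (subst sum_Zmu_reflect [OF pos, of "\<lambda>z. \<Sum>k\<in>UNIV. norm (K z $ k)"]) simp
  finally show ?thesis .
qed

end

section \<open>The inequality on one atom\<close>

text \<open>Lagrange's identity writes the deficit as half of the sum of \<open>a\<^sub>x a\<^sub>z (r\<^sub>x - r\<^sub>z)\<^sup>2\<close> over all ordered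
  pairs; a single pair occurs twice.\<close>

lemma Cauchy_Schwarz_weighted_deficit:
  fixes a r :: "'a \<Rightarrow> real"
  assumes fin: "finite Z" and a: "\<And>x. x \<in> Z \<Longrightarrow> a x \<ge> 0" and s: "s \<in> Z" "s' \<in> Z" "s \<noteq> s'"
  shows "(\<Sum>x\<in>Z. a x * r x)\<^sup>2 + a s * a s' * (r s - r s')\<^sup>2
    \<le> (\<Sum>x\<in>Z. a x) * (\<Sum>x\<in>Z. a x * (r x)\<^sup>2)"
proof -
  define f where "f x z = a x * a z * (r x - r z)\<^sup>2" for x z
  have f0: "f x z \<ge> 0" if "x \<in> Z" "z \<in> Z" for x z
    using that a by (simp add: f_def)
  have "f x z = a x * (a z * (r z)\<^sup>2) + (a x * (r x)\<^sup>2) * a z - 2 * ((a x * r x) * (a z * r z))" for x z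
    by (simp add: f_def power2_eq_square algebra_simps)
  then have "(\<Sum>x\<in>Z. \<Sum>z\<in>Z. f x z)
      = (\<Sum>x\<in>Z. a x) * (\<Sum>z\<in>Z. a z * (r z)\<^sup>2) + (\<Sum>x\<in>Z. a x * (r x)\<^sup>2) * (\<Sum>z\<in>Z. a z)
        - 2 * ((\<Sum>x\<in>Z. a x * r x) * (\<Sum>z\<in>Z. a z * r z))"
    by (simp only: sum.distrib sum_subtractf sum_product sum_distrib_left [symmetric])
  then have double: "(\<Sum>x\<in>Z. \<Sum>z\<in>Z. f x z)
      = 2 * ((\<Sum>x\<in>Z. a x) * (\<Sum>z\<in>Z. a z * (r z)\<^sup>2) - (\<Sum>x\<in>Z. a x * r x)\<^sup>2)"
    by (simp add: power2_eq_square)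
  have row: "(\<Sum>z\<in>Z. f x z) \<ge> f x z'" if "x \<in> Z" "z' \<in> Z" for x z'
    by (rule member_le_sum) (use that fin f0 in auto)
  have "f s s' + f s' s \<le> (\<Sum>x\<in>{s, s'}. \<Sum>z\<in>Z. f x z)"
    using s row [of s s'] row [of s' s] by simp
  also have "\<dots> \<le> (\<Sum>x\<in>Z. \<Sum>z\<in>Z. f x z)"
    using s fin f0 by (intro sum_mono2) (auto intro!: sum_nonneg)
  finally have "2 * f s s' \<le> (\<Sum>x\<in>Z. \<Sum>z\<in>Z. f x z)"
    by (simp add: f_def power2_commute mult_ac)
  from this [unfolded double] show ?thesis
    by (simp add: f_def)
qed

context torus_flow
begin

definition walk_const :: real where
  "walk_const = 2 * (1 + \<mu>) * (64 * \<mu> + (2 + 16 * \<mu> * q ^ 5))"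

definition local_const :: real where
  "local_const = 2 + 4 ^ \<mu> * walk_const + 3 * q ^ 5 * (\<mu> * (4 ^ \<mu> * (2 * (1 + \<mu>))))"

lemma walk_const_nonneg: "walk_const \<ge> 0"
  unfolding walk_const_def using q_ge1 by (intro mult_nonneg_nonneg add_nonneg_nonneg) auto

lemma local_const_parts: "4 ^ \<mu> * walk_const \<ge> 0" "3 * q ^ 5 * (\<mu> * (4 ^ \<mu> * (2 * (1 + \<mu>)))) \<ge> 0"
  using q_ge1 walk_const_nonneg by (intro mult_nonneg_nonneg; simp)+

lemma local_const_nonneg: "local_const \<ge> 0"
  unfolding local_const_def using local_const_parts by linarith

text \<open>With \<open>t\<^sub>x = \<mu>\<^sup>n \<nu>(\<omega>\<^sub>x)\<close> this is, up to normalisation, the loss of the potential from an atom to its kids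
  plus a multiple of the growth of the \<open>L\<^sub>1\<close> norm. The multiple makes it at least \<open>defect\<close>.\<close>

definition excess :: "(int^'d \<Rightarrow> real) \<Rightarrow> real" where
  "excess t = norm total * sqrt (\<Sum>x\<in>Zmu \<mu>. t x)
     - (\<Sum>x\<in>Zmu \<mu>. norm (G x) * sqrt (real \<mu> * t x)) + (real \<mu> + 1) * defect"

context
  fixes t :: "int^'d \<Rightarrow> real"
  assumes t0: "\<And>x. t x \<ge> 0" and t1: "(\<Sum>x\<in>Zmu \<mu>. t x) \<le> 1"
begin

text \<open>The two ways to lose potential. Since \<open>\<mu>|G(x)| = |A| + \<mu>\<delta> - E(x)\<close>, Cauchy-Schwarz applied to
  \<open>\<Sum>|G(x)| (\<mu>t\<^sub>x)\<^sup>1\<^sup>/\<^sup>2\<close> with weights \<open>|G|\<close> leaves \<open>|A| \<Sum> t E\<close> over, and its deficit leaves the variation of \<open>t\<close>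
  between any two points.\<close>

lemma excess_master:
  assumes sp: "\<And>x. spread x \<ge> 0" and s: "s \<in> Zmu \<mu>" "s' \<in> Zmu \<mu>" "s \<noteq> s'"
  shows "excess t \<ge> defect"
    "norm total * (\<Sum>x\<in>Zmu \<mu>. t x * spread x)
      + \<mu> * norm (G s) * norm (G s') * (sqrt (t s) - sqrt (t s'))\<^sup>2
      \<le> 2 * (norm total + \<mu> * defect) * excess t"
proof -
  define \<theta> where "\<theta> = (\<Sum>x\<in>Zmu \<mu>. t x)"
  define V where "V = (\<Sum>x\<in>Zmu \<mu>. norm (G x) * sqrt (real \<mu> * t x))"
  define W where "W = norm total + \<mu> * defect"
  define Y where "Y = (\<Sum>x\<in>Zmu \<mu>. t x * spread x)"
  define D where "D = \<mu> * norm (G s) * norm (G s') * (sqrt (t s) - sqrt (t s'))\<^sup>2"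
  have \<theta>: "0 \<le> \<theta>" "\<theta> \<le> 1" using t0 t1 by (simp_all add: \<theta>_def sum_nonneg)
  have sq: "0 \<le> sqrt \<theta>" "sqrt \<theta> \<le> 1" using \<theta> by simp_all
  have md: "\<mu> * defect \<ge> defect" "defect \<ge> 0"
    using defect_nonneg mu mult_right_mono [of 1 "real \<mu>" defect] by simp_all
  have W0: "norm total \<le> W" "0 \<le> W"
    using md norm_ge_zero [of total] unfolding W_def by linarith+
  have V0: "V \<ge> 0" using t0 by (simp add: V_def sum_nonneg)
  have Y0: "Y \<ge> 0" using t0 sp by (simp add: Y_def sum_nonneg)
  have D0: "D \<ge> 0" by (simp add: D_def)
  have U: "(\<Sum>x\<in>Zmu \<mu>. norm (G x) * (\<mu> * t x)) = \<theta> * W - Y"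
  proof -
    have "norm (G x) * (\<mu> * t x) = t x * W - t x * spread x" for x
      by (simp add: W_def spread_def algebra_simps)
    then show ?thesis
      by (simp add: sum_subtractf sum_distrib_right [symmetric] \<theta>_def Y_def)
  qed
  have U0: "\<theta> * W - Y \<ge> 0"
    unfolding U [symmetric] using t0 by (simp add: sum_nonneg)
  have "V\<^sup>2 + D \<le> (\<Sum>x\<in>Zmu \<mu>. norm (G x)) * (\<Sum>x\<in>Zmu \<mu>. norm (G x) * (sqrt (real \<mu> * t x))\<^sup>2)"
  proof -
    have "(sqrt (real \<mu> * t s) - sqrt (real \<mu> * t s'))\<^sup>2 = \<mu> * (sqrt (t s) - sqrt (t s'))\<^sup>2"
      by (simp add: real_sqrt_mult right_diff_distrib [symmetric] power_mult_distrib)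
    then show ?thesis
      using Cauchy_Schwarz_weighted_deficit
        [of "Zmu \<mu>" "\<lambda>x. norm (G x)" s s' "\<lambda>x. sqrt (real \<mu> * t x)"] s
      by (simp add: V_def D_def mult_ac)
  qed
  also have "(\<Sum>x\<in>Zmu \<mu>. norm (G x) * (sqrt (real \<mu> * t x))\<^sup>2) = \<theta> * W - Y"
    using t0 U by simp
  also have "(\<Sum>x\<in>Zmu \<mu>. norm (G x)) = norm total + defect"
    by (simp add: defect_def mass_def)
  also have "(norm total + defect) * (\<theta> * W - Y) \<le> W * (\<theta> * W - Y)"
    using md U0 by (intro mult_right_mono) (auto simp: W_def)
  also have "\<dots> \<le> \<theta> * W\<^sup>2 - norm total * Y"
    using mult_right_mono [OF W0(1) Y0] by (simp add: power2_eq_square algebra_simps)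
  finally have main: "norm total * Y + D \<le> (W * sqrt \<theta>)\<^sup>2 - V\<^sup>2"
    using \<theta> by (simp add: power_mult_distrib mult.commute)
  have "V \<le> W * sqrt \<theta>"
  proof (rule power2_le_imp_le)
    show "V\<^sup>2 \<le> (W * sqrt \<theta>)\<^sup>2"
      using main D0 mult_nonneg_nonneg [OF norm_ge_zero [of total] Y0] by linarith
  qed (use W0 sq in simp)
  moreover have ex: "W * sqrt \<theta> - V \<le> excess t - defect"
    using mult_left_mono [OF sq(2), of "\<mu> * defect"] md
    by (simp add: excess_def W_def V_def \<theta>_def algebra_simps)
  ultimately show "excess t \<ge> defect" by linarith
  have "(W * sqrt \<theta>)\<^sup>2 - V\<^sup>2 = (W * sqrt \<theta> - V) * (W * sqrt \<theta> + V)"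
    by (simp add: power2_eq_square algebra_simps)
  also have "\<dots> \<le> (W * sqrt \<theta> - V) * (2 * W)"
    using \<open>V \<le> W * sqrt \<theta>\<close> mult_left_mono [OF sq(2) W0(2)] by (intro mult_left_mono) auto
  also have "\<dots> \<le> excess t * (2 * W)"
    using ex md W0 by (intro mult_right_mono) auto
  finally show "norm total * (\<Sum>x\<in>Zmu \<mu>. t x * spread x)
      + \<mu> * norm (G s) * norm (G s') * (sqrt (t s) - sqrt (t s'))\<^sup>2
      \<le> 2 * (norm total + \<mu> * defect) * excess t"
    using main by (simp add: Y_def D_def W_def algebra_simps)
qed

context
  assumes small: "defect < norm total"
begin

lemma norm_total_pos: "norm total > 0"
  using small defect_nonneg by linarith

lemma ex_other: "x \<in> Zmu \<mu> \<Longrightarrow> \<exists>s\<in>Zmu \<mu>. s \<noteq> x"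
  using shift_neq [of "Some undefined" None x] mu red_Zmu [of x \<mu>]
  by (intro bexI [of _ "red \<mu> (x - gen None + gen (Some undefined))"]) auto

lemma excess_bounds:
  assumes sp: "\<And>x. spread x \<ge> 0" and s: "s \<in> Zmu \<mu>"
  shows "t s * spread s \<le> 2 * (1 + \<mu>) * excess t"
    and "s' \<in> Zmu \<mu> \<Longrightarrow> s' \<noteq> s \<Longrightarrow>
      \<mu> * norm (G s) * norm (G s') * (sqrt (t s) - sqrt (t s'))\<^sup>2 \<le> norm total * (2 * (1 + \<mu>) * excess t)"
proof -
  let ?D = "\<lambda>s'. \<mu> * norm (G s) * norm (G s') * (sqrt (t s) - sqrt (t s'))\<^sup>2"
  have *: "norm total * (t s * spread s) + ?D s' \<le> norm total * (2 * (1 + \<mu>) * excess t)"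
    if "s' \<in> Zmu \<mu>" "s' \<noteq> s" for s'
  proof -
    have "excess t \<ge> 0" using excess_master(1) [OF sp s that(1)] that(2) defect_nonneg by force
    moreover have "2 * (norm total + \<mu> * defect) \<le> norm total * (2 * (1 + \<mu>))"
      using mult_left_mono [OF less_imp_le [OF small], of "real \<mu>"] by (simp add: algebra_simps)
    ultimately have "2 * (norm total + \<mu> * defect) * excess t \<le> norm total * (2 * (1 + \<mu>)) * excess t"
      by (rule mult_right_mono [rotated])
    moreover have "t s * spread s \<le> (\<Sum>x\<in>Zmu \<mu>. t x * spread x)"
      by (rule member_le_sum) (use s t0 sp in auto)
    then have "norm total * (t s * spread s) \<le> norm total * (\<Sum>x\<in>Zmu \<mu>. t x * spread x)"
      by (rule mult_left_mono) simp
    ultimately show ?thesis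
      using excess_master(2) [OF sp s that(1)] that(2) by (simp add: mult.assoc)
  qed
  obtain r where s': "r \<in> Zmu \<mu>" "r \<noteq> s" using ex_other [OF s] by blast
  have "norm total * (t s * spread s) \<le> norm total * (2 * (1 + \<mu>) * excess t)"
    using * [OF s'] by (smt (verit) mult_nonneg_nonneg norm_ge_zero of_nat_0_le_iff zero_le_power2)
  then show "t s * spread s \<le> 2 * (1 + \<mu>) * excess t"
    using norm_total_pos by simp
  have "norm total * (t s * spread s) \<ge> 0" using sp t0 by simp
  then show "s' \<in> Zmu \<mu> \<Longrightarrow> s' \<noteq> s \<Longrightarrow> ?D s' \<le> norm total * (2 * (1 + \<mu>) * excess t)"
    using * [of s'] by linarith
qed

text \<open>Walk along the line as long as \<open>t\<close> has not dropped by a factor of 4 in one step. If \<open>E\<close> is large at the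
  current point, \<open>\<Sum> t E\<close> pays for the whole weight \<open>t\<^sub>x |A|\<close>. Otherwise the current and
  the next point both carry a fixed part of \<open>|A|\<close> by \<open>advance_big\<close>, and a drop of \<open>t\<close> between them
  pays through the deficit.\<close>

lemma walk:
  assumes p: "pinned i j" and x: "x \<in> Zmu \<mu>"
  shows "norm total * t x \<le> 4 ^ y * walk_const * excess t
    \<or> (\<forall>y'\<le>y. t x \<le> 4 ^ y' * t (red \<mu> (line i j x y')))"
proof (induction y)
  case 0
  then show ?case using x by (simp add: line_0 [OF p] red_Zmu)
next
  case (Suc y)
  have pos: "\<mu> > 0" using mu by simp
  note sp = spread_nonneg [OF p]
  let ?A = "norm total"
  let ?s = "red \<mu> (line i j x y)" and ?s' = "red \<mu> (line i j x (Suc y))"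
  let ?h = "2 + 16 * \<mu> * q ^ 5"
  have h0: "?h \<ge> 0" using q_ge1 by simp
  have ex0: "excess t \<ge> 0"
    using ex_other [OF x] excess_master(1) [OF sp x] defect_nonneg by (metis order_trans)
  note wc = walk_const_nonneg
  have mono: "4 ^ y * walk_const * excess t \<le> 4 ^ Suc y * walk_const * excess t"
    using ex0 wc by (intro mult_right_mono) auto
  have finish: ?case if "?A * t ?s \<le> walk_const * excess t" and tx: "t x \<le> 4 ^ y * t ?s"
  proof -
    have "?A * t x \<le> 4 ^ y * (?A * t ?s)"
      using mult_left_mono [OF tx, of ?A] by (simp add: mult_ac)
    also have "\<dots> \<le> 4 ^ y * (walk_const * excess t)"
      using that(1) by (intro mult_left_mono) auto
    finally have "?A * t x \<le> 4 ^ y * walk_const * excess t" by (simp add: mult.assoc)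
    then show ?thesis using mono by (intro disjI1) linarith
  qed
  from Suc.IH show ?case
  proof
    assume "?A * t x \<le> 4 ^ y * walk_const * excess t"
    then show ?thesis using mono by linarith
  next
    assume IH: "\<forall>y'\<le>y. t x \<le> 4 ^ y' * t (red \<mu> (line i j x y'))"
    then have tx: "t x \<le> 4 ^ y * t ?s" by blast
    have neq: "?s' \<noteq> ?s"
      using shift_neq [OF ij [OF p], of "line i j x y"] by (simp add: line_Suc [OF p] algebra_simps)
    have Gs: "G ?s = G (line i j x y)" "G ?s' = G (line i j x y + gen i - gen j)"
      by (simp_all add: per line_Suc [OF p])
    have ss: "spread ?s = spread (line i j x y)" by (rule spread_cong) simp
    have c: "2 * (1 + \<mu>) * c * excess t \<le> walk_const * excess t" if "c \<le> 64 * \<mu> + ?h" for c :: real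
      unfolding walk_const_def using that ex0 by (intro mult_right_mono mult_left_mono) auto
    show ?thesis
    proof (cases "spread ?s * ?h \<le> ?A")
      case False
      have "?A * t ?s \<le> (spread ?s * ?h) * t ?s"
        using False t0 by (intro mult_right_mono) auto
      also have "\<dots> = (t ?s * spread ?s) * ?h" by simp
      also have "\<dots> \<le> (2 * (1 + \<mu>) * excess t) * ?h"
        using excess_bounds(1) [OF sp, of ?s] pos h0 by (intro mult_right_mono) auto
      also have "\<dots> = 2 * (1 + \<mu>) * ?h * excess t" by simp
      finally have "?A * t ?s \<le> walk_const * excess t" using c [of ?h] by simp
      then show ?thesis using finish tx by blast
    next
      case True
      then have big: "?A / 4 \<le> \<mu> * norm (G ?s)" "?A / 4 \<le> \<mu> * norm (G ?s')"
        using advance_big [OF p, of "line i j x y"] unfolding ss Gs by simp_all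
      show ?thesis
      proof (cases "t ?s \<le> 4 * t ?s'")
        case True
        then have "4 ^ y * t ?s \<le> 4 ^ y * (4 * t ?s')" by (intro mult_left_mono) auto
        then have "t x \<le> 4 ^ y * (4 * t ?s')" using tx by linarith
        then have "t x \<le> 4 ^ Suc y * t ?s'" by (simp add: mult_ac)
        then show ?thesis using IH by (auto simp: le_Suc_eq)
      next
        case False
        have "sqrt (4 * t ?s') \<le> sqrt (t ?s)" using False by (intro real_sqrt_le_mono) simp
        then have "2 * sqrt (t ?s') \<le> sqrt (t ?s)" by (simp add: real_sqrt_mult)
        then have "(sqrt (t ?s) / 2)\<^sup>2 \<le> (sqrt (t ?s) - sqrt (t ?s'))\<^sup>2"
          using t0 by (intro power_mono) auto
        then have q4: "t ?s / 4 \<le> (sqrt (t ?s) - sqrt (t ?s'))\<^sup>2"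
          using t0 by (simp add: power_divide)
        have "(?A / 4 * (?A / 4)) * (t ?s / 4) \<le> ((\<mu> * norm (G ?s)) * (\<mu> * norm (G ?s'))) * (sqrt (t ?s) - sqrt (t ?s'))\<^sup>2"
          using big q4 t0 by (intro mult_mono) auto
        also have "\<dots> = \<mu> * (\<mu> * norm (G ?s) * norm (G ?s') * (sqrt (t ?s) - sqrt (t ?s'))\<^sup>2)"
          by simp
        also have "\<dots> \<le> \<mu> * (?A * (2 * (1 + \<mu>) * excess t))"
          using excess_bounds(2) [OF sp, of ?s ?s'] pos neq by (intro mult_left_mono) auto
        finally have "?A * (?A * t ?s) \<le> ?A * (2 * (1 + \<mu>) * real (64 * \<mu>) * excess t)"
          by (simp add: algebra_simps)
        then have "?A * t ?s \<le> 2 * (1 + \<mu>) * real (64 * \<mu>) * excess t"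
          using norm_total_pos by (simp only: mult_le_cancel_left_pos)
        then have "?A * t ?s \<le> walk_const * excess t"
          by (rule order_trans [OF _ c]) (use h0 in auto)
        then show ?thesis using finish tx by blast
      qed
    qed
  qed
qed

lemma walk_line_spread:
  assumes p: "pinned i j" and x: "x \<in> Zmu \<mu>"
  shows "norm total * t x \<le> 4 ^ \<mu> * walk_const * excess t
    \<or> t x * line_spread i j x \<le> \<mu> * (4 ^ \<mu> * (2 * (1 + \<mu>) * excess t))"
proof (cases "norm total * t x \<le> 4 ^ \<mu> * walk_const * excess t")
  case False
  have pos: "\<mu> > 0" using mu by simp
  note sp = spread_nonneg [OF p]
  have "t x * spread (line i j x y) \<le> 4 ^ \<mu> * (2 * (1 + \<mu>) * excess t)" if "y < \<mu>" for y
  proof -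
    let ?s = "red \<mu> (line i j x y)"
    have ss: "spread ?s = spread (line i j x y)" by (rule spread_cong) simp
    have b: "t ?s * spread ?s \<le> 2 * (1 + \<mu>) * excess t"
      by (rule excess_bounds) (use sp pos in auto)
    have "t x \<le> 4 ^ y * t ?s" using walk [OF p x, of \<mu>] False that by auto
    then have "t x * spread ?s \<le> (4 ^ y * t ?s) * spread ?s"
      by (rule mult_right_mono) (rule sp)
    also have "\<dots> \<le> 4 ^ \<mu> * (t ?s * spread ?s)"
      using that t0 sp by (simp add: mult_right_mono power_increasing mult.assoc)
    also have "\<dots> \<le> 4 ^ \<mu> * (2 * (1 + \<mu>) * excess t)"
      using b by (intro mult_left_mono) auto
    finally show ?thesis by (simp only: ss)
  qed
  then have "(\<Sum>y<\<mu>. t x * spread (line i j x y)) \<le> real (card {..<\<mu>}) * (4 ^ \<mu> * (2 * (1 + \<mu>) * excess t))"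
    by (intro sum_bounded_above) auto
  then show ?thesis by (simp add: line_spread_def [OF p] sum_distrib_left)
qed simp

end

end

text \<open>If the flow is far from having a constant direction (\<open>|A| \<le> \<delta>\<close>), or if the walk has paid for
  \<open>t\<^sub>x |A|\<close>, the trivial bound \<open>|\<phi>(G)(x)| = O(|A| + \<delta>)\<close> suffices. Otherwise \<open>E\<close> is paid for along the
  whole line.\<close>

lemma local_estimate:
  fixes K :: "int^'d \<Rightarrow> complex^('d option)"
  assumes t0: "\<And>x. t x \<ge> 0" and t1: "(\<Sum>x\<in>Zmu \<mu>. t x) \<le> 1"
    and cancel: "\<And>i j. i \<noteq> j \<Longrightarrow>
      (\<Sum>y<\<mu>. K (red \<mu> (int y *s (gen j - gen i))) $ i
                         - K (red \<mu> (int y *s (gen j - gen i))) $ j) = 0"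
    and x: "x \<in> Zmu \<mu>"
  shows "t x * norm (\<Sum>z\<in>Zmu \<mu>. \<Sum>k\<in>UNIV. K (red \<mu> (x - z)) $ k * G z $ k)
    \<le> kernel_norm \<mu> K * (local_const * excess t)"
proof -
  let ?\<phi> = "norm (\<Sum>z\<in>Zmu \<mu>. \<Sum>k\<in>UNIV. K (red \<mu> (x - z)) $ k * G z $ k)"
  let ?\<kappa> = "kernel_norm \<mu> K"
  have \<kappa>: "?\<kappa> \<ge> 0" by (rule kernel_norm_nonneg)
  have tx: "t x \<le> 1" using t1 member_le_sum [of x "Zmu \<mu>" t] x t0 by simp
  have mass_eq: "mass = norm total + defect" by (simp add: defect_def)
  have triv: "t x * ?\<phi> \<le> ?\<kappa> * (norm total * t x + defect)"
  proof -
    have "t x * ?\<phi> \<le> t x * (?\<kappa> * mass)"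
      using t0 by (intro mult_left_mono conv_le_mass) auto
    also have "\<dots> = ?\<kappa> * (norm total * t x + t x * defect)"
      by (simp add: mass_eq algebra_simps)
    also have "\<dots> \<le> ?\<kappa> * (norm total * t x + defect)"
      using tx defect_nonneg \<kappa> mult_right_mono [of "t x" 1 defect] by (intro mult_left_mono) auto
    finally show ?thesis .
  qed
  have parts: "c * excess t \<le> local_const * excess t"
    if "c \<in> {2, 1 + 4 ^ \<mu> * walk_const, 3 * q ^ 5 * (\<mu> * (4 ^ \<mu> * (2 * (1 + \<mu>))))}" "excess t \<ge> 0" for c
  proof (rule mult_right_mono)
    show "c \<le> local_const" using that(1) local_const_parts unfolding local_const_def by auto
  qed (use that in simp)
  show ?thesis
  proof (cases "total = 0")
    case True
    then have "excess t = (\<mu> + 1) * defect - (\<Sum>x\<in>Zmu \<mu>. norm (G x) * sqrt (real \<mu> * t x))"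
      by (simp add: excess_def)
    moreover have "(\<Sum>x\<in>Zmu \<mu>. norm (G x) * sqrt (real \<mu> * t x)) \<le> (\<Sum>x\<in>Zmu \<mu>. norm (G x) * \<mu>)"
    proof (intro sum_mono mult_left_mono)
      fix z :: "int^'d" assume "z \<in> Zmu \<mu>"
      then have "t z \<le> 1" using t1 member_le_sum [of z "Zmu \<mu>" t] t0 by simp
      then have "real \<mu> * t z \<le> real \<mu> * real \<mu>" using mu by (intro mult_left_mono) auto
      then show "sqrt (real \<mu> * t z) \<le> real \<mu>"
        by (intro real_le_lsqrt) (auto simp: power2_eq_square t0)
    qed simp
    moreover have "(\<Sum>x\<in>Zmu \<mu>. norm (G x) * \<mu>) = \<mu> * defect"
      using True by (simp add: defect_def mass_def sum_distrib_left mult.commute)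
    ultimately have ex: "excess t \<ge> defect" by (simp add: algebra_simps)
    have "t x * ?\<phi> \<le> ?\<kappa> * defect" using triv True by simp
    also have "\<dots> \<le> ?\<kappa> * (local_const * excess t)"
      using parts [of 2] ex defect_nonneg \<kappa> by (intro mult_left_mono) auto
    finally show ?thesis .
  next
    case False
    then obtain i j where p: "pinned i j" by (rule ex_pinned)
    note sp = spread_nonneg [OF p]
    obtain s where "s \<in> Zmu \<mu>" "s \<noteq> x"
      using shift_neq [of "Some undefined" None x] mu red_Zmu [OF x] red_in_Zmu
      by (metis less_le_trans option.distinct(1) zero_less_numeral)
    then have ex: "excess t \<ge> defect" using excess_master(1) [OF t0 t1 sp x] by blast
    show ?thesis
    proof (cases "defect < norm total")
      case False
      have "norm total * t x + defect \<le> 2 * excess t"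
        using False ex tx mult_left_mono [OF tx, of "norm total"] by simp
      then have "norm total * t x + defect \<le> local_const * excess t"
        using parts [of 2] ex defect_nonneg by force
      then have "?\<kappa> * (norm total * t x + defect) \<le> ?\<kappa> * (local_const * excess t)"
        using \<kappa> by (rule mult_left_mono)
      then show ?thesis using triv by linarith
    next
      case True
      from walk_line_spread [OF t0 t1 True p x] show ?thesis
      proof
        assume "norm total * t x \<le> 4 ^ \<mu> * walk_const * excess t"
        then have "norm total * t x + defect \<le> (1 + 4 ^ \<mu> * walk_const) * excess t"
          using ex by (simp add: algebra_simps)
        then have "norm total * t x + defect \<le> local_const * excess t"
          using parts [of "1 + 4 ^ \<mu> * walk_const"] ex defect_nonneg by force
        then have "?\<kappa> * (norm total * t x + defect) \<le> ?\<kappa> * (local_const * excess t)"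
          using \<kappa> by (rule mult_left_mono)
        then show ?thesis using triv by linarith
      next
        assume *: "t x * line_spread i j x \<le> \<mu> * (4 ^ \<mu> * (2 * (1 + \<mu>) * excess t))"
        have "t x * ?\<phi> \<le> t x * (?\<kappa> * (3 * q ^ 5 * line_spread i j x))"
          using t0 ij [OF p] by (intro mult_left_mono conv_le_line_spread [OF p] cancel) auto
        also have "\<dots> = ?\<kappa> * (3 * q ^ 5) * (t x * line_spread i j x)" by simp
        also have "\<dots> \<le> ?\<kappa> * (3 * q ^ 5) * (\<mu> * (4 ^ \<mu> * (2 * (1 + \<mu>) * excess t)))"
          using \<kappa> q_ge1 * by (intro mult_left_mono) auto
        also have "\<dots> = ?\<kappa> * (3 * q ^ 5 * (\<mu> * (4 ^ \<mu> * (2 * (1 + \<mu>)))) * excess t)"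
          by (simp add: algebra_simps)
        also have "\<dots> \<le> ?\<kappa> * (local_const * excess t)"
          using \<kappa> ex defect_nonneg by (intro mult_left_mono parts) auto
        finally show ?thesis .
      qed
    qed
  qed
qed

end

text \<open>The homogeneous form of \<open>local_estimate\<close>, summed over \<open>x\<close>. Keeping \<open>\<Theta>\<close> apart from the sum of
  the weights lets one potential, with \<open>\<Theta>\<close> the supremum in the theorem, serve on all atoms.\<close>

theorem flow_estimate:
  fixes \<mu> :: nat and K :: "int^'d \<Rightarrow> complex^('d option)"
  assumes mu: "\<mu> \<ge> 2"
    and cancel: "\<And>i j. i \<noteq> j \<Longrightarrow>
      (\<Sum>y<\<mu>. K (red \<mu> (int y *s (gen j - gen i))) $ i
                         - K (red \<mu> (int y *s (gen j - gen i))) $ j) = 0"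
  obtains C :: real where "C \<ge> 0"
    "\<And>G (\<Theta> :: real) (t :: int^'d \<Rightarrow> real). torus_flow \<mu> G (real CARD('d option)) \<Longrightarrow> (\<And>x. x \<in> Zmu \<mu> \<Longrightarrow> t x \<ge> 0) \<Longrightarrow>
      (\<Sum>x\<in>Zmu \<mu>. t x) \<le> \<Theta> \<Longrightarrow>
      (\<Sum>x\<in>Zmu \<mu>. t x * norm (\<Sum>z\<in>Zmu \<mu>. \<Sum>k\<in>UNIV. K (red \<mu> (x - z)) $ k * G z $ k))
      \<le> C * (norm (\<Sum>x\<in>Zmu \<mu>. G x) * sqrt (\<Theta> * (\<Sum>x\<in>Zmu \<mu>. t x))
             - (\<Sum>x\<in>Zmu \<mu>. norm (G x) * sqrt (\<Theta> * (\<mu> * t x)))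
             + (\<mu> + 1) * \<Theta> * ((\<Sum>x\<in>Zmu \<mu>. norm (G x)) - norm (\<Sum>x\<in>Zmu \<mu>. G x)))"
proof -
  let ?q = "real CARD('d option)"
  let ?m = "real (card (Zmu \<mu> :: (int^'d) set))"
  define C where "C = ?m * (kernel_norm \<mu> K * torus_flow.local_const \<mu> ?q)"
  have "torus_flow \<mu> (\<lambda>_ :: int^'d. 0 :: complex^('d option)) ?q"
    by unfold_locales (use mu in auto)
  from torus_flow.local_const_nonneg [OF this] have C0: "C \<ge> 0"
    unfolding C_def by (intro mult_nonneg_nonneg kernel_norm_nonneg) auto
  have "(\<Sum>x\<in>Zmu \<mu>. t x * norm (\<Sum>z\<in>Zmu \<mu>. \<Sum>k\<in>UNIV. K (red \<mu> (x - z)) $ k * G z $ k))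
      \<le> C * (norm (\<Sum>x\<in>Zmu \<mu>. G x) * sqrt (\<Theta> * (\<Sum>x\<in>Zmu \<mu>. t x))
             - (\<Sum>x\<in>Zmu \<mu>. norm (G x) * sqrt (\<Theta> * (\<mu> * t x)))
             + (\<mu> + 1) * \<Theta> * ((\<Sum>x\<in>Zmu \<mu>. norm (G x)) - norm (\<Sum>x\<in>Zmu \<mu>. G x)))"
    (is "?L \<le> C * ?R")
    if G: "torus_flow \<mu> G ?q" and t: "\<And>x. x \<in> Zmu \<mu> \<Longrightarrow> t x \<ge> 0"
      and \<Theta>: "(\<Sum>x\<in>Zmu \<mu>. t x) \<le> \<Theta>" for G :: "int^'d \<Rightarrow> complex^('d option)" and \<Theta> :: real and t :: "int^'d \<Rightarrow> real"
  proof (cases "\<Theta> = 0")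
    case True
    have "(\<Sum>x\<in>Zmu \<mu>. t x) = 0"
      using t \<Theta> True by (meson order_antisym sum_nonneg)
    then have "\<forall>x\<in>Zmu \<mu>. t x = 0"
      using t by (subst (asm) sum_nonneg_eq_0_iff) auto
    then show ?thesis using True by simp
  next
    case False
    interpret torus_flow \<mu> G ?q by (rule G)
    have pos: "\<Theta> > 0" using False t \<Theta> sum_nonneg [of "Zmu \<mu>" t] by force
    define t' where "t' x = t (red \<mu> x) / \<Theta>" for x
    have t': "t' x \<ge> 0" for x using t mu pos by (simp add: t'_def)
    have tZ: "t x = \<Theta> * t' x" if "x \<in> Zmu \<mu>" for x
      using that pos by (simp add: t'_def red_Zmu)
    have st: "(\<Sum>x\<in>Zmu \<mu>. t x) = \<Theta> * (\<Sum>x\<in>Zmu \<mu>. t' x)"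
      by (simp add: tZ sum_distrib_left)
    have t'1: "(\<Sum>x\<in>Zmu \<mu>. t' x) \<le> 1"
      using \<Theta> pos unfolding st by (simp add: mult_le_cancel_left2)
    have s2: "sqrt (\<Theta> * (\<Theta> * c)) = \<Theta> * sqrt c" for c
      using pos by (simp add: real_sqrt_mult mult.assoc [symmetric])
    have "?R = \<Theta> * excess t'"
    proof -
      have "(\<Sum>x\<in>Zmu \<mu>. norm (G x) * sqrt (\<Theta> * (\<mu> * t x))) = \<Theta> * (\<Sum>x\<in>Zmu \<mu>. norm (G x) * sqrt (real \<mu> * t' x))"
        unfolding sum_distrib_left
      proof (rule sum.cong [OF refl])
        fix x :: "int^'d" assume "x \<in> Zmu \<mu>"
        then show "norm (G x) * sqrt (\<Theta> * (\<mu> * t x)) = \<Theta> * (norm (G x) * sqrt (real \<mu> * t' x))"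
          using s2 [of "\<mu> * t' x"] by (simp add: tZ mult_ac)
      qed
      then show ?thesis
        unfolding st s2 by (simp add: excess_def total_def defect_def mass_def algebra_simps)
    qed
    moreover have "?L \<le> (\<Sum>x\<in>(Zmu \<mu> :: (int^'d) set). \<Theta> * (kernel_norm \<mu> K * (local_const * excess t')))"
    proof (rule sum_mono)
      fix x :: "int^'d" assume x: "x \<in> Zmu \<mu>"
      show "t x * norm (\<Sum>z\<in>Zmu \<mu>. \<Sum>k\<in>UNIV. K (red \<mu> (x - z)) $ k * G z $ k)
          \<le> \<Theta> * (kernel_norm \<mu> K * (local_const * excess t'))"
        using mult_left_mono [OF local_estimate [OF t' t'1 cancel x], of \<Theta>] pos
        by (simp add: tZ [OF x] mult.assoc)
    qed
    ultimately show ?thesis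
      by (simp add: C_def mult_ac)
  qed
  with C0 show ?thesis by (rule that)
qed

section \<open>Atoms of the filtration\<close>

lemma TT_iff: "\<gamma> \<in> TT \<mu> \<longleftrightarrow> (\<forall>k. \<gamma> k \<in> Zmu \<mu>)"
  by (simp add: TT_top_def PiE_iff)

definition cyl :: "nat \<Rightarrow> nat \<Rightarrow> (nat \<Rightarrow> int^'d) \<Rightarrow> (nat \<Rightarrow> int^'d) set" where
  "cyl \<mu> n \<delta> = {\<gamma>\<in>TT \<mu>. \<forall>k<n. \<gamma> k = \<delta> k}"

lemma AF_cyl: "AF \<mu> n = cyl \<mu> n ` TT \<mu>"
  by (auto simp: AF_def cyl_def)

lemma cyl_in_AF: "\<gamma> \<in> TT \<mu> \<Longrightarrow> cyl \<mu> n \<gamma> \<in> AF \<mu> n"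
  by (simp add: AF_cyl)

lemma self_in_cyl: "\<gamma> \<in> TT \<mu> \<Longrightarrow> \<gamma> \<in> cyl \<mu> n \<gamma>"
  by (simp add: cyl_def)

lemma AF_eq_cyl: "\<omega> \<in> AF \<mu> n \<Longrightarrow> \<gamma> \<in> \<omega> \<Longrightarrow> \<omega> = cyl \<mu> n \<gamma>"
  by (auto simp: AF_cyl cyl_def)

lemma AF_subset: "\<omega> \<in> AF \<mu> n \<Longrightarrow> \<omega> \<subseteq> TT \<mu>"
  by (auto simp: AF_cyl cyl_def)

lemma in_AF_iff: "\<omega> \<in> AF \<mu> n \<Longrightarrow> \<gamma> \<in> TT \<mu> \<Longrightarrow> \<gamma> \<in> \<omega> \<longleftrightarrow> \<omega> = cyl \<mu> n \<gamma>"
  using AF_eq_cyl self_in_cyl by blast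

text \<open>A function that is constant on an atom is evaluated at this point.\<close>

definition rep :: "'a set \<Rightarrow> 'a" where "rep \<omega> = (SOME \<gamma>. \<gamma> \<in> \<omega>)"

lemma rep_in: "\<omega> \<in> AF \<mu> n \<Longrightarrow> rep \<omega> \<in> \<omega>"
  unfolding rep_def AF_cyl using self_in_cyl by (metis imageE someI)

lemma rep_in_TT: "\<omega> \<in> AF \<mu> n \<Longrightarrow> rep \<omega> \<in> TT \<mu>"
  using rep_in AF_subset by blast

lemma zero_in_TT: "\<mu> > 0 \<Longrightarrow> (\<lambda>_. 0) \<in> TT \<mu>"
  by (simp add: TT_iff Zmu_def)

lemma AF_0: "\<mu> > 0 \<Longrightarrow> AF \<mu> 0 = {TT \<mu>}"
  using zero_in_TT by (auto simp: AF_cyl cyl_def)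

lemma kid_cyl:
  assumes "\<gamma> \<in> TT \<mu>" "x \<in> Zmu \<mu>"
  shows "kid n (cyl \<mu> n \<gamma>) x = cyl \<mu> (Suc n) (\<gamma>(n := x))" "\<gamma>(n := x) \<in> TT \<mu>"
  using assms by (auto simp: kid_def cyl_def TT_iff less_Suc_eq)

lemma kid_in_AF: "\<omega> \<in> AF \<mu> n \<Longrightarrow> x \<in> Zmu \<mu> \<Longrightarrow> kid n \<omega> x \<in> AF \<mu> (Suc n)"
  by (auto simp: AF_cyl kid_cyl)

lemma kid_subset: "kid n \<omega> x \<subseteq> \<omega>"
  by (auto simp: kid_def)

lemma bij_kid:
  "bij_betw (\<lambda>(\<omega>, x). kid n \<omega> x) (AF \<mu> n \<times> Zmu \<mu>) (AF \<mu> (Suc n) :: (nat \<Rightarrow> int^'d) set set)"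
proof -
  have "\<omega> = \<omega>' \<and> x = x'" if eq: "\<omega> \<in> AF \<mu> n" "\<omega>' \<in> AF \<mu> n" "x \<in> Zmu \<mu>" "x' \<in> Zmu \<mu>"
    "kid n \<omega> x = kid n \<omega>' x'" for \<omega> \<omega>' and x x' :: "int^'d"
  proof -
    obtain \<gamma> where "\<gamma> \<in> kid n \<omega> x"
      using rep_in [OF kid_in_AF [OF eq(1,3)]] by blast
    then have "\<gamma> \<in> \<omega>" "\<gamma> n = x" "\<gamma> \<in> \<omega>'" "\<gamma> n = x'"
      using eq(5) by (auto simp: kid_def)
    then show ?thesis using AF_eq_cyl eq(1,2) by metis
  qed
  moreover have "\<exists>\<omega>\<in>AF \<mu> n. \<exists>x\<in>Zmu \<mu>. \<omega>' = kid n \<omega> x" if "\<omega>' \<in> AF \<mu> (Suc n)" for \<omega>' :: "(nat \<Rightarrow> int^'d) set"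
  proof -
    obtain \<gamma> where \<gamma>: "\<gamma> \<in> TT \<mu>" "\<omega>' = cyl \<mu> (Suc n) \<gamma>" using \<open>\<omega>' \<in> AF \<mu> (Suc n)\<close> by (auto simp: AF_cyl)
    then have "\<omega>' = kid n (cyl \<mu> n \<gamma>) (\<gamma> n)"
      by (auto simp: kid_def cyl_def less_Suc_eq)
    then show ?thesis using \<gamma> cyl_in_AF TT_iff by blast
  qed
  ultimately show ?thesis
    by (auto simp: bij_betw_def inj_on_def kid_in_AF image_iff)
qed

lemma sum_AF_Suc: "(\<Sum>\<omega>\<in>AF \<mu> (Suc n). f \<omega>) = (\<Sum>\<omega>\<in>AF \<mu> n. \<Sum>x\<in>Zmu \<mu>. f (kid n \<omega> x))"
proof -
  have "(\<Sum>\<omega>\<in>AF \<mu> (Suc n). f \<omega>) = (\<Sum>p\<in>AF \<mu> n \<times> Zmu \<mu>. f (case p of (\<omega>, x) \<Rightarrow> kid n \<omega> x))"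
    by (rule sum.reindex_bij_betw [OF bij_kid, symmetric])
  also have "\<dots> = (\<Sum>\<omega>\<in>AF \<mu> n. \<Sum>x\<in>Zmu \<mu>. f (kid n \<omega> x))"
    unfolding sum.cartesian_product by (rule sum.cong) auto
  finally show ?thesis .
qed

lemma finite_AF [simp]: "\<mu> > 0 \<Longrightarrow> finite (AF \<mu> n :: (nat \<Rightarrow> int^'d) set set)"
proof (induction n)
  case (Suc n)
  then have "finite (AF \<mu> n \<times> Zmu \<mu> :: ((nat \<Rightarrow> int^'d) set \<times> _) set)"
    by (intro finite_cartesian_product) auto
  then show ?case using bij_betw_finite [OF bij_kid [where \<mu> = \<mu> and n = n]] by blast
qed (simp add: AF_0)

lemma sum_AF_indicator:
  fixes f :: "(nat \<Rightarrow> int^'d) set \<Rightarrow> 'b::real_vector"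
  assumes "\<mu> > 0" "\<gamma> \<in> TT \<mu>"
  shows "(\<Sum>\<omega>\<in>AF \<mu> n. indicator \<omega> \<gamma> *\<^sub>R f \<omega>) = f (cyl \<mu> n \<gamma>)"
proof -
  have "(\<Sum>\<omega>\<in>AF \<mu> n. indicator \<omega> \<gamma> *\<^sub>R f \<omega>) = (\<Sum>\<omega>\<in>AF \<mu> n. if \<omega> = cyl \<mu> n \<gamma> then f \<omega> else 0)"
    by (rule sum.cong) (use in_AF_iff assms(2) in \<open>auto simp: indicator_def\<close>)
  then show ?thesis using assms cyl_in_AF [OF assms(2), of n] by simp
qed

text \<open>Measurability with respect to the finite algebra of level \<open>n\<close>, as a pointwise condition: the
  function depends on the first \<open>n\<close> digits only.\<close>

definition level :: "nat \<Rightarrow> nat \<Rightarrow> ((nat \<Rightarrow> int^'d) \<Rightarrow> 'b) \<Rightarrow> bool" where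
  "level \<mu> n f \<longleftrightarrow> (\<forall>\<gamma>\<in>TT \<mu>. \<forall>\<gamma>'\<in>TT \<mu>. (\<forall>k<n. \<gamma> k = \<gamma>' k) \<longrightarrow> f \<gamma> = f \<gamma>')"

lemma levelD:
  "level \<mu> n f \<Longrightarrow> \<gamma> \<in> TT \<mu> \<Longrightarrow> \<gamma>' \<in> TT \<mu> \<Longrightarrow> (\<And>k. k < n \<Longrightarrow> \<gamma> k = \<gamma>' k) \<Longrightarrow> f \<gamma> = f \<gamma>'"
  unfolding level_def by blast

lemma level_compose2:
  fixes f :: "(nat \<Rightarrow> int^'d) \<Rightarrow> 'b" and g :: "(nat \<Rightarrow> int^'d) \<Rightarrow> 'c"
  assumes "level \<mu> n f" "level \<mu> n g"
  shows "level \<mu> n (\<lambda>\<gamma>. h (f \<gamma>) (g \<gamma>))"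
  unfolding level_def
proof (intro ballI impI)
  fix \<gamma> \<gamma>' :: "nat \<Rightarrow> int^'d"
  assume \<gamma>: "\<gamma> \<in> TT \<mu>" "\<gamma>' \<in> TT \<mu>" "\<forall>k<n. \<gamma> k = \<gamma>' k"
  have "f \<gamma> = f \<gamma>'" using \<gamma> by (intro levelD [OF assms(1)]) blast+
  moreover have "g \<gamma> = g \<gamma>'" using \<gamma> by (intro levelD [OF assms(2)]) blast+
  ultimately show "h (f \<gamma>) (g \<gamma>) = h (f \<gamma>') (g \<gamma>')" by (simp only:)
qed

lemma level_compose: "level \<mu> n f \<Longrightarrow> level \<mu> n (\<lambda>\<gamma>. h (f \<gamma>))"
  using level_compose2 [of \<mu> n f f "\<lambda>a _. h a"] by simp

lemma level_mono:
  fixes f :: "(nat \<Rightarrow> int^'d) \<Rightarrow> 'b"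
  assumes "level \<mu> n f" "n \<le> n'"
  shows "level \<mu> n' f"
  unfolding level_def
proof (intro ballI impI)
  fix \<gamma> \<gamma>' :: "nat \<Rightarrow> int^'d" assume "\<gamma> \<in> TT \<mu>" "\<gamma>' \<in> TT \<mu>" "\<forall>k<n'. \<gamma> k = \<gamma>' k"
  then show "f \<gamma> = f \<gamma>'"
    using assms(2) levelD [OF assms(1), of \<gamma> \<gamma>'] by (meson order_less_le_trans)
qed

lemma level_rep:
  assumes "level \<mu> n f" "\<omega> \<in> AF \<mu> n" "\<gamma> \<in> \<omega>"
  shows "f (rep \<omega>) = f \<gamma>"
proof -
  have "rep \<omega> \<in> cyl \<mu> n \<gamma>"
    using rep_in [OF assms(2)] AF_eq_cyl [OF assms(2,3)] by simp
  then show ?thesis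
    using AF_subset [OF assms(2)] assms(3) by (intro levelD [OF assms(1)]) (auto simp: cyl_def)
qed

lemma AF_in_Pow: "AF \<mu> n \<subseteq> Pow (TT \<mu>)"
  using AF_subset by auto

lemma space_filt: "space (filt \<mu> n) = TT \<mu>"
  by (simp add: filt_def space_measure_of AF_in_Pow)

lemma sets_filt: "sets (filt \<mu> n) = sigma_sets (TT \<mu>) (AF \<mu> n)"
  by (simp add: filt_def sets_measure_of AF_in_Pow)

lemma filt_set_level:
  fixes A :: "(nat \<Rightarrow> int^'d) set"
  assumes "A \<in> sets (filt \<mu> n)"
  shows "level \<mu> n (\<lambda>\<gamma>. \<gamma> \<in> A)"
  unfolding level_def
proof (intro ballI impI)
  fix \<gamma> \<gamma>' :: "nat \<Rightarrow> int^'d" assume \<gamma>: "\<gamma> \<in> TT \<mu>" "\<gamma>' \<in> TT \<mu>" "\<forall>k<n. \<gamma> k = \<gamma>' k"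
  from assms have "A \<in> sigma_sets (TT \<mu>) (AF \<mu> n)" by (simp only: sets_filt)
  then show "\<gamma> \<in> A \<longleftrightarrow> \<gamma>' \<in> A"
  proof induction
    case (Basic A)
    then show ?case using \<gamma> by (auto simp: AF_cyl cyl_def)
  next
    case (Compl A)
    then show ?case using \<gamma>(1,2) by blast
  next
    case (Union A)
    then show ?case by blast
  qed simp
qed

lemma measurable_filt_level:
  fixes f :: "(nat \<Rightarrow> int^'d) \<Rightarrow> 'b::t1_space"
  assumes "f \<in> borel_measurable (filt \<mu> n)"
  shows "level \<mu> n f"
  unfolding level_def
proof (intro ballI impI)
  fix \<gamma> \<gamma>' :: "nat \<Rightarrow> int^'d" assume \<gamma>: "\<gamma> \<in> TT \<mu>" "\<gamma>' \<in> TT \<mu>" "\<forall>k<n. \<gamma> k = \<gamma>' k"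
  have "f -` {f \<gamma>} \<inter> TT \<mu> \<in> sets (filt \<mu> n)"
    using measurable_sets [OF assms, of "{f \<gamma>}"] by (simp add: space_filt)
  from filt_set_level [OF this] \<gamma> show "f \<gamma> = f \<gamma>'"
    unfolding level_def by fastforce
qed

lemma level_measurable_filt:
  assumes "\<mu> > 0" "level \<mu> n f"
  shows "f \<in> borel_measurable (filt \<mu> n)"
proof (rule measurableI)
  fix B assume "B \<in> sets (borel :: 'b measure)"
  have "f -` B \<inter> TT \<mu> = \<Union>{\<omega>\<in>AF \<mu> n. f (rep \<omega>) \<in> B}"
  proof (intro equalityI subsetI)
    fix \<gamma> assume "\<gamma> \<in> f -` B \<inter> TT \<mu>"
    then show "\<gamma> \<in> \<Union>{\<omega>\<in>AF \<mu> n. f (rep \<omega>) \<in> B}"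
      using level_rep [OF assms(2) cyl_in_AF self_in_cyl, of \<gamma>]
      by (intro UnionI [of "cyl \<mu> n \<gamma>"]) (auto intro: self_in_cyl cyl_in_AF)
  next
    fix \<gamma> assume "\<gamma> \<in> \<Union>{\<omega>\<in>AF \<mu> n. f (rep \<omega>) \<in> B}"
    then obtain \<omega> where \<omega>: "\<omega> \<in> AF \<mu> n" "\<gamma> \<in> \<omega>" "f (rep \<omega>) \<in> B" by blast
    then show "\<gamma> \<in> f -` B \<inter> TT \<mu>"
      using level_rep [OF assms(2) \<omega>(1,2)] AF_subset [OF \<omega>(1)] by auto
  qed
  also have "\<dots> \<in> sets (filt \<mu> n)"
    by (rule sets.finite_Union) (use assms(1) in \<open>auto simp: sets_filt\<close>)
  finally show "f -` B \<inter> space (filt \<mu> n) \<in> sets (filt \<mu> n)"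
    by (simp add: space_filt)
qed simp

section \<open>Measures on the tree\<close>

lemma space_TT_borel: "space (TT_borel \<mu>) = TT \<mu>"
  by (simp add: TT_borel_def space_measure_of_conv)

lemma sets_TT_borel: "sets (TT_borel \<mu>) = sigma_sets (TT \<mu>) {U. openin (TT_top \<mu>) U}"
  unfolding TT_borel_def
proof (rule sets_measure_of, rule subsetI)
  fix U assume "U \<in> {U. openin (TT_top \<mu>) U}"
  then have "U \<subseteq> TT \<mu>" by (intro openin_subset) simp
  then show "U \<in> Pow (TT \<mu>)" by simp
qed

lemma openin_cyl:
  assumes "\<delta> \<in> TT \<mu>"
  shows "openin (TT_top \<mu>) (cyl \<mu> n \<delta>)"
proof -
  let ?X = "\<lambda>k. if k < n then {\<delta> k} else Zmu \<mu>"
  have "\<gamma> \<in> cyl \<mu> n \<delta> \<longleftrightarrow> (\<forall>k. \<gamma> k \<in> ?X k)" for \<gamma>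
  proof -
    have "(\<forall>k. \<gamma> k \<in> ?X k) \<longleftrightarrow> (\<forall>k. \<gamma> k \<in> Zmu \<mu>) \<and> (\<forall>k<n. \<gamma> k = \<delta> k)"
      using assms [unfolded TT_iff] by (metis singletonD singletonI)
    then show ?thesis by (simp add: cyl_def TT_iff)
  qed
  then have "cyl \<mu> n \<delta> = (\<Pi>\<^sub>E k\<in>UNIV. ?X k)"
    by (intro set_eqI) (simp add: PiE_iff del: if_split)
  moreover have "openin (product_topology (\<lambda>_. discrete_topology (Zmu \<mu>)) UNIV) (\<Pi>\<^sub>E k\<in>UNIV. ?X k)"
  proof (rule product_topology_basis)
    show "openin (discrete_topology (Zmu \<mu>)) (?X k)" for k
      using assms by (auto simp: TT_iff)
    have "{k. ?X k \<noteq> topspace (discrete_topology (Zmu \<mu>))} \<subseteq> {..<n}"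
      by (auto split: if_splits)
    then show "finite {k. ?X k \<noteq> topspace (discrete_topology (Zmu \<mu>))}"
      by (rule finite_subset) simp
  qed
  ultimately show ?thesis by (simp add: TT_top_def)
qed

lemma AF_sets_borel: "\<omega> \<in> AF \<mu> n \<Longrightarrow> \<omega> \<in> sets (TT_borel \<mu>)"
  unfolding sets_TT_borel AF_cyl by (auto intro!: sigma_sets.Basic openin_cyl)

lemma measure_kids:
  assumes "\<mu> > 0" "sets \<nu> = sets (TT_borel \<mu>)" "finite_measure \<nu>" and \<omega>: "\<omega> \<in> AF \<mu> n"
  shows "(\<Sum>x\<in>Zmu \<mu>. measure \<nu> (kid n \<omega> x)) = measure \<nu> \<omega>"
proof -
  interpret finite_measure \<nu> by fact
  have "\<omega> = (\<Union>x\<in>Zmu \<mu>. kid n \<omega> x)"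
    using AF_subset [OF \<omega>] by (auto simp: kid_def TT_iff)
  then have "measure \<nu> \<omega> = measure \<nu> (\<Union>x\<in>Zmu \<mu>. kid n \<omega> x)" by simp
  also have "\<dots> = (\<Sum>x\<in>Zmu \<mu>. measure \<nu> (kid n \<omega> x))"
    using kid_in_AF [OF \<omega>] AF_sets_borel assms(2)
    by (intro finite_measure_finite_Union) (auto simp: disjoint_family_on_def kid_def)
  finally show ?thesis by simp
qed

lemma nn_integral_weighted_indicators:
  assumes "finite_measure M" "finite I" "\<And>i. i \<in> I \<Longrightarrow> w i \<ge> 0" "\<And>i. i \<in> I \<Longrightarrow> A i \<in> sets M"
  shows "(\<integral>\<^sup>+\<gamma>. ennreal (\<Sum>i\<in>I. w i * indicator (A i) \<gamma>) \<partial>M) = ennreal (\<Sum>i\<in>I. w i * measure M (A i))"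
proof -
  interpret finite_measure M by fact
  have int: "has_bochner_integral M (\<lambda>\<gamma>. w i * indicator (A i) \<gamma>) (w i * measure M (A i))" if "i \<in> I" for i
    using assms(4) [OF that]
    by (intro has_bochner_integral_mult_right has_bochner_integral_real_indicator)
       (simp_all add: emeasure_eq_measure)
  have hb: "has_bochner_integral M (\<lambda>\<gamma>. \<Sum>i\<in>I. w i * indicator (A i) \<gamma>) (\<Sum>i\<in>I. w i * measure M (A i))"
    by (rule has_bochner_integral_sum) (rule int)
  have nn: "(\<Sum>i\<in>I. w i * indicator (A i) \<gamma>) \<ge> 0" for \<gamma>
    by (rule sum_nonneg) (use assms(3) in \<open>simp add: indicator_def\<close>)
  note hb' = hb [unfolded has_bochner_integral_iff]
  have "(\<integral>\<^sup>+\<gamma>. ennreal (\<Sum>i\<in>I. w i * indicator (A i) \<gamma>) \<partial>M)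
      = ennreal (\<integral>\<gamma>. (\<Sum>i\<in>I. w i * indicator (A i) \<gamma>) \<partial>M)"
    by (rule nn_integral_eq_integral [OF conjunct1 [OF hb'] AE_I2 [OF nn]])
  then show ?thesis
    by (simp only: conjunct2 [OF hb'])
qed

lemma space_TT_prob: "space (TT_prob \<mu>) = TT \<mu>"
  by (rule set_eqI) (simp only: TT_prob_def space_PiM space_uniform_count_measure TT_iff PiE_iff
      extensional_UNIV UNIV_I ball_UNIV simp_thms)

lemma prob_TT_prob:
  assumes "\<mu> > 0"
  shows "prob_space (TT_prob \<mu> :: (nat \<Rightarrow> int^'d) measure)"
proof -
  have "(0 :: int^'d) \<in> Zmu \<mu>" using assms by (simp add: Zmu_def)
  then have "prob_space (uniform_count_measure (Zmu \<mu> :: (int^'d) set))"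
    by (intro prob_space_uniform_count_measure) auto
  then show ?thesis unfolding TT_prob_def by (intro prob_space_PiM)
qed

lemma AF_TT_prob:
  fixes \<omega> :: "(nat \<Rightarrow> int^'d) set"
  assumes "\<mu> > 0" "\<omega> \<in> AF \<mu> n"
  shows "\<omega> \<in> sets (TT_prob \<mu>)" "measure (TT_prob \<mu>) \<omega> = 1 / real (\<mu> ^ CARD('d)) ^ n"
proof -
  let ?U = "uniform_count_measure (Zmu \<mu> :: (int^'d) set)"
  have ne: "(0 :: int^'d) \<in> Zmu \<mu>" using assms by (simp add: Zmu_def)
  then have "prob_space ?U"
    by (intro prob_space_uniform_count_measure) auto
  then interpret product_prob_space "\<lambda>_ :: nat. ?U" UNIV
    by (intro product_prob_spaceI)
  obtain \<delta> where \<delta>: "\<delta> \<in> TT \<mu>" "\<omega> = cyl \<mu> n \<delta>" using assms by (auto simp: AF_cyl)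
  have \<omega>: "\<omega> = prod_emb UNIV (\<lambda>_. ?U) {..<n} (\<Pi>\<^sub>E k\<in>{..<n}. {\<delta> k})"
    using \<delta> by (auto simp: prod_emb_def cyl_def TT_iff PiE_iff space_PiM space_uniform_count_measure restrict_def extensional_def)
  have s: "{\<delta> k} \<in> sets ?U" for k using \<delta> by (simp add: TT_iff sets_uniform_count_measure)
  show "\<omega> \<in> sets (TT_prob \<mu>)"
    unfolding \<omega> TT_prob_def by (rule sets_PiM_I) (auto simp: s)
  have "emeasure (TT_prob \<mu>) \<omega> = (\<Prod>k<n. emeasure ?U {\<delta> k})"
    unfolding \<omega> TT_prob_def by (rule emeasure_PiM_emb) (auto simp: s)
  also have "\<dots> = (\<Prod>k<n. ennreal (1 / real (\<mu> ^ CARD('d))))"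
    using \<delta> by (intro prod.cong) (auto simp: emeasure_uniform_count_measure TT_iff card_Zmu)
  also have "\<dots> = ennreal (1 / real (\<mu> ^ CARD('d)) ^ n)"
    by (simp add: ennreal_power power_one_over)
  finally show "measure (TT_prob \<mu>) \<omega> = 1 / real (\<mu> ^ CARD('d)) ^ n"
    by (simp add: measure_def)
qed

lemma nn_integral_level:
  fixes f :: "(nat \<Rightarrow> int^'d) \<Rightarrow> real"
  assumes "\<mu> > 0" "level \<mu> n f" "\<And>\<gamma>. \<gamma> \<in> TT \<mu> \<Longrightarrow> f \<gamma> \<ge> 0"
  shows "(\<integral>\<^sup>+\<gamma>. ennreal (f \<gamma>) \<partial>TT_prob \<mu>)
    = ennreal ((\<Sum>\<omega>\<in>AF \<mu> n. f (rep \<omega>)) / real (\<mu> ^ CARD('d)) ^ n)"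
proof -
  interpret prob_space "TT_prob \<mu> :: (nat \<Rightarrow> int^'d) measure" using assms(1) by (rule prob_TT_prob)
  have "(\<integral>\<^sup>+\<gamma>. ennreal (f \<gamma>) \<partial>TT_prob \<mu>)
      = (\<integral>\<^sup>+\<gamma>. ennreal (\<Sum>\<omega>\<in>AF \<mu> n. f (rep \<omega>) * indicator \<omega> \<gamma>) \<partial>TT_prob \<mu>)"
  proof (rule nn_integral_cong)
    fix \<gamma> :: "nat \<Rightarrow> int^'d" assume "\<gamma> \<in> space (TT_prob \<mu>)"
    then have \<gamma>: "\<gamma> \<in> TT \<mu>" by (simp add: space_TT_prob)
    show "ennreal (f \<gamma>) = ennreal (\<Sum>\<omega>\<in>AF \<mu> n. f (rep \<omega>) * indicator \<omega> \<gamma>)"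
      using sum_AF_indicator [OF assms(1) \<gamma>, where n = n and f = "\<lambda>\<omega>. f (rep \<omega>)"]
        level_rep [OF assms(2) cyl_in_AF self_in_cyl, OF \<gamma> \<gamma>] by (simp add: mult.commute)
  qed
  also have "\<dots> = ennreal (\<Sum>\<omega>\<in>AF \<mu> n. f (rep \<omega>) * measure (TT_prob \<mu>) \<omega>)"
    using assms(1) AF_TT_prob(1) [OF assms(1)] assms(3) [OF rep_in_TT]
    by (intro nn_integral_weighted_indicators) (auto simp: finite_measure_axioms)
  also have "(\<Sum>\<omega>\<in>AF \<mu> n. f (rep \<omega>) * measure (TT_prob \<mu>) \<omega>)
      = (\<Sum>\<omega>\<in>AF \<mu> n. f (rep \<omega>)) / real (\<mu> ^ CARD('d)) ^ n"
    by (auto intro!: sum.cong simp: AF_TT_prob(2) [OF assms(1)] sum_divide_distrib)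
  finally show ?thesis .
qed

lemma integral_level:
  fixes f :: "(nat \<Rightarrow> int^'d) \<Rightarrow> 'b :: euclidean_space"
  assumes "\<mu> > 0" "level \<mu> n f"
  shows "integrable (TT_prob \<mu>) f"
    "integral\<^sup>L (TT_prob \<mu>) f = (\<Sum>\<omega>\<in>AF \<mu> n. f (rep \<omega>)) /\<^sub>R real (\<mu> ^ CARD('d)) ^ n"
proof -
  interpret prob_space "TT_prob \<mu> :: (nat \<Rightarrow> int^'d) measure" using assms(1) by (rule prob_TT_prob)
  let ?g = "\<lambda>\<gamma>. \<Sum>\<omega>\<in>AF \<mu> n. indicator \<omega> \<gamma> *\<^sub>R f (rep \<omega>)"
  have fg: "f \<gamma> = ?g \<gamma>" if "\<gamma> \<in> space (TT_prob \<mu>)" for \<gamma>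
  proof -
    have \<gamma>: "\<gamma> \<in> TT \<mu>" using that by (simp add: space_TT_prob)
    show ?thesis using sum_AF_indicator [OF assms(1) \<gamma>, where n = n and f = "\<lambda>\<omega>. f (rep \<omega>)"]
        level_rep [OF assms(2) cyl_in_AF self_in_cyl, OF \<gamma> \<gamma>] by simp
  qed
  have "has_bochner_integral (TT_prob \<mu>) ?g (\<Sum>\<omega>\<in>AF \<mu> n. measure (TT_prob \<mu>) \<omega> *\<^sub>R f (rep \<omega>))"
    using AF_TT_prob(1) [OF assms(1)]
    by (intro has_bochner_integral_sum has_bochner_integral_scaleR_left has_bochner_integral_real_indicator)
       (auto simp: emeasure_eq_measure)
  moreover have "(\<Sum>\<omega>\<in>AF \<mu> n. measure (TT_prob \<mu>) \<omega> *\<^sub>R f (rep \<omega>))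
      = (\<Sum>\<omega>\<in>AF \<mu> n. f (rep \<omega>)) /\<^sub>R real (\<mu> ^ CARD('d)) ^ n"
    by (auto intro!: sum.cong simp: AF_TT_prob(2) [OF assms(1)] scaleR_sum_right inverse_eq_divide)
  ultimately have "has_bochner_integral (TT_prob \<mu>) ?g ((\<Sum>\<omega>\<in>AF \<mu> n. f (rep \<omega>)) /\<^sub>R real (\<mu> ^ CARD('d)) ^ n)"
    by (simp only:)
  then have "has_bochner_integral (TT_prob \<mu>) f ((\<Sum>\<omega>\<in>AF \<mu> n. f (rep \<omega>)) /\<^sub>R real (\<mu> ^ CARD('d)) ^ n)"
    using has_bochner_integral_cong [of "TT_prob \<mu>" "TT_prob \<mu>" ?g f _ _, OF refl fg [symmetric] refl]
    by blast
  then show "integrable (TT_prob \<mu>) f"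
    "integral\<^sup>L (TT_prob \<mu>) f = (\<Sum>\<omega>\<in>AF \<mu> n. f (rep \<omega>)) /\<^sub>R real (\<mu> ^ CARD('d)) ^ n"
    by (auto simp: has_bochner_integral_iff)
qed

section \<open>Divergence-free functions as flows\<close>

lemma sum_option: "(\<Sum>k\<in>UNIV. f k) = f None + (\<Sum>j\<in>UNIV. f (Some j))" for f :: "'d::finite option \<Rightarrow> 'b::comm_monoid_add"
  by (simp add: UNIV_option_conv sum.reindex)

definition lift :: "complex^'d \<Rightarrow> complex^('d option)" where
  "lift v = (\<chi> k. case k of None \<Rightarrow> - (\<Sum>j\<in>UNIV. v $ j) | Some j \<Rightarrow> v $ j)"

lemma lift_nth [simp]: "lift v $ None = - (\<Sum>j\<in>UNIV. v $ j)" "lift v $ Some j = v $ j"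
  by (simp_all add: lift_def)

lemma lift_add: "lift (v + w) = lift v + lift w"
  by (simp add: vec_eq_iff lift_def sum.distrib split: option.split)

lemma lift_0 [simp]: "lift 0 = 0"
  by (simp add: vec_eq_iff lift_def split: option.split)

lemma lift_sum: "finite S \<Longrightarrow> lift (\<Sum>x\<in>S. f x) = (\<Sum>x\<in>S. lift (f x))"
  by (induction S rule: finite_induct) (simp_all add: lift_add)

lemma norm_lift: "norm (lift v) \<le> 2 * real CARD('d) * norm v" for v :: "complex^'d"
proof -
  have "norm (lift v) \<le> (\<Sum>k\<in>UNIV. norm (lift v $ k))"
    unfolding norm_vec_def by (rule L2_set_le_sum) simp
  also have "\<dots> \<le> 2 * (\<Sum>j\<in>UNIV. norm (v $ j))"
    by (simp add: sum_option norm_sum)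
  also have "\<dots> \<le> 2 * (\<Sum>j\<in>(UNIV :: 'd set). norm v)"
    by (intro mult_left_mono sum_mono Finite_Cartesian_Product.norm_nth_le) simp
  finally show ?thesis by simp
qed

lemma torus_flow_lift:
  fixes g :: "int^'d \<Rightarrow> complex^'d"
  assumes "\<mu> \<ge> 2" "g \<in> W_div \<mu>"
  shows "torus_flow \<mu> (\<lambda>x. lift (v + g (red \<mu> x))) (real CARD('d option))"
proof
  fix x :: "int^'d"
  have "\<forall>x\<in>Zmu \<mu>. (\<Sum>j\<in>UNIV. g (red \<mu> (x + axis j 1)) $ j - g x $ j) = 0"
    using assms(2) by (simp add: W_div_def)
  then have "(\<Sum>j\<in>UNIV. g (red \<mu> (red \<mu> x + axis j 1)) $ j - g (red \<mu> x) $ j) = 0"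
    by (rule bspec) (use assms(1) in simp)
  then show "(\<Sum>k\<in>UNIV. lift (v + g (red \<mu> (x + gen k))) $ k) = 0"
    by (simp add: sum_option gen_def sum.distrib sum_subtractf)
qed (use assms(1) in \<open>simp_all add: sum_option\<close>)

definition extend_kernel :: "(int^'d \<Rightarrow> complex^'d) \<Rightarrow> int^'d \<Rightarrow> complex^('d option)" where
  "extend_kernel K z = (\<chi> k. case k of None \<Rightarrow> 0 | Some j \<Rightarrow> K z $ j)"

lemma extend_kernel_nth [simp]: "extend_kernel K z $ None = 0" "extend_kernel K z $ Some j = K z $ j"
  by (simp_all add: extend_kernel_def)

lemma conv_op_lift:
  assumes "\<mu> > 0" "(\<Sum>x\<in>Zmu \<mu>. K x) = 0"
  shows "(\<Sum>z\<in>Zmu \<mu>. \<Sum>k\<in>UNIV. extend_kernel K (red \<mu> (x - z)) $ k * lift (v + g (red \<mu> z)) $ k)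
    = conv_op \<mu> K g x"
proof -
  have "(\<Sum>z\<in>Zmu \<mu>. K (red \<mu> (x - z))) = 0"
    using assms sum_Zmu_reflect [OF assms(1), of K x] by simp
  then have "(\<Sum>z\<in>Zmu \<mu>. K (red \<mu> (x - z)) $ j) = 0" for j
    by (metis sum_component zero_index)
  then have "(\<Sum>z\<in>Zmu \<mu>. \<Sum>j\<in>UNIV. K (red \<mu> (x - z)) $ j * v $ j) = 0"
    by (subst sum.swap) (simp add: sum_distrib_right [symmetric])
  then show ?thesis
    by (simp add: sum_option conv_op_def pairing_def distrib_left sum.distrib red_Zmu)
qed

lemma sum_int_lessThan: "(\<Sum>y\<in>{0..<int n}. f y) = (\<Sum>y<n. f (int y))"
  by (rule sum.reindex_bij_witness [of _ int nat]) auto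

lemma sum_line_reflect:
  assumes "\<mu> > 0"
  shows "(\<Sum>y<\<mu>. f (red \<mu> (- int y *s v))) = (\<Sum>y<\<mu>. f (red \<mu> (int y *s v)))"
proof -
  have inv: "(\<mu> - (\<mu> - y) mod \<mu>) mod \<mu> = y" if "y < \<mu>" for y
    using that by (cases "y = 0") auto
  show ?thesis
  proof (rule sum.reindex_bij_witness [of _ "\<lambda>y. (\<mu> - y) mod \<mu>" "\<lambda>y. (\<mu> - y) mod \<mu>"])
    fix y assume "y \<in> {..<\<mu>}"
    then have y: "y < \<mu>" by simp
    show "(\<mu> - (\<mu> - y) mod \<mu>) mod \<mu> = y"
      using y by (rule inv)
    show "(\<mu> - y) mod \<mu> \<in> {..<\<mu>}" using assms by simp
    have "int ((\<mu> - y) mod \<mu>) mod int \<mu> = (- int y) mod int \<mu>"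
      using y by (simp add: zmod_int of_nat_diff mod_simps)
    then have "(int ((\<mu> - y) mod \<mu>) * c) mod int \<mu> = (- int y * c) mod int \<mu>" for c
      by (metis mod_mult_left_eq)
    then show "f (red \<mu> (int ((\<mu> - y) mod \<mu>) *s v)) = f (red \<mu> (- int y *s v))"
      by (intro arg_cong [where f = f]) (simp add: vec_eq_iff)
  qed (use assms inv in auto)
qed

definition line_conditions :: "nat \<Rightarrow> (int^'d \<Rightarrow> complex^'d) \<Rightarrow> bool" where
  "line_conditions \<mu> K \<longleftrightarrow>
     (\<forall>j. (\<Sum>y\<in>{0..<int \<mu>}. K (red \<mu> (y *s axis j 1)) $ j) = 0) \<and>
     (\<forall>i j. i \<noteq> j \<longrightarrow>
        (\<Sum>y\<in>{0..<int \<mu>}. K (red \<mu> (y *s (axis j 1 - axis i 1))) $ j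
                         - K (red \<mu> (y *s (axis j 1 - axis i 1))) $ i) = 0)"

lemma extend_kernel_cancel:
  fixes K :: "int^'d \<Rightarrow> complex^'d"
  assumes pos: "\<mu> > 0" and K: "line_conditions \<mu> K" and "i \<noteq> j"
  shows "(\<Sum>y<\<mu>. extend_kernel K (red \<mu> (int y *s (gen j - gen i))) $ i
                - extend_kernel K (red \<mu> (int y *s (gen j - gen i))) $ j) = 0"
proof -
  have single: "(\<Sum>y<\<mu>. K (red \<mu> (int y *s axis b 1)) $ b) = 0" for b
    using K by (simp add: line_conditions_def sum_int_lessThan)
  have pair: "(\<Sum>y<\<mu>. K (red \<mu> (int y *s (axis b 1 - axis a 1))) $ b
                       - K (red \<mu> (int y *s (axis b 1 - axis a 1))) $ a) = 0" if "a \<noteq> b" for a b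
    using K that by (simp add: line_conditions_def sum_int_lessThan)
  show ?thesis
  proof (cases i)
    case None
    then obtain b where "j = Some b" using \<open>i \<noteq> j\<close> by (cases j) auto
    then show ?thesis using single [of b] None by (simp add: gen_def sum_negf)
  next
    case (Some a)
    show ?thesis
    proof (cases j)
      case None
      have "int y *s (0 - axis a 1) = - int y *s (axis a 1 :: int^'d)" for y
        by (simp add: vec_eq_iff)
      then show ?thesis
        using single [of a] None Some sum_line_reflect [OF pos, of "\<lambda>z. K z $ a" "axis a 1"]
        by (simp add: gen_def)
    next
      case (Some b)
      then show ?thesis using pair [of a b] \<open>i = Some a\<close> \<open>i \<noteq> j\<close>
        by (simp add: gen_def sum_subtractf)
    qed
  qed
qed

section \<open>Sufficiency\<close>

lemma powr_weights:
  assumes "\<mu> > 0" "D > 0"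
  shows "real (\<mu> ^ D) powr ((1 - (real D - 1) / real D) * real n) = real \<mu> ^ n"
    and "real (\<mu> ^ D) powr (- ((real D - 1) / real D) * real n) = real \<mu> ^ n / real (\<mu> ^ D) ^ n"
proof -
  have e: "(1 - (real D - 1) / real D) * real n = real n / real D"
    using assms by (simp add: field_simps)
  have base: "real (\<mu> ^ D) = real \<mu> powr real D"
    using assms by (simp add: powr_realpow)
  show *: "real (\<mu> ^ D) powr ((1 - (real D - 1) / real D) * real n) = real \<mu> ^ n"
    unfolding e base powr_powr using assms by (simp add: powr_realpow)
  have "- ((real D - 1) / real D) * real n = (1 - (real D - 1) / real D) * real n - real n"
    by (simp add: algebra_simps)
  then have "real (\<mu> ^ D) powr (- ((real D - 1) / real D) * real n)
      = real (\<mu> ^ D) powr ((1 - (real D - 1) / real D) * real n) / real (\<mu> ^ D) powr real n"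
    by (simp only: powr_diff)
  also have "\<dots> = real \<mu> ^ n / real (\<mu> ^ D) ^ n"
    unfolding * using assms by (simp add: powr_realpow)
  finally show "real (\<mu> ^ D) powr (- ((real D - 1) / real D) * real n) = real \<mu> ^ n / real (\<mu> ^ D) ^ n" .
qed

lemma martingale_level: "is_martingale \<mu> F \<Longrightarrow> level \<mu> n (F n)"
  unfolding is_martingale_def by (rule measurable_filt_level) blast

lemma mdiff_eq:
  assumes F: "\<And>n. level \<mu> n (F n)" and \<omega>: "\<omega> \<in> AF \<mu> n" and x: "x \<in> Zmu \<mu>" and \<gamma>: "\<gamma> \<in> kid n \<omega> x"
  shows "mdiff F n \<omega> x = F (Suc n) \<gamma> - F n \<gamma>"
proof -
  have "F (Suc n) \<gamma>' - F n \<gamma>' = F (Suc n) \<gamma> - F n \<gamma>" if "\<gamma>' \<in> kid n \<omega> x" for \<gamma>'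
  proof -
    have "F (Suc n) \<gamma>' = F (Suc n) \<gamma>"
      using level_rep [OF F kid_in_AF [OF \<omega> x]] that \<gamma> by metis
    moreover have "F n \<gamma>' = F n \<gamma>"
      using level_rep [OF F \<omega>] that \<gamma> kid_subset by (metis subsetD)
    ultimately show ?thesis by simp
  qed
  then have "(\<lambda>\<gamma>. F (Suc n) \<gamma> - F n \<gamma>) ` kid n \<omega> x = (\<lambda>_. F (Suc n) \<gamma> - F n \<gamma>) ` kid n \<omega> x"
    by (rule image_cong [OF refl])
  also have "\<dots> = {F (Suc n) \<gamma> - F n \<gamma>}"
    using \<gamma> by (rule image_constant)
  finally have "(\<lambda>\<gamma>. F (Suc n) \<gamma> - F n \<gamma>) ` kid n \<omega> x = {F (Suc n) \<gamma> - F n \<gamma>}" .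
  then show ?thesis by (simp add: mdiff_def)
qed

lemma rep_kid:
  assumes F: "\<And>n. level \<mu> n (F n)" and \<omega>: "\<omega> \<in> AF \<mu> n" and x: "x \<in> Zmu \<mu>"
  shows "F (Suc n) (rep (kid n \<omega> x)) = F n (rep \<omega>) + mdiff F n \<omega> x"
proof -
  have r: "rep (kid n \<omega> x) \<in> kid n \<omega> x" using rep_in [OF kid_in_AF [OF \<omega> x]] .
  then have "F n (rep \<omega>) = F n (rep (kid n \<omega> x))"
    using level_rep [OF F \<omega>] kid_subset by (metis subsetD)
  then show ?thesis using mdiff_eq [of \<mu> F, OF F \<omega> x r] by simp
qed

lemma lift_scaleR: "lift (c *\<^sub>R v) = c *\<^sub>R lift v"
  by (simp add: vec_eq_iff lift_def scaleR_sum_right split: option.split)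

text \<open>The integral of a function of level \<open>n\<close>, given by its values on the atoms.\<close>

definition atom_sum :: "nat \<Rightarrow> nat \<Rightarrow> ((nat \<Rightarrow> int^'d) set \<Rightarrow> real) \<Rightarrow> real" where
  "atom_sum \<mu> n h = (\<Sum>\<omega>\<in>AF \<mu> n. h \<omega>) / real (\<mu> ^ CARD('d)) ^ n"

lemma atom_sum_Suc:
  fixes h :: "(nat \<Rightarrow> int^'d) set \<Rightarrow> real"
  assumes "\<mu> > 0"
  shows "atom_sum \<mu> n (\<lambda>\<omega>. \<Sum>x\<in>Zmu \<mu>. h (kid n \<omega> x)) = real (\<mu> ^ CARD('d)) * atom_sum \<mu> (Suc n) h"
  using assms by (simp add: atom_sum_def sum_AF_Suc)

lemma atom_sum_linear:
  "atom_sum \<mu> n (\<lambda>\<omega>. c * (b * u \<omega> - v \<omega> + e * (s \<omega> - b * r \<omega>)))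
    = c * (b * atom_sum \<mu> n u - atom_sum \<mu> n v + e * (atom_sum \<mu> n s - b * atom_sum \<mu> n r))"
proof -
  have "(\<Sum>\<omega>\<in>AF \<mu> n. c * (b * u \<omega> - v \<omega> + e * (s \<omega> - b * r \<omega>)))
      = c * (b * sum u (AF \<mu> n) - sum v (AF \<mu> n) + e * (sum s (AF \<mu> n) - b * sum r (AF \<mu> n)))"
    by (simp only: sum_distrib_left [symmetric] sum.distrib sum_subtractf)
  then show ?thesis
    by (simp only: atom_sum_def divide_inverse) (simp only: algebra_simps)
qed

text \<open>Here \<open>P\<close> is the potential and \<open>Q\<close> the \<open>L\<^sub>1\<close> norm at level \<open>n\<close>, both for the lifted martingale. The
  inequality on one atom bounds level \<open>n\<close> by a multiple of
  \<open>P\<^sub>n - P\<^sub>n\<^sub>+\<^sub>1 + (\<mu> + 1) a (Q\<^sub>n\<^sub>+\<^sub>1 - Q\<^sub>n)\<close>, and \<open>0 \<le> P\<^sub>n\<close>, \<open>P\<^sub>0 \<le> a Q\<^sub>0\<close>. The martingale property enters as the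
  zero sum of the differences.\<close>

theorem telescoped_bound:
  fixes \<mu> :: nat and K :: "int^'d \<Rightarrow> complex^'d"
  assumes mu: "\<mu> \<ge> 2" and K0: "(\<Sum>x\<in>Zmu \<mu>. K x) = 0" and cond: "line_conditions \<mu> K"
  obtains C :: real where "C \<ge> 0"
    "\<And>(F :: nat \<Rightarrow> (nat \<Rightarrow> int^'d) \<Rightarrow> complex^'d) (\<nu> :: (nat \<Rightarrow> int^'d) measure) a N.
      (\<And>n. level \<mu> n (F n)) \<Longrightarrow> (\<And>n \<omega>. \<omega> \<in> AF \<mu> n \<Longrightarrow> mdiff F n \<omega> \<in> W_div \<mu>) \<Longrightarrow>
      sets \<nu> = sets (TT_borel \<mu>) \<Longrightarrow> finite_measure \<nu> \<Longrightarrow>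
      (\<And>n \<omega>. \<omega> \<in> AF \<mu> n \<Longrightarrow> real \<mu> ^ n * measure \<nu> \<omega> \<le> a) \<Longrightarrow>
      (\<Sum>n<N. atom_sum \<mu> n (\<lambda>\<omega>. \<Sum>x\<in>Zmu \<mu>. real \<mu> ^ n * measure \<nu> (kid n \<omega> x) * norm (conv_op \<mu> K (mdiff F n \<omega>) x)))
      \<le> C * a * (atom_sum \<mu> 0 (\<lambda>\<omega>. norm (F 0 (rep \<omega>))) + atom_sum \<mu> N (\<lambda>\<omega>. norm (F N (rep \<omega>))))"
proof -
  have pos: "\<mu> > 0" using mu by simp
  let ?m = "real (\<mu> ^ CARD('d))"
  have m0: "?m > 0" using pos by simp
  obtain C where C: "C \<ge> 0"
    "\<And>G (\<Theta> :: real) (t :: int^'d \<Rightarrow> real). torus_flow \<mu> G (real CARD('d option)) \<Longrightarrow> (\<And>x. x \<in> Zmu \<mu> \<Longrightarrow> t x \<ge> 0) \<Longrightarrow>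
      (\<Sum>x\<in>Zmu \<mu>. t x) \<le> \<Theta> \<Longrightarrow>
      (\<Sum>x\<in>Zmu \<mu>. t x * norm (\<Sum>z\<in>Zmu \<mu>. \<Sum>k\<in>UNIV. extend_kernel K (red \<mu> (x - z)) $ k * G z $ k))
      \<le> C * (norm (\<Sum>x\<in>Zmu \<mu>. G x) * sqrt (\<Theta> * (\<Sum>x\<in>Zmu \<mu>. t x))
             - (\<Sum>x\<in>Zmu \<mu>. norm (G x) * sqrt (\<Theta> * (\<mu> * t x)))
             + (\<mu> + 1) * \<Theta> * ((\<Sum>x\<in>Zmu \<mu>. norm (G x)) - norm (\<Sum>x\<in>Zmu \<mu>. G x)))"
    using flow_estimate [OF mu, of "extend_kernel K"] extend_kernel_cancel [OF pos cond] by blast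
  define D where "D = C * ?m * (real \<mu> + 1) * (2 * real CARD('d))"
  show ?thesis
  proof (rule that [of D])
    show "D \<ge> 0" using C(1) by (simp add: D_def)
    fix F :: "nat \<Rightarrow> (nat \<Rightarrow> int^'d) \<Rightarrow> complex^'d" and \<nu> :: "(nat \<Rightarrow> int^'d) measure" and a N
    assume F: "\<And>n. level \<mu> n (F n)" and W: "\<And>n \<omega>. \<omega> \<in> AF \<mu> n \<Longrightarrow> mdiff F n \<omega> \<in> W_div \<mu>"
      and \<nu>: "sets \<nu> = sets (TT_borel \<mu>)" "finite_measure \<nu>"
      and a: "\<And>n \<omega>. \<omega> \<in> AF \<mu> n \<Longrightarrow> real \<mu> ^ n * measure \<nu> \<omega> \<le> a"
    define w where "w n \<omega> = real \<mu> ^ n * measure \<nu> \<omega>" for n \<omega>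
    define f where "f n \<omega> = norm (lift (F n (rep \<omega>)))" for n \<omega>
    define P where "P n = atom_sum \<mu> n (\<lambda>\<omega>. f n \<omega> * sqrt (a * w n \<omega>))" for n
    define Q where "Q n = atom_sum \<mu> n (f n)" for n
    define S where "S n = atom_sum \<mu> n (\<lambda>\<omega>. \<Sum>x\<in>Zmu \<mu>. real \<mu> ^ n * measure \<nu> (kid n \<omega> x)
      * norm (conv_op \<mu> K (mdiff F n \<omega>) x))" for n
    have w0: "w n \<omega> \<ge> 0" for n \<omega> by (simp add: w_def)
    have wa: "w n \<omega> \<le> a" if "\<omega> \<in> AF \<mu> n" for n \<omega> using a [OF that] by (simp add: w_def)
    have f0: "f n \<omega> \<ge> 0" for n \<omega> by (simp add: f_def)
    have "(TT \<mu> :: (nat \<Rightarrow> int^'d) set) \<in> AF \<mu> 0" by (simp add: AF_0 [OF pos])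
    from order_trans [OF w0 wa [OF this]] have a0: "a \<ge> 0" .
    have local: "(\<Sum>x\<in>Zmu \<mu>. real \<mu> ^ n * measure \<nu> (kid n \<omega> x) * norm (conv_op \<mu> K (mdiff F n \<omega>) x))
        \<le> C * (?m * (f n \<omega> * sqrt (a * w n \<omega>))
            - (\<Sum>x\<in>Zmu \<mu>. f (Suc n) (kid n \<omega> x) * sqrt (a * w (Suc n) (kid n \<omega> x)))
            + (\<mu> + 1) * a * ((\<Sum>x\<in>Zmu \<mu>. f (Suc n) (kid n \<omega> x)) - ?m * f n \<omega>))"
      if \<omega>: "\<omega> \<in> AF \<mu> n" for n \<omega>
    proof -
      let ?v = "F n (rep \<omega>)" and ?g = "mdiff F n \<omega>"
      let ?G = "\<lambda>x. lift (?v + ?g (red \<mu> x))"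
      let ?t = "\<lambda>x. real \<mu> ^ n * measure \<nu> (kid n \<omega> x)"
      have G: "?G x = lift (F (Suc n) (rep (kid n \<omega> x)))" if "x \<in> Zmu \<mu>" for x
        using rep_kid [of \<mu> F, OF F \<omega> that] that by (simp add: red_Zmu)
      have st: "(\<Sum>x\<in>Zmu \<mu>. ?t x) = w n \<omega>"
        using measure_kids [OF pos \<nu> \<omega>] by (simp add: w_def sum_distrib_left [symmetric])
      have "(\<Sum>x\<in>Zmu \<mu>. ?v + ?g (red \<mu> x)) = ?m *\<^sub>R ?v"
      proof -
        have "(\<Sum>x\<in>Zmu \<mu>. ?g (red \<mu> x)) = (\<Sum>x\<in>Zmu \<mu>. ?g x)"
          by (rule sum.cong) (simp_all add: red_Zmu)
        also have "\<dots> = 0" using W [OF \<omega>] by (simp add: W_div_def zero_sum_def)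
        finally show ?thesis by (simp only: sum.distrib sum_constant_scaleR card_Zmu add_0_right)
      qed
      then have tot: "(\<Sum>x\<in>Zmu \<mu>. ?G x) = ?m *\<^sub>R lift ?v"
        by (simp only: lift_sum [OF finite_Zmu, symmetric] lift_scaleR)
      have ntot: "norm (\<Sum>x\<in>Zmu \<mu>. ?G x) = ?m * f n \<omega>"
        unfolding tot f_def by simp
      have nG: "norm (?G x) = f (Suc n) (kid n \<omega> x)" if "x \<in> Zmu \<mu>" for x
        using G [OF that] by (simp only: f_def)
      have tw: "\<mu> * ?t x = w (Suc n) (kid n \<omega> x)" for x
        by (simp add: w_def)
      have "(\<Sum>x\<in>Zmu \<mu>. ?t x * norm (conv_op \<mu> K ?g x))
          = (\<Sum>x\<in>Zmu \<mu>. ?t x * norm (\<Sum>z\<in>Zmu \<mu>. \<Sum>k\<in>UNIV. extend_kernel K (red \<mu> (x - z)) $ k * ?G z $ k))"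
        by (simp only: conv_op_lift [OF pos K0])
      also have "\<dots> \<le> C * (norm (\<Sum>x\<in>Zmu \<mu>. ?G x) * sqrt (a * (\<Sum>x\<in>Zmu \<mu>. ?t x))
             - (\<Sum>x\<in>Zmu \<mu>. norm (?G x) * sqrt (a * (\<mu> * ?t x)))
             + (\<mu> + 1) * a * ((\<Sum>x\<in>Zmu \<mu>. norm (?G x)) - norm (\<Sum>x\<in>Zmu \<mu>. ?G x)))"
        by (rule C(2) [OF torus_flow_lift [OF mu W [OF \<omega>]]]) (use wa [OF \<omega>] st in simp_all)
      also have "(\<Sum>x\<in>Zmu \<mu>. norm (?G x) * sqrt (a * (\<mu> * ?t x)))
          = (\<Sum>x\<in>Zmu \<mu>. f (Suc n) (kid n \<omega> x) * sqrt (a * w (Suc n) (kid n \<omega> x)))"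
        by (rule sum.cong [OF refl]) (simp only: nG tw)
      also have "(\<Sum>x\<in>Zmu \<mu>. norm (?G x)) = (\<Sum>x\<in>Zmu \<mu>. f (Suc n) (kid n \<omega> x))"
        by (rule sum.cong [OF refl]) (simp only: nG)
      finally show ?thesis
        unfolding ntot st by (simp only: mult.assoc)
    qed
    have step: "S n \<le> C * ?m * (P n - P (Suc n) + (\<mu> + 1) * a * (Q (Suc n) - Q n))" for n
    proof -
      have "S n \<le> atom_sum \<mu> n (\<lambda>\<omega>. C * (?m * (f n \<omega> * sqrt (a * w n \<omega>))
            - (\<Sum>x\<in>Zmu \<mu>. f (Suc n) (kid n \<omega> x) * sqrt (a * w (Suc n) (kid n \<omega> x)))
            + (\<mu> + 1) * a * ((\<Sum>x\<in>Zmu \<mu>. f (Suc n) (kid n \<omega> x)) - ?m * f n \<omega>)))"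
        unfolding S_def atom_sum_def using m0
        by (intro divide_right_mono sum_mono local) auto
      also have "\<dots> = C * (?m * P n
          - atom_sum \<mu> n (\<lambda>\<omega>. \<Sum>x\<in>Zmu \<mu>. f (Suc n) (kid n \<omega> x) * sqrt (a * w (Suc n) (kid n \<omega> x)))
          + (\<mu> + 1) * a * (atom_sum \<mu> n (\<lambda>\<omega>. \<Sum>x\<in>Zmu \<mu>. f (Suc n) (kid n \<omega> x)) - ?m * Q n))"
        unfolding P_def Q_def by (rule atom_sum_linear)
      also have "\<dots> = C * (?m * P n - ?m * P (Suc n) + (\<mu> + 1) * a * (?m * Q (Suc n) - ?m * Q n))"
        unfolding P_def Q_def
        by (simp only: atom_sum_Suc [OF pos, of n "\<lambda>\<omega>. f (Suc n) \<omega> * sqrt (a * w (Suc n) \<omega>)"]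
            atom_sum_Suc [OF pos, of n "f (Suc n)"])
      also have "\<dots> = C * ?m * (P n - P (Suc n) + (\<mu> + 1) * a * (Q (Suc n) - Q n))"
        by (simp only: algebra_simps)
      finally show ?thesis .
    qed
    have "(\<Sum>n<N. S n) \<le> C * ?m * (P 0 - P N + (\<mu> + 1) * a * (Q N - Q 0))"
    proof (induction N)
      case (Suc N)
      have "(\<Sum>n<Suc N. S n) \<le> C * ?m * (P 0 - P N + (\<mu> + 1) * a * (Q N - Q 0))
          + C * ?m * (P N - P (Suc N) + (\<mu> + 1) * a * (Q (Suc N) - Q N))"
        using Suc.IH step [of N] by simp
      also have "\<dots> = C * ?m * (P 0 - P (Suc N) + (\<mu> + 1) * a * (Q (Suc N) - Q 0))"
        by (simp only: distrib_left [symmetric]) (simp add: algebra_simps)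
      finally show ?case .
    qed simp
    also have "\<dots> \<le> C * ?m * ((\<mu> + 1) * a * (Q 0 + Q N))"
    proof (intro mult_left_mono)
      have PN: "P N \<ge> 0"
        unfolding P_def atom_sum_def using m0 f0 a0 w0
        by (intro divide_nonneg_nonneg sum_nonneg mult_nonneg_nonneg) auto
      have Q0: "Q n \<ge> 0" for n
        unfolding Q_def atom_sum_def using m0 f0 by (intro divide_nonneg_nonneg sum_nonneg) auto
      have "P 0 \<le> a * Q 0"
      proof -
        have "sqrt (a * w 0 \<omega>) \<le> a" if "\<omega> \<in> AF \<mu> 0" for \<omega>
          using wa [OF that] a0 w0 [of 0 \<omega>] by (intro real_le_lsqrt) (auto simp: power2_eq_square intro: mult_left_mono)
        then have "P 0 \<le> atom_sum \<mu> 0 (\<lambda>\<omega>. f 0 \<omega> * a)"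
          unfolding P_def atom_sum_def using f0 m0
          by (intro divide_right_mono sum_mono mult_left_mono) auto
        also have "\<dots> = a * Q 0"
          by (simp add: Q_def atom_sum_def sum_distrib_right [symmetric])
        finally show ?thesis .
      qed
      moreover have "a * Q 0 \<le> (\<mu> + 1) * a * (2 * Q 0)"
        using mult_right_mono [of 1 "2 * (real \<mu> + 1)" "a * Q 0"] a0 Q0 [of 0] by (simp add: algebra_simps)
      moreover have "(\<mu> + 1) * a * (Q 0 + Q N) = (\<mu> + 1) * a * (Q N - Q 0) + (\<mu> + 1) * a * (2 * Q 0)"
        by (simp add: algebra_simps)
      ultimately show "P 0 - P N + (\<mu> + 1) * a * (Q N - Q 0) \<le> (\<mu> + 1) * a * (Q 0 + Q N)"
        using PN by linarith
    qed (use C(1) m0 in auto)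
    also have "\<dots> \<le> C * ?m * ((\<mu> + 1) * a * (2 * real CARD('d) * (atom_sum \<mu> 0 (\<lambda>\<omega>. norm (F 0 (rep \<omega>)))
        + atom_sum \<mu> N (\<lambda>\<omega>. norm (F N (rep \<omega>))))))"
    proof -
      have "Q n \<le> 2 * real CARD('d) * atom_sum \<mu> n (\<lambda>\<omega>. norm (F n (rep \<omega>)))" for n
      proof -
        have "Q n \<le> atom_sum \<mu> n (\<lambda>\<omega>. 2 * real CARD('d) * norm (F n (rep \<omega>)))"
          unfolding Q_def atom_sum_def f_def using m0 by (intro divide_right_mono sum_mono norm_lift) auto
        then show ?thesis by (simp add: atom_sum_def sum_distrib_left [symmetric])
      qed
      from add_mono [OF this [of 0] this [of N]] show ?thesis
        using C(1) m0 a0 by (intro mult_left_mono) (auto simp: distrib_left)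
    qed
    also have "\<dots> = D * a * (atom_sum \<mu> 0 (\<lambda>\<omega>. norm (F 0 (rep \<omega>))) + atom_sum \<mu> N (\<lambda>\<omega>. norm (F N (rep \<omega>))))"
      by (simp add: D_def algebra_simps)
    finally show "(\<Sum>n<N. atom_sum \<mu> n (\<lambda>\<omega>. \<Sum>x\<in>Zmu \<mu>. real \<mu> ^ n * measure \<nu> (kid n \<omega> x) * norm (conv_op \<mu> K (mdiff F n \<omega>) x)))
      \<le> D * a * (atom_sum \<mu> 0 (\<lambda>\<omega>. norm (F 0 (rep \<omega>))) + atom_sum \<mu> N (\<lambda>\<omega>. norm (F N (rep \<omega>))))"
      by (simp only: S_def)
  qed
qed

lemma sum_triple:
  assumes "\<mu> > 0"
  shows "(\<Sum>n<N. \<Sum>\<omega>\<in>AF \<mu> n. \<Sum>x\<in>Zmu \<mu>. h n \<omega> x)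
    = (\<Sum>(n, \<omega>, x)\<in>(SIGMA n:{..<N}. AF \<mu> n \<times> Zmu \<mu>). h n \<omega> x)"
proof -
  have "(\<Sum>n<N. \<Sum>\<omega>\<in>AF \<mu> n. \<Sum>x\<in>Zmu \<mu>. h n \<omega> x)
      = (\<Sum>n<N. \<Sum>p\<in>AF \<mu> n \<times> Zmu \<mu>. case p of (\<omega>, x) \<Rightarrow> h n \<omega> x)"
    by (simp only: sum.cartesian_product)
  also have "\<dots> = (\<Sum>(n, p)\<in>(SIGMA n:{..<N}. AF \<mu> n \<times> Zmu \<mu>). case p of (\<omega>, x) \<Rightarrow> h n \<omega> x)"
    by (rule sum.Sigma) (use assms in auto)
  finally show ?thesis .
qed

theorem sufficiency:
  fixes \<mu> m :: nat and \<alpha> :: real and K :: "int^'d \<Rightarrow> complex^'d"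
  assumes mu: "\<mu> \<ge> 2" and m: "m = \<mu> ^ CARD('d)" and \<alpha>: "\<alpha> = (real CARD('d) - 1) / real CARD('d)"
    and K0: "(\<Sum>x\<in>Zmu \<mu>. K x) = 0" and cond: "line_conditions \<mu> K"
  shows "\<exists>C::real. C \<ge> 0 \<and>
            (\<forall>(F :: nat \<Rightarrow> (nat \<Rightarrow> int^'d) \<Rightarrow> complex^'d) \<nu>.
               F \<in> WW \<mu> (W_div \<mu>) \<and> simple_martingale \<mu> F \<and>
               sets \<nu> = sets (TT_borel \<mu>) \<and> finite_measure \<nu> \<and>
               (SUP n. SUP \<omega>\<in>AF \<mu> n. ennreal (real m powr ((1 - \<alpha>) * real n)) * emeasure \<nu> \<omega>) < \<infinity>
               \<longrightarrow>
               (\<integral>\<^sup>+ \<gamma>. ennreal (cmod (riesz_potential \<mu> (conv_op \<mu> K) \<alpha> F \<gamma>)) \<partial>\<nu>)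
                 \<le> ennreal C *
                   (SUP n. SUP \<omega>\<in>AF \<mu> n. ennreal (real m powr ((1 - \<alpha>) * real n)) * emeasure \<nu> \<omega>) *
                   L1_norm \<mu> F)"
proof -
  have pos: "\<mu> > 0" using mu by simp
  obtain D where D: "D \<ge> 0" and core:
    "\<And>(F :: nat \<Rightarrow> (nat \<Rightarrow> int^'d) \<Rightarrow> complex^'d) (\<nu> :: (nat \<Rightarrow> int^'d) measure) a N.
      (\<And>n. level \<mu> n (F n)) \<Longrightarrow> (\<And>n \<omega>. \<omega> \<in> AF \<mu> n \<Longrightarrow> mdiff F n \<omega> \<in> W_div \<mu>) \<Longrightarrow>
      sets \<nu> = sets (TT_borel \<mu>) \<Longrightarrow> finite_measure \<nu> \<Longrightarrow>
      (\<And>n \<omega>. \<omega> \<in> AF \<mu> n \<Longrightarrow> real \<mu> ^ n * measure \<nu> \<omega> \<le> a) \<Longrightarrow>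
      (\<Sum>n<N. atom_sum \<mu> n (\<lambda>\<omega>. \<Sum>x\<in>Zmu \<mu>. real \<mu> ^ n * measure \<nu> (kid n \<omega> x) * norm (conv_op \<mu> K (mdiff F n \<omega>) x)))
      \<le> D * a * (atom_sum \<mu> 0 (\<lambda>\<omega>. norm (F 0 (rep \<omega>))) + atom_sum \<mu> N (\<lambda>\<omega>. norm (F N (rep \<omega>))))"
    using telescoped_bound [OF mu K0 cond] by blast
  show ?thesis
  proof (intro exI [of _ "2 * D"] conjI allI impI)
    show "2 * D \<ge> 0" using D by simp
    fix F :: "nat \<Rightarrow> (nat \<Rightarrow> int^'d) \<Rightarrow> complex^'d" and \<nu> :: "(nat \<Rightarrow> int^'d) measure"
    define A where "A = (SUP n. SUP \<omega>\<in>AF \<mu> n. ennreal (real m powr ((1 - \<alpha>) * real n)) * emeasure \<nu> \<omega>)"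
    define c where "c n = real \<mu> ^ n / real (\<mu> ^ CARD('d)) ^ n" for n
    define a where "a = enn2real A"
    define b where "b = enn2real (L1_norm \<mu> F)"
    assume hyp: "F \<in> WW \<mu> (W_div \<mu>) \<and> simple_martingale \<mu> F \<and>
               sets \<nu> = sets (TT_borel \<mu>) \<and> finite_measure \<nu> \<and>
               (SUP n. SUP \<omega>\<in>AF \<mu> n. ennreal (real m powr ((1 - \<alpha>) * real n)) * emeasure \<nu> \<omega>) < \<infinity>"
    then have \<nu>: "sets \<nu> = sets (TT_borel \<mu>)" "finite_measure \<nu>" by blast+
    interpret finite_measure \<nu> by (rule \<nu>(2))
    have "is_martingale \<mu> F" using hyp unfolding simple_martingale_def by blast
    then have F: "level \<mu> n (F n)" for n by (rule martingale_level)
    have W: "mdiff F n \<omega> \<in> W_div \<mu>" if "\<omega> \<in> AF \<mu> n" for n \<omega>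
      using hyp that unfolding WW_def by blast
    obtain N where N: "\<And>n \<gamma>. n \<ge> N \<Longrightarrow> \<gamma> \<in> TT \<mu> \<Longrightarrow> F n \<gamma> = F N \<gamma>"
      using hyp unfolding simple_martingale_def by blast
    have Aa: "A = ennreal a"
      using hyp unfolding a_def A_def by (simp add: less_top)
    have a0: "a \<ge> 0" by (simp add: a_def)
    have Bb: "L1_norm \<mu> F = ennreal b"
      using hyp unfolding b_def WW_def by (simp add: less_top)
    have b0: "b \<ge> 0" by (simp add: b_def)
    have wa: "real \<mu> ^ n * measure \<nu> \<omega> \<le> a" if "\<omega> \<in> AF \<mu> n" for n \<omega>
    proof -
      have "ennreal (real m powr ((1 - \<alpha>) * real n)) * emeasure \<nu> \<omega>
          \<le> (SUP \<omega>\<in>AF \<mu> n. ennreal (real m powr ((1 - \<alpha>) * real n)) * emeasure \<nu> \<omega>)"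
        by (rule SUP_upper [OF that])
      also have "\<dots> \<le> A"
        unfolding A_def by (rule SUP_upper) simp
      finally have "ennreal (real \<mu> ^ n * measure \<nu> \<omega>) \<le> ennreal a"
        unfolding Aa m \<alpha> powr_weights(1) [OF pos zero_less_card_finite]
        by (simp add: emeasure_eq_measure ennreal_mult)
      then show ?thesis using a0 by (simp add: ennreal_le_iff)
    qed
    have qb: "atom_sum \<mu> n (\<lambda>\<omega>. norm (F n (rep \<omega>))) \<le> b" for n
    proof -
      have "level \<mu> n (\<lambda>\<gamma>. norm (F n \<gamma>))"
        by (rule level_compose [OF F])
      from nn_integral_level [OF pos this]
      have "ennreal (atom_sum \<mu> n (\<lambda>\<omega>. norm (F n (rep \<omega>)))) = (\<integral>\<^sup>+\<gamma>. ennreal (norm (F n \<gamma>)) \<partial>TT_prob \<mu>)"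
        by (simp add: atom_sum_def)
      also have "\<dots> \<le> L1_norm \<mu> F"
        unfolding L1_norm_def by (rule SUP_upper) simp
      finally show ?thesis unfolding Bb using b0 by (simp add: ennreal_le_iff)
    qed
    have late: "conv_op \<mu> K (mdiff F n \<omega>) x = 0" if "n \<ge> N" "\<omega> \<in> AF \<mu> n" for n \<omega> x
    proof -
      have "mdiff F n \<omega> y = 0" if y: "y \<in> Zmu \<mu>" for y
      proof -
        have r: "rep (kid n \<omega> y) \<in> kid n \<omega> y" using rep_in [OF kid_in_AF [OF \<open>\<omega> \<in> AF \<mu> n\<close> y]] .
        have "rep (kid n \<omega> y) \<in> TT \<mu>" using rep_in_TT [OF kid_in_AF [OF \<open>\<omega> \<in> AF \<mu> n\<close> y]] .
        then have "F (Suc n) (rep (kid n \<omega> y)) = F n (rep (kid n \<omega> y))"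
          using N [of n] N [of "Suc n"] \<open>n \<ge> N\<close> by simp
        then show ?thesis using mdiff_eq [of \<mu> F, OF F \<open>\<omega> \<in> AF \<mu> n\<close> y r] by simp
      qed
      then show ?thesis by (simp add: conv_op_def pairing_def)
    qed
    let ?\<phi> = "\<lambda>n \<omega> x. conv_op \<mu> K (mdiff F n \<omega>) x"
    define I where "I = (SIGMA n:{..<N}. (AF \<mu> n :: (nat \<Rightarrow> int^'d) set set) \<times> (Zmu \<mu> :: (int^'d) set))"
    define h where "h p = (case p of (n, \<omega>, x) \<Rightarrow> c n * norm (?\<phi> n \<omega> x))" for p
    define E where "E p = (case p of (n, \<omega>, x) \<Rightarrow> kid n \<omega> x)" for p :: "nat \<times> (nat \<Rightarrow> int^'d) set \<times> (int^'d)"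
    have c0: "c n \<ge> 0" for n by (simp add: c_def)
    have pw: "real (\<mu> ^ CARD('d)) powr (- \<alpha> * real n) = c n" for n
      unfolding \<alpha> c_def by (rule powr_weights(2) [OF pos zero_less_card_finite])
    have le: "norm (riesz_potential \<mu> (conv_op \<mu> K) \<alpha> F \<gamma>) \<le> (\<Sum>p\<in>I. h p * indicator (E p) \<gamma>)" for \<gamma>
    proof -
      have "riesz_potential \<mu> (conv_op \<mu> K) \<alpha> F \<gamma>
          = (\<Sum>n<N. of_real (c n) * (\<Sum>\<omega>\<in>AF \<mu> n. \<Sum>x\<in>Zmu \<mu>. ?\<phi> n \<omega> x * indicator (kid n \<omega> x) \<gamma>))"
        unfolding riesz_potential_def pw
        by (rule suminf_finite) (auto simp: late)
      also have "norm \<dots> \<le> (\<Sum>n<N. c n * (\<Sum>\<omega>\<in>AF \<mu> n. \<Sum>x\<in>Zmu \<mu>. norm (?\<phi> n \<omega> x) * indicator (kid n \<omega> x) \<gamma>))"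
      proof (intro sum_norm_le)
        fix n
        have "norm (\<Sum>\<omega>\<in>AF \<mu> n. \<Sum>x\<in>Zmu \<mu>. ?\<phi> n \<omega> x * indicator (kid n \<omega> x) \<gamma>)
            \<le> (\<Sum>\<omega>\<in>AF \<mu> n. \<Sum>x\<in>Zmu \<mu>. norm (?\<phi> n \<omega> x) * indicator (kid n \<omega> x) \<gamma>)"
          by (intro sum_norm_le) (simp add: norm_mult indicator_def)
        then show "norm (of_real (c n) * (\<Sum>\<omega>\<in>AF \<mu> n. \<Sum>x\<in>Zmu \<mu>. ?\<phi> n \<omega> x * indicator (kid n \<omega> x) \<gamma>))
            \<le> c n * (\<Sum>\<omega>\<in>AF \<mu> n. \<Sum>x\<in>Zmu \<mu>. norm (?\<phi> n \<omega> x) * indicator (kid n \<omega> x) \<gamma>)"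
          using c0 by (simp add: norm_mult mult_left_mono)
      qed
      also have "\<dots> = (\<Sum>n<N. \<Sum>\<omega>\<in>AF \<mu> n. \<Sum>x\<in>Zmu \<mu>. c n * norm (?\<phi> n \<omega> x) * indicator (kid n \<omega> x) \<gamma>)"
        by (simp only: sum_distrib_left mult.assoc)
      also have "\<dots> = (\<Sum>p\<in>I. h p * indicator (E p) \<gamma>)"
        unfolding sum_triple [OF pos] I_def by (rule sum.cong) (auto simp: h_def E_def)
      finally show ?thesis .
    qed
    have "(\<integral>\<^sup>+ \<gamma>. ennreal (cmod (riesz_potential \<mu> (conv_op \<mu> K) \<alpha> F \<gamma>)) \<partial>\<nu>)
        \<le> (\<integral>\<^sup>+ \<gamma>. ennreal (\<Sum>p\<in>I. h p * indicator (E p) \<gamma>) \<partial>\<nu>)"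
      by (intro nn_integral_mono ennreal_leI le)
    also have "\<dots> = ennreal (\<Sum>p\<in>I. h p * measure \<nu> (E p))"
    proof (rule nn_integral_weighted_indicators [OF \<nu>(2)])
      show "finite I" unfolding I_def using pos by (intro finite_SigmaI finite_cartesian_product) auto
      show "h p \<ge> 0" for p by (auto simp: h_def c0 split: prod.split)
      show "E p \<in> sets \<nu>" if "p \<in> I" for p
        using that AF_sets_borel [OF kid_in_AF] by (auto simp: E_def I_def \<nu>(1))
    qed
    also have "(\<Sum>p\<in>I. h p * measure \<nu> (E p))
        = (\<Sum>n<N. \<Sum>\<omega>\<in>AF \<mu> n. \<Sum>x\<in>Zmu \<mu>. c n * norm (?\<phi> n \<omega> x) * measure \<nu> (kid n \<omega> x))"
      unfolding sum_triple [OF pos] I_def by (rule sum.cong) (auto simp: h_def E_def)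
    also have "\<dots> = (\<Sum>n<N. atom_sum \<mu> n (\<lambda>\<omega>. \<Sum>x\<in>Zmu \<mu>. real \<mu> ^ n * measure \<nu> (kid n \<omega> x) * norm (?\<phi> n \<omega> x)))"
      by (simp add: atom_sum_def c_def sum_divide_distrib mult_ac)
    also have "ennreal \<dots> \<le> ennreal (D * a * (atom_sum \<mu> 0 (\<lambda>\<omega>. norm (F 0 (rep \<omega>))) + atom_sum \<mu> N (\<lambda>\<omega>. norm (F N (rep \<omega>)))))"
      by (intro ennreal_leI core F W \<nu> wa)
    also have "\<dots> \<le> ennreal (D * a * (b + b))"
      using D a0 by (intro ennreal_leI mult_left_mono add_mono qb) auto
    also have "\<dots> = ennreal (2 * D) * A * L1_norm \<mu> F"
      unfolding Aa Bb using D a0 b0 by (simp add: ennreal_mult [symmetric] algebra_simps)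
    finally show "(\<integral>\<^sup>+ \<gamma>. ennreal (cmod (riesz_potential \<mu> (conv_op \<mu> K) \<alpha> F \<gamma>)) \<partial>\<nu>)
                 \<le> ennreal (2 * D) *
                   (SUP n. SUP \<omega>\<in>AF \<mu> n. ennreal (real m powr ((1 - \<alpha>) * real n)) * emeasure \<nu> \<omega>) *
                   L1_norm \<mu> F"
      by (simp only: A_def)
  qed
qed

section \<open>Necessity\<close>

lemma level_scaleR_indicator:
  assumes "A \<in> sets (filt \<mu> n)" "level \<mu> n f"
  shows "level \<mu> n (\<lambda>\<gamma>. indicator A \<gamma> *\<^sub>R f \<gamma>)"
  unfolding indicator_def by (rule level_compose2 [OF filt_set_level [OF assms(1)] assms(2)])

lemma is_martingale_if_zero_sum:
  fixes F :: "nat \<Rightarrow> (nat \<Rightarrow> int^'d) \<Rightarrow> complex^'d"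
  assumes pos: "\<mu> > 0" and F: "\<And>n. level \<mu> n (F n)"
    and zs: "\<And>n \<omega>. \<omega> \<in> AF \<mu> n \<Longrightarrow> mdiff F n \<omega> \<in> zero_sum \<mu>"
  shows "is_martingale \<mu> F"
  unfolding is_martingale_def
proof (intro allI conjI ballI)
  fix n
  show "F n \<in> borel_measurable (filt \<mu> n)" by (rule level_measurable_filt [OF pos F])
  show "integrable (TT_prob \<mu>) (F n)" by (rule integral_level(1) [OF pos F])
  fix A :: "(nat \<Rightarrow> int^'d) set" assume A: "A \<in> sets (filt \<mu> n)"
  let ?m = "real (\<mu> ^ CARD('d))"
  have m0: "?m > 0" using pos by simp
  have l: "level \<mu> n (\<lambda>\<gamma>. indicator A \<gamma> *\<^sub>R F n \<gamma>)"
    by (rule level_scaleR_indicator [OF A F])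
  have "level \<mu> (Suc n) (\<lambda>\<gamma>. \<gamma> \<in> A)"
    by (rule level_mono [OF filt_set_level [OF A]]) simp
  then have l': "level \<mu> (Suc n) (\<lambda>\<gamma>. indicator A \<gamma> *\<^sub>R F (Suc n) \<gamma>)"
    unfolding indicator_def by (rule level_compose2) (rule F)
  have kids: "(\<Sum>x\<in>Zmu \<mu>. indicator A (rep (kid n \<omega> x)) *\<^sub>R F (Suc n) (rep (kid n \<omega> x)))
      = ?m *\<^sub>R (indicator A (rep \<omega>) *\<^sub>R F n (rep \<omega>))" if \<omega>: "\<omega> \<in> AF \<mu> n" for \<omega>
  proof -
    have "(indicator A (rep (kid n \<omega> x)) :: real) = indicator A (rep \<omega>)" if "x \<in> Zmu \<mu>" for x
    proof -
      have "rep (kid n \<omega> x) \<in> \<omega>" using rep_in [OF kid_in_AF [OF \<omega> that]] kid_subset by blast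
      then show ?thesis using level_rep [OF filt_set_level [OF A] \<omega>] by (simp add: indicator_def)
    qed
    then have "(\<Sum>x\<in>Zmu \<mu>. indicator A (rep (kid n \<omega> x)) *\<^sub>R F (Suc n) (rep (kid n \<omega> x)))
        = (\<Sum>x\<in>Zmu \<mu>. indicator A (rep \<omega>) *\<^sub>R (F n (rep \<omega>) + mdiff F n \<omega> x))"
      using rep_kid [of \<mu> F, OF F \<omega>] by (intro sum.cong refl) simp
    also have "\<dots> = indicator A (rep \<omega>) *\<^sub>R (?m *\<^sub>R F n (rep \<omega>) + (\<Sum>x\<in>Zmu \<mu>. mdiff F n \<omega> x))"
      by (simp only: scaleR_sum_right [symmetric] sum.distrib sum_constant_scaleR card_Zmu)
    also have "(\<Sum>x\<in>Zmu \<mu>. mdiff F n \<omega> x) = 0" using zs [OF \<omega>] by (simp add: zero_sum_def)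
    finally show ?thesis by (simp add: mult.commute)
  qed
  let ?S = "\<Sum>\<omega>\<in>AF \<mu> n. indicator A (rep \<omega>) *\<^sub>R F n (rep \<omega>)"
  have S: "(\<Sum>\<omega>\<in>AF \<mu> n. \<Sum>x\<in>Zmu \<mu>. indicator A (rep (kid n \<omega> x)) *\<^sub>R F (Suc n) (rep (kid n \<omega> x)))
      = ?m *\<^sub>R ?S"
    unfolding scaleR_sum_right by (rule sum.cong [OF refl kids])
  have "inverse (?m ^ Suc n) * ?m = inverse (?m ^ n)" using m0 by simp
  then have "(?m *\<^sub>R ?S) /\<^sub>R ?m ^ Suc n = ?S /\<^sub>R ?m ^ n" by (simp only: scaleR_scaleR)
  then show "set_lebesgue_integral (TT_prob \<mu>) A (F (Suc n)) = set_lebesgue_integral (TT_prob \<mu>) A (F n)"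
    unfolding set_lebesgue_integral_def integral_level(2) [OF pos l] integral_level(2) [OF pos l'] sum_AF_Suc S .
qed

text \<open>An open set is the union of the countably many atoms that it contains.\<close>

lemma open_in_TT_prob:
  fixes U :: "(nat \<Rightarrow> int^'d) set"
  assumes pos: "\<mu> > 0" and U: "openin (TT_top \<mu>) U"
  shows "U \<in> sets (TT_prob \<mu>)"
proof -
  have "U = (\<Union>n. \<Union>{\<omega>\<in>AF \<mu> n. \<omega> \<subseteq> U})"
  proof (intro equalityI subsetI)
    fix \<gamma> assume \<gamma>: "\<gamma> \<in> U"
    then have T: "\<gamma> \<in> TT \<mu>" using openin_subset [OF U] by blast
    obtain X where X: "finite {i \<in> UNIV. X i \<noteq> topspace (discrete_topology (Zmu \<mu> :: (int^'d) set))}"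
      "\<gamma> \<in> Pi\<^sub>E UNIV X" "Pi\<^sub>E UNIV X \<subseteq> U"
      using U \<gamma> unfolding TT_top_def openin_product_topology_alt by blast
    obtain n where n: "\<And>i. X i \<noteq> Zmu \<mu> \<Longrightarrow> i < n"
      using finite_nat_set_iff_bounded [THEN iffD1, OF X(1)] by auto
    have "cyl \<mu> n \<gamma> \<subseteq> Pi\<^sub>E UNIV X"
    proof
      fix \<delta> assume \<delta>: "\<delta> \<in> cyl \<mu> n \<gamma>"
      have "\<delta> i \<in> X i" for i
      proof (cases "i < n")
        case True
        then have "\<delta> i = \<gamma> i" using \<delta> by (simp add: cyl_def)
        then show ?thesis using X(2) by (simp add: PiE_iff)
      next
        case False
        then have "X i = Zmu \<mu>" using n by blast
        then show ?thesis using \<delta> by (simp add: cyl_def TT_iff)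
      qed
      then show "\<delta> \<in> Pi\<^sub>E UNIV X" by (simp add: PiE_iff)
    qed
    then have "cyl \<mu> n \<gamma> \<subseteq> U" using X(3) by blast
    then show "\<gamma> \<in> (\<Union>n. \<Union>{\<omega>\<in>AF \<mu> n. \<omega> \<subseteq> U})"
      using cyl_in_AF [OF T] self_in_cyl [OF T] by blast
  qed blast
  also have "\<dots> \<in> sets (TT_prob \<mu>)"
  proof -
    have "\<Union>{\<omega>\<in>AF \<mu> n. \<omega> \<subseteq> U} \<in> sets (TT_prob \<mu>)" for n
      by (rule sets.finite_Union) (use pos AF_TT_prob(1) [OF pos] in auto)
    then show ?thesis by (intro sets.countable_UN) auto
  qed
  finally show ?thesis .
qed

lemma id_measurable_TT:
  assumes "\<mu> > 0"
  shows "(\<lambda>\<gamma>. \<gamma>) \<in> measurable (TT_prob \<mu>) (TT_borel \<mu> :: (nat \<Rightarrow> int^'d) measure)"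
  unfolding TT_borel_def
proof (rule measurable_measure_of)
  show "{U. openin (TT_top \<mu>) U} \<subseteq> Pow (TT \<mu>)" using openin_subset by blast
  show "(\<lambda>\<gamma>. \<gamma>) \<in> space (TT_prob \<mu>) \<rightarrow> TT \<mu>" by (simp add: space_TT_prob)
  fix U :: "(nat \<Rightarrow> int^'d) set" assume "U \<in> {U. openin (TT_top \<mu>) U}"
  then have "openin (TT_top \<mu>) U" by simp
  from open_in_TT_prob [OF assms this] openin_subset [OF this]
  show "(\<lambda>\<gamma>. \<gamma>) -` U \<inter> space (TT_prob \<mu>) \<in> sets (TT_prob \<mu>)"
    by (simp add: space_TT_prob Int_absorb2)
qed

text \<open>\<open>L\<close> will be one of the lines. \<open>L_div\<close> says that the function with value \<open>v\<close> on \<open>L\<close> and zero elsewhere is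
  divergence free. The cascade \<open>u\<close> multiplies by \<open>\<rho> = m / \<mu>\<close> on the kids in \<open>L\<close> and by zero on the others during the
  first \<open>N\<close> levels, and is constant afterwards.\<close>

locale line_cascade =
  fixes \<mu> N :: nat and L :: "(int^'d) set" and v :: "complex^'d"
  assumes mu: "\<mu> \<ge> 2"
    and L_sub: "L \<subseteq> Zmu \<mu>" and L_card: "card L = \<mu>"
    and L_div: "\<And>x. x \<in> Zmu \<mu> \<Longrightarrow>
      (\<Sum>j\<in>UNIV. v $ j * (of_bool (red \<mu> (x + axis j 1) \<in> L) - of_bool (x \<in> L))) = 0"
begin

definition \<rho> :: real where "\<rho> = real (\<mu> ^ (CARD('d) - 1))"

lemma pos: "\<mu> > 0" using mu by simp

lemma \<rho>_mu: "\<rho> * \<mu> = real (\<mu> ^ CARD('d))"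
proof -
  have "CARD('d) = Suc (CARD('d) - 1)" using zero_less_card_finite [where 'a = 'd] by simp
  then show ?thesis unfolding \<rho>_def by (metis mult.commute of_nat_mult power_Suc)
qed

lemma \<rho>_ge1: "\<rho> \<ge> 1"
  unfolding \<rho>_def using pos by (metis of_nat_1 of_nat_le_iff one_le_power Suc_le_eq One_nat_def)

definition u :: "nat \<Rightarrow> (nat \<Rightarrow> int^'d) \<Rightarrow> real" where
  "u n \<gamma> = \<rho> ^ min n N * of_bool (\<forall>k<min n N. \<gamma> k \<in> L)"

definition F :: "nat \<Rightarrow> (nat \<Rightarrow> int^'d) \<Rightarrow> complex^'d" where
  "F n \<gamma> = u n \<gamma> *\<^sub>R v"

definition \<eta> :: "nat \<Rightarrow> int^'d \<Rightarrow> real" where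
  "\<eta> n x = (if n < N then \<rho> * of_bool (x \<in> L) else 1)"

lemma u_nonneg: "u n \<gamma> \<ge> 0" using \<rho>_ge1 by (simp add: u_def)

lemma u_Suc: "u (Suc n) \<gamma> = u n \<gamma> * \<eta> n (\<gamma> n)"
proof (cases "n < N")
  case True
  then have "min (Suc n) N = Suc n" "min n N = n" by auto
  then show ?thesis using True by (auto simp: u_def \<eta>_def less_Suc_eq)
qed (simp add: u_def \<eta>_def min_def)

lemma level_u: "level \<mu> n (u n)"
  unfolding level_def
proof (intro ballI impI)
  fix \<gamma> \<gamma>' :: "nat \<Rightarrow> int^'d" assume "\<forall>k<n. \<gamma> k = \<gamma>' k"
  then have "(\<forall>k<min n N. \<gamma> k \<in> L) \<longleftrightarrow> (\<forall>k<min n N. \<gamma>' k \<in> L)"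
    by (metis min_less_iff_conj)
  then show "u n \<gamma> = u n \<gamma>'" by (simp only: u_def)
qed

lemma level_F: "level \<mu> n (F n)"
  unfolding F_def by (rule level_compose [OF level_u])

lemma sum_\<eta>: "(\<Sum>x\<in>Zmu \<mu>. \<eta> n x) = real (\<mu> ^ CARD('d))"
proof (cases "n < N")
  case True
  have "(\<Sum>x\<in>Zmu \<mu>. \<eta> n x) = \<rho> * (\<Sum>x\<in>Zmu \<mu>. of_bool (x \<in> L))"
    using True by (simp add: \<eta>_def sum_distrib_left)
  also have "(\<Sum>x\<in>Zmu \<mu>. of_bool (x \<in> L)) = real (card (Zmu \<mu> \<inter> L))"
    by (simp add: sum_of_bool_eq Int_def)
  also have "Zmu \<mu> \<inter> L = L" using L_sub by blast
  finally show ?thesis by (simp add: L_card \<rho>_mu)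
qed (simp add: \<eta>_def card_Zmu)

lemma rep_kid_digit: "\<omega> \<in> AF \<mu> n \<Longrightarrow> x \<in> Zmu \<mu> \<Longrightarrow> rep (kid n \<omega> x) n = x"
  using rep_in [OF kid_in_AF] unfolding kid_def by blast

lemma u_rep_kid:
  assumes \<omega>: "\<omega> \<in> AF \<mu> n" and x: "x \<in> Zmu \<mu>"
  shows "u (Suc n) (rep (kid n \<omega> x)) = u n (rep \<omega>) * \<eta> n x"
proof -
  have "rep (kid n \<omega> x) \<in> \<omega>" using rep_in [OF kid_in_AF [OF \<omega> x]] kid_subset by blast
  from level_rep [OF level_u \<omega> this] show ?thesis
    by (simp add: u_Suc rep_kid_digit [OF \<omega> x])
qed

lemma mdiff_F:
  assumes \<omega>: "\<omega> \<in> AF \<mu> n" and x: "x \<in> Zmu \<mu>"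
  shows "mdiff F n \<omega> x = (u n (rep \<omega>) * (\<eta> n x - 1)) *\<^sub>R v"
proof -
  have "mdiff F n \<omega> x = F (Suc n) (rep (kid n \<omega> x)) - F n (rep \<omega>)"
    using rep_kid [of \<mu> F, OF level_F \<omega> x] by simp
  then show ?thesis
    by (simp add: F_def u_rep_kid [OF \<omega> x] scaleR_diff_left [symmetric] right_diff_distrib)
qed

lemma mdiff_F_W:
  assumes \<omega>: "\<omega> \<in> AF \<mu> n"
  shows "mdiff F n \<omega> \<in> W_div \<mu>"
  unfolding W_div_def zero_sum_def mem_Collect_eq
proof (intro conjI ballI)
  have "(\<Sum>x\<in>Zmu \<mu>. mdiff F n \<omega> x) = (\<Sum>x\<in>Zmu \<mu>. (u n (rep \<omega>) * (\<eta> n x - 1)) *\<^sub>R v)"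
    by (rule sum.cong) (simp_all add: mdiff_F [OF \<omega>])
  also have "\<dots> = (u n (rep \<omega>) * (\<Sum>x\<in>Zmu \<mu>. \<eta> n x - 1)) *\<^sub>R v"
    by (simp only: scaleR_sum_left [symmetric] sum_distrib_left)
  also have "(\<Sum>x\<in>(Zmu \<mu> :: (int^'d) set). \<eta> n x - 1) = 0"
    by (simp add: sum_subtractf sum_\<eta> card_Zmu)
  finally show "(\<Sum>x\<in>Zmu \<mu>. mdiff F n \<omega> x) = 0" by simp
next
  fix x :: "int^'d" assume x: "x \<in> Zmu \<mu>"
  let ?c = "u n (rep \<omega>) * (if n < N then \<rho> else 0)"
  have e: "\<eta> n y - \<eta> n x = (if n < N then \<rho> else 0) * (of_bool (y \<in> L) - of_bool (x \<in> L))" for y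
    by (simp add: \<eta>_def right_diff_distrib)
  have "mdiff F n \<omega> (red \<mu> (x + axis j 1)) $ j - mdiff F n \<omega> x $ j
      = of_real ?c * (v $ j * (of_bool (red \<mu> (x + axis j 1) \<in> L) - of_bool (x \<in> L)))" for j
  proof -
    have "mdiff F n \<omega> (red \<mu> (x + axis j 1)) - mdiff F n \<omega> x
        = (u n (rep \<omega>) * (\<eta> n (red \<mu> (x + axis j 1)) - \<eta> n x)) *\<^sub>R v"
      unfolding mdiff_F [OF \<omega> x] mdiff_F [OF \<omega> red_in_Zmu [OF pos]] scaleR_diff_left [symmetric]
      by (rule arg_cong [where f = "\<lambda>c. c *\<^sub>R v"]) (simp add: algebra_simps)
    also have "\<dots> = (?c * (of_bool (red \<mu> (x + axis j 1) \<in> L) - of_bool (x \<in> L))) *\<^sub>R v"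
      unfolding e by (simp only: mult.assoc)
    finally have "(mdiff F n \<omega> (red \<mu> (x + axis j 1)) - mdiff F n \<omega> x) $ j
        = ((?c * (of_bool (red \<mu> (x + axis j 1) \<in> L) - of_bool (x \<in> L))) *\<^sub>R v) $ j" by simp
    then show ?thesis
      unfolding vector_minus_component vector_scaleR_component by (simp add: scaleR_conv_of_real)
  qed
  then show "(\<Sum>j\<in>UNIV. mdiff F n \<omega> (red \<mu> (x + axis j 1)) $ j - mdiff F n \<omega> x $ j) = 0"
    by (simp only: sum_distrib_left [symmetric] L_div [OF x] mult_zero_right)
qed

lemma martingale_F: "is_martingale \<mu> F"
  by (rule is_martingale_if_zero_sum [OF pos level_F]) (use mdiff_F_W in \<open>simp add: W_div_def\<close>)

lemma simple_F: "simple_martingale \<mu> F"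
  unfolding simple_martingale_def
proof (intro conjI exI allI impI ballI)
  fix n \<gamma> assume "n \<ge> N"
  then show "F n \<gamma> = F N \<gamma>" by (simp add: F_def u_def min_def)
qed (rule martingale_F)

lemma atom_sum_u: "atom_sum \<mu> n (\<lambda>\<omega>. u n (rep \<omega>)) = 1"
proof (induction n)
  case 0
  show ?case by (simp add: atom_sum_def AF_0 [OF pos] u_def)
next
  case (Suc n)
  have "real (\<mu> ^ CARD('d)) * atom_sum \<mu> (Suc n) (\<lambda>\<omega>. u (Suc n) (rep \<omega>))
      = atom_sum \<mu> n (\<lambda>\<omega>. \<Sum>x\<in>Zmu \<mu>. u (Suc n) (rep (kid n \<omega> x)))"
    by (rule atom_sum_Suc [OF pos, symmetric])
  also have "\<dots> = atom_sum \<mu> n (\<lambda>\<omega>. real (\<mu> ^ CARD('d)) * u n (rep \<omega>))"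
    unfolding atom_sum_def
    by (intro arg_cong2 [where f = "(/)"] sum.cong refl)
       (simp add: u_rep_kid sum_distrib_left [symmetric] sum_distrib_right [symmetric] sum_\<eta> mult.commute)
  also have "\<dots> = real (\<mu> ^ CARD('d)) * atom_sum \<mu> n (\<lambda>\<omega>. u n (rep \<omega>))"
    by (simp add: atom_sum_def sum_distrib_left [symmetric])
  finally show ?case using pos Suc.IH by simp
qed

lemma L1_F: "L1_norm \<mu> F = ennreal (norm v)"
proof -
  have "(\<integral>\<^sup>+\<gamma>. ennreal (norm (F n \<gamma>)) \<partial>TT_prob \<mu>) = ennreal (norm v)" for n
  proof -
    have "level \<mu> n (\<lambda>\<gamma>. norm (F n \<gamma>))"
      by (rule level_compose [OF level_F])
    then have "(\<integral>\<^sup>+\<gamma>. ennreal (norm (F n \<gamma>)) \<partial>TT_prob \<mu>)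
        = ennreal ((\<Sum>\<omega>\<in>AF \<mu> n. norm (F n (rep \<omega>))) / real (\<mu> ^ CARD('d)) ^ n)"
      by (rule nn_integral_level [OF pos]) simp
    also have "(\<Sum>\<omega>\<in>AF \<mu> n. norm (F n (rep \<omega>))) / real (\<mu> ^ CARD('d)) ^ n
        = atom_sum \<mu> n (\<lambda>\<omega>. u n (rep \<omega>)) * norm v"
      by (simp add: atom_sum_def F_def u_nonneg sum_distrib_right)
    finally show ?thesis by (simp add: atom_sum_u)
  qed
  then show ?thesis by (simp add: L1_norm_def)
qed

lemma F_in_WW: "F \<in> WW \<mu> (W_div \<mu>)"
  using martingale_F mdiff_F_W L1_F by (simp add: WW_def)

end

context line_cascade
begin

text \<open>The total variation of the vector measure defined by the cascade for \<open>|v| = 1\<close>. After level \<open>N\<close> it spreads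
  uniformly, so that it is at most \<open>\<mu>\<^sup>-\<^sup>n\<close> on the atoms of every level \<open>n\<close>.\<close>

definition \<nu> :: "(nat \<Rightarrow> int^'d) measure" where
  "\<nu> = distr (density (TT_prob \<mu>) (\<lambda>\<gamma>. ennreal (u N \<gamma>))) (TT_borel \<mu>) (\<lambda>\<gamma>. \<gamma>)"

lemma sets_\<nu>: "sets \<nu> = sets (TT_borel \<mu>)"
  by (simp add: \<nu>_def)

lemma u_measurable: "u N \<in> borel_measurable (TT_prob \<mu>)"
  using integral_level(1) [OF pos level_u [of N]] by (rule borel_measurable_integrable)

lemma emeasure_\<nu>:
  assumes A: "A \<in> sets (TT_borel \<mu>)"
  shows "emeasure \<nu> A = (\<integral>\<^sup>+\<gamma>. ennreal (u N \<gamma> * indicator A \<gamma>) \<partial>TT_prob \<mu>)"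
proof -
  let ?D = "density (TT_prob \<mu>) (\<lambda>\<gamma>. ennreal (u N \<gamma>))"
  have m: "(\<lambda>\<gamma>. \<gamma>) \<in> measurable ?D (TT_borel \<mu>)"
    using id_measurable_TT [OF pos] by (simp add: measurable_density_eq1)
  have sub: "A \<subseteq> TT \<mu>" using sets.sets_into_space [OF A] by (simp add: space_TT_borel)
  have A': "A \<in> sets (TT_prob \<mu>)"
    using measurable_sets [OF id_measurable_TT [OF pos] A] sub by (simp add: space_TT_prob Int_absorb2)
  have "emeasure \<nu> A = emeasure ?D A"
    unfolding \<nu>_def using emeasure_distr [OF m A] sub by (simp add: space_TT_prob Int_absorb2)
  also have "\<dots> = (\<integral>\<^sup>+\<gamma>. ennreal (u N \<gamma>) * indicator A \<gamma> \<partial>TT_prob \<mu>)"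
    by (rule emeasure_density) (use u_measurable A' in auto)
  also have "\<dots> = (\<integral>\<^sup>+\<gamma>. ennreal (u N \<gamma> * indicator A \<gamma>) \<partial>TT_prob \<mu>)"
    by (intro nn_integral_cong) (simp add: indicator_def)
  finally show ?thesis .
qed

lemma finite_\<nu>: "finite_measure \<nu>"
proof
  have "space \<nu> = TT \<mu>" using sets_eq_imp_space_eq [OF sets_\<nu>] by (simp add: space_TT_borel)
  moreover have "(TT \<mu> :: (nat \<Rightarrow> int^'d) set) \<in> AF \<mu> 0" by (simp add: AF_0 [OF pos])
  then have "(TT \<mu> :: (nat \<Rightarrow> int^'d) set) \<in> sets (TT_borel \<mu>)" by (rule AF_sets_borel)
  moreover have "(\<integral>\<^sup>+\<gamma>. ennreal (u N \<gamma> * indicator (TT \<mu>) \<gamma>) \<partial>TT_prob \<mu>) = (\<integral>\<^sup>+\<gamma>. ennreal (u N \<gamma>) \<partial>TT_prob \<mu>)"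
    by (intro nn_integral_cong) (simp add: space_TT_prob)
  moreover have "(\<integral>\<^sup>+\<gamma>. ennreal (u N \<gamma>) \<partial>TT_prob \<mu>) = ennreal 1"
    using nn_integral_level [OF pos level_u [of N] u_nonneg] atom_sum_u [of N] by (simp only: atom_sum_def)
  ultimately show "emeasure \<nu> (space \<nu>) \<noteq> \<infinity>"
    by (simp add: emeasure_\<nu>)
qed

lemma measure_\<nu>_late:
  assumes n: "n \<ge> N" and \<omega>: "\<omega> \<in> AF \<mu> n"
  shows "measure \<nu> \<omega> = u n (rep \<omega>) / real (\<mu> ^ CARD('d)) ^ n"
proof -
  have un: "u N = u n" using n by (auto simp: u_def fun_eq_iff min_def)
  have li: "level \<mu> n (\<lambda>\<gamma>. indicator \<omega> \<gamma> :: real)"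
    unfolding level_def
  proof (intro ballI impI)
    fix \<gamma> \<gamma>' :: "nat \<Rightarrow> int^'d" assume \<gamma>: "\<gamma> \<in> TT \<mu>" "\<gamma>' \<in> TT \<mu>" "\<forall>k<n. \<gamma> k = \<gamma>' k"
    then have "cyl \<mu> n \<gamma> = cyl \<mu> n \<gamma>'" by (simp add: cyl_def)
    then show "(indicator \<omega> \<gamma> :: real) = indicator \<omega> \<gamma>'"
      using in_AF_iff [OF \<omega>] \<gamma>(1,2) by (simp add: indicator_def)
  qed
  have "emeasure \<nu> \<omega> = (\<integral>\<^sup>+\<gamma>. ennreal (u n \<gamma> * indicator \<omega> \<gamma>) \<partial>TT_prob \<mu>)"
    using emeasure_\<nu> [OF AF_sets_borel [OF \<omega>]] by (simp only: un)
  also have "\<dots> = ennreal ((\<Sum>\<omega>'\<in>AF \<mu> n. u n (rep \<omega>') * indicator \<omega> (rep \<omega>')) / real (\<mu> ^ CARD('d)) ^ n)"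
    by (rule nn_integral_level [OF pos level_compose2 [OF level_u li]]) (simp add: u_nonneg)
  also have "(\<Sum>\<omega>'\<in>AF \<mu> n. u n (rep \<omega>') * indicator \<omega> (rep \<omega>')) = (\<Sum>\<omega>'\<in>AF \<mu> n. if \<omega>' = \<omega> then u n (rep \<omega>) else 0)"
  proof (rule sum.cong [OF refl])
    fix \<omega>' :: "(nat \<Rightarrow> int^'d) set" assume "\<omega>' \<in> AF \<mu> n"
    then show "u n (rep \<omega>') * indicator \<omega> (rep \<omega>') = (if \<omega>' = \<omega> then u n (rep \<omega>) else 0)"
      using rep_in [OF \<omega>] rep_in [of \<omega>' \<mu> n] AF_eq_cyl [OF \<omega>] AF_eq_cyl [of \<omega>' \<mu> n] by (auto simp: indicator_def)
  qed
  also have "\<dots> = u n (rep \<omega>)" using \<omega> pos by simp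
  finally show ?thesis by (simp add: measure_def u_nonneg)
qed

lemma measure_\<nu>:
  assumes "\<omega> \<in> AF \<mu> n"
  shows "measure \<nu> \<omega> = u n (rep \<omega>) / real (\<mu> ^ CARD('d)) ^ n"
proof (cases "n \<ge> N")
  case False
  then have "n \<le> N" by simp
  then have "\<forall>\<omega>\<in>AF \<mu> n. measure \<nu> \<omega> = u n (rep \<omega>) / real (\<mu> ^ CARD('d)) ^ n"
  proof (induction rule: inc_induct)
    case (step n)
    show ?case
    proof
      fix \<omega> :: "(nat \<Rightarrow> int^'d) set" assume \<omega>: "\<omega> \<in> AF \<mu> n"
      have "measure \<nu> \<omega> = (\<Sum>x\<in>Zmu \<mu>. measure \<nu> (kid n \<omega> x))"
        by (rule measure_kids [OF pos sets_\<nu> finite_\<nu> \<omega>, symmetric])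
      also have "\<dots> = (\<Sum>x\<in>Zmu \<mu>. u n (rep \<omega>) * \<eta> n x / real (\<mu> ^ CARD('d)) ^ Suc n)"
        by (rule sum.cong) (simp_all only: step.IH [rule_format, OF kid_in_AF [OF \<omega>]] u_rep_kid [OF \<omega>])
      also have "\<dots> = u n (rep \<omega>) * real (\<mu> ^ CARD('d)) / real (\<mu> ^ CARD('d)) ^ Suc n"
        by (simp only: sum_divide_distrib [symmetric] sum_distrib_left [symmetric] sum_\<eta>)
      finally show "measure \<nu> \<omega> = u n (rep \<omega>) / real (\<mu> ^ CARD('d)) ^ n"
        using pos by simp
    qed
  next
    case base
    show ?case by (intro ballI measure_\<nu>_late) auto
  qed
  then show ?thesis using assms by blast
qed (simp add: measure_\<nu>_late assms)

lemma measure_\<nu>_le: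
  assumes "\<omega> \<in> AF \<mu> n"
  shows "real \<mu> ^ n * measure \<nu> \<omega> \<le> 1"
proof -
  have "u n (rep \<omega>) \<le> \<rho> ^ min n N"
    using \<rho>_ge1 by (simp add: u_def)
  also have "\<dots> \<le> \<rho> ^ n" using \<rho>_ge1 by (intro power_increasing) auto
  finally have "real \<mu> ^ n * u n (rep \<omega>) \<le> real \<mu> ^ n * \<rho> ^ n" by (intro mult_left_mono) auto
  also have "\<dots> = real (\<mu> ^ CARD('d)) ^ n" by (simp only: power_mult_distrib [symmetric] \<rho>_mu [symmetric] mult.commute)
  finally show ?thesis using pos by (simp add: measure_\<nu> [OF assms])
qed

lemma pairing_scaleR: "pairing k (c *\<^sub>R w) = of_real c * pairing k w"
  unfolding pairing_def vector_scaleR_component sum_distrib_left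
  by (rule sum.cong) (simp_all add: scaleR_conv_of_real)

lemma conv_F:
  assumes K0: "(\<Sum>x\<in>Zmu \<mu>. K x) = 0"
    and \<kappa>: "\<And>x. x \<in> L \<Longrightarrow> (\<Sum>z\<in>L. pairing (K (red \<mu> (x - z))) v) = \<kappa>"
    and n: "n < N" and \<omega>: "\<omega> \<in> AF \<mu> n" and x: "x \<in> L"
  shows "conv_op \<mu> K (mdiff F n \<omega>) x = of_real (u n (rep \<omega>) * \<rho>) * \<kappa>"
proof -
  let ?p = "\<lambda>z. pairing (K (red \<mu> (x - z))) v"
  have "(\<Sum>z\<in>Zmu \<mu>. K (red \<mu> (x - z))) = 0"
    using sum_Zmu_reflect [OF pos, of K x] K0 by simp
  then have "(\<Sum>z\<in>Zmu \<mu>. K (red \<mu> (x - z)) $ j) = 0" for j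
    by (metis sum_component zero_index)
  then have p0: "(\<Sum>z\<in>Zmu \<mu>. ?p z) = 0"
    unfolding pairing_def by (subst sum.swap) (simp add: sum_distrib_right [symmetric])
  have "conv_op \<mu> K (mdiff F n \<omega>) x
      = (\<Sum>z\<in>Zmu \<mu>. of_real (u n (rep \<omega>)) * (of_real \<rho> * (if z \<in> L then ?p z else 0) - ?p z))"
    unfolding conv_op_def
  proof (rule sum.cong [OF refl])
    fix z :: "int^'d" assume z: "z \<in> Zmu \<mu>"
    show "pairing (K (red \<mu> (x - z))) (mdiff F n \<omega> z)
        = of_real (u n (rep \<omega>)) * (of_real \<rho> * (if z \<in> L then ?p z else 0) - ?p z)"
      unfolding mdiff_F [OF \<omega> z] pairing_scaleR using n by (simp add: \<eta>_def algebra_simps)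
  qed
  also have "\<dots> = of_real (u n (rep \<omega>)) * (of_real \<rho> * (\<Sum>z\<in>Zmu \<mu>. if z \<in> L then ?p z else 0) - (\<Sum>z\<in>Zmu \<mu>. ?p z))"
    by (simp only: sum_distrib_left [symmetric] sum_subtractf)
  also have "(\<Sum>z\<in>Zmu \<mu>. if z \<in> L then ?p z else 0) = (\<Sum>z\<in>L. ?p z)"
    using L_sub by (simp add: sum.inter_restrict [symmetric] Int_absorb1)
  finally show ?thesis by (simp add: p0 \<kappa> [OF x])
qed

lemma sum_kid_indicator:
  fixes h :: "(nat \<Rightarrow> int^'d) set \<Rightarrow> int^'d \<Rightarrow> complex"
  assumes \<gamma>: "\<gamma> \<in> TT \<mu>"
  shows "(\<Sum>\<omega>\<in>AF \<mu> n. \<Sum>x\<in>Zmu \<mu>. h \<omega> x * indicator (kid n \<omega> x) \<gamma>) = h (cyl \<mu> n \<gamma>) (\<gamma> n)"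
proof -
  have gn: "\<gamma> n \<in> Zmu \<mu>" using \<gamma> by (simp add: TT_iff)
  have "(\<Sum>\<omega>\<in>AF \<mu> n. \<Sum>x\<in>Zmu \<mu>. h \<omega> x * indicator (kid n \<omega> x) \<gamma>)
      = (\<Sum>\<omega>\<in>AF \<mu> n. \<Sum>x\<in>Zmu \<mu>. if x = \<gamma> n then (if \<omega> = cyl \<mu> n \<gamma> then h \<omega> x else 0) else 0)"
    by (intro sum.cong refl) (use in_AF_iff [OF _ \<gamma>] in \<open>auto simp: indicator_def kid_def\<close>)
  also have "\<dots> = (\<Sum>\<omega>\<in>AF \<mu> n. if \<omega> = cyl \<mu> n \<gamma> then h \<omega> (\<gamma> n) else 0)"
    using gn by simp
  also have "\<dots> = h (cyl \<mu> n \<gamma>) (\<gamma> n)"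
    using pos cyl_in_AF [OF \<gamma>, of n] by simp
  finally show ?thesis .
qed

text \<open>On a point whose first \<open>N\<close> digits lie in \<open>L\<close>, the factor \<open>\<rho>\<^sup>n\<close> of the cascade cancels against the weight
  of level \<open>n\<close>, and every one of these levels contributes \<open>\<rho> \<kappa>\<close>.\<close>

lemma riesz_F:
  assumes \<alpha>: "\<alpha> = (real CARD('d) - 1) / real CARD('d)"
    and K0: "(\<Sum>x\<in>Zmu \<mu>. K x) = 0"
    and \<kappa>: "\<And>x. x \<in> L \<Longrightarrow> (\<Sum>z\<in>L. pairing (K (red \<mu> (x - z))) v) = \<kappa>"
    and \<gamma>: "\<gamma> \<in> TT \<mu>" "\<forall>k<N. \<gamma> k \<in> L"
  shows "riesz_potential \<mu> (conv_op \<mu> K) \<alpha> F \<gamma> = of_nat N * of_real \<rho> * \<kappa>"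
proof -
  have summand: "of_real (real (\<mu> ^ CARD('d)) powr (- \<alpha> * real n)) * conv_op \<mu> K (mdiff F n (cyl \<mu> n \<gamma>)) (\<gamma> n)
      = (if n < N then of_real \<rho> * \<kappa> else 0)" for n
  proof (cases "n < N")
    case True
    have "u n (rep (cyl \<mu> n \<gamma>)) = u n \<gamma>"
      by (rule level_rep [OF level_u cyl_in_AF self_in_cyl]) (rule \<gamma>(1))+
    also have "\<dots> = \<rho> ^ n" using True \<gamma>(2) by (simp add: u_def)
    finally have un: "u n (rep (cyl \<mu> n \<gamma>)) = \<rho> ^ n" .
    have "real \<mu> ^ n / real (\<mu> ^ CARD('d)) ^ n * (\<rho> ^ n * \<rho>) = \<rho>"
    proof -
      have "real \<mu> ^ n * \<rho> ^ n = real (\<mu> ^ CARD('d)) ^ n"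
        by (simp only: power_mult_distrib [symmetric] \<rho>_mu [symmetric] mult.commute)
      moreover have "real (\<mu> ^ CARD('d)) ^ n \<noteq> 0" using pos by simp
      ultimately show ?thesis by (metis mult.assoc nonzero_eq_divide_eq mult.commute times_divide_eq_left mult_1)
    qed
    then have "complex_of_real (real \<mu> ^ n / real (\<mu> ^ CARD('d)) ^ n) * of_real (\<rho> ^ n * \<rho>) = of_real \<rho>"
      by (metis of_real_mult)
    then show ?thesis
      using conv_F [OF K0 \<kappa> True cyl_in_AF [OF \<gamma>(1)], of "\<gamma> n"] True \<gamma>(2)
      unfolding \<alpha> powr_weights(2) [OF pos zero_less_card_finite] un
      by (simp add: mult.assoc [symmetric])
  next
    case False
    have "mdiff F n (cyl \<mu> n \<gamma>) y = 0" if "y \<in> Zmu \<mu>" for y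
      using mdiff_F [OF cyl_in_AF [OF \<gamma>(1)] that] False by (simp add: \<eta>_def)
    then show ?thesis using False by (simp add: conv_op_def pairing_def)
  qed
  have "riesz_potential \<mu> (conv_op \<mu> K) \<alpha> F \<gamma> = (\<Sum>n. if n < N then of_real \<rho> * \<kappa> else 0)"
    unfolding riesz_potential_def sum_kid_indicator [OF \<gamma>(1)] summand ..
  also have "\<dots> = (\<Sum>n<N. of_real \<rho> * \<kappa>)"
    by (subst suminf_finite [of "{..<N}"]) auto
  finally show ?thesis by simp
qed

text \<open>\<open>\<nu>\<close> is a probability measure carried by the atoms of level \<open>N\<close> on which \<open>riesz_F\<close> applies.\<close>

lemma riesz_integral_ge:
  assumes \<alpha>: "\<alpha> = (real CARD('d) - 1) / real CARD('d)"
    and K0: "(\<Sum>x\<in>Zmu \<mu>. K x) = 0"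
    and \<kappa>: "\<And>x. x \<in> L \<Longrightarrow> (\<Sum>z\<in>L. pairing (K (red \<mu> (x - z))) v) = \<kappa>"
  shows "ennreal (real N * norm \<kappa>) \<le> (\<integral>\<^sup>+ \<gamma>. ennreal (cmod (riesz_potential \<mu> (conv_op \<mu> K) \<alpha> F \<gamma>)) \<partial>\<nu>)"
proof -
  let ?w = "\<lambda>\<omega>. real N * norm \<kappa> * of_bool (u N (rep \<omega>) \<noteq> 0)"
  let ?R = "\<lambda>\<gamma>. cmod (riesz_potential \<mu> (conv_op \<mu> K) \<alpha> F \<gamma>)"
  have "(\<Sum>\<omega>\<in>AF \<mu> N. ?w \<omega> * measure \<nu> \<omega>) = real N * norm \<kappa> * atom_sum \<mu> N (\<lambda>\<omega>. u N (rep \<omega>))"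
  proof -
    have "(\<Sum>\<omega>\<in>AF \<mu> N. ?w \<omega> * measure \<nu> \<omega>) = (\<Sum>\<omega>\<in>AF \<mu> N. real N * norm \<kappa> * (u N (rep \<omega>) / real (\<mu> ^ CARD('d)) ^ N))"
      by (rule sum.cong) (auto simp: measure_\<nu>)
    then show ?thesis by (simp only: atom_sum_def sum_distrib_left sum_divide_distrib)
  qed
  then have "ennreal (real N * norm \<kappa>) = ennreal (\<Sum>\<omega>\<in>AF \<mu> N. ?w \<omega> * measure \<nu> \<omega>)"
    by (simp only: atom_sum_u mult_1_right)
  also have "\<dots> = (\<integral>\<^sup>+\<gamma>. ennreal (\<Sum>\<omega>\<in>AF \<mu> N. ?w \<omega> * indicator \<omega> \<gamma>) \<partial>\<nu>)"
    using pos AF_sets_borel sets_\<nu>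
    by (intro nn_integral_weighted_indicators [symmetric] finite_\<nu>) auto
  also have "\<dots> \<le> (\<integral>\<^sup>+ \<gamma>. ennreal (?R \<gamma>) \<partial>\<nu>)"
  proof (intro nn_integral_mono ennreal_leI)
    fix \<gamma> assume "\<gamma> \<in> space \<nu>"
    then have \<gamma>: "\<gamma> \<in> TT \<mu>" using sets_eq_imp_space_eq [OF sets_\<nu>] by (simp add: space_TT_borel)
    have "(\<Sum>\<omega>\<in>AF \<mu> N. ?w \<omega> * indicator \<omega> \<gamma>) = ?w (cyl \<mu> N \<gamma>)"
      using sum_AF_indicator [OF pos \<gamma>, where f = ?w and n = N] by (simp only: real_scaleR_def mult.commute)
    also have "u N (rep (cyl \<mu> N \<gamma>)) = u N \<gamma>"
      by (rule level_rep [OF level_u cyl_in_AF self_in_cyl]) (rule \<gamma>)+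
    also have "real N * norm \<kappa> * of_bool (u N \<gamma> \<noteq> 0) \<le> ?R \<gamma>"
    proof (cases "\<forall>k<N. \<gamma> k \<in> L")
      case True
      have "?R \<gamma> = real N * \<rho> * norm \<kappa>"
        using riesz_F [OF \<alpha> K0 \<kappa> \<gamma> True] \<rho>_ge1 by (simp add: norm_mult)
      moreover have "real N * norm \<kappa> * of_bool (u N \<gamma> \<noteq> 0) \<le> real N * norm \<kappa> * \<rho>"
        using \<rho>_ge1 by (intro mult_left_mono) auto
      ultimately show ?thesis by (simp only: mult_ac)
    next
      case False
      then show ?thesis by (auto simp: u_def)
    qed
    finally show "(\<Sum>\<omega>\<in>AF \<mu> N. ?w \<omega> * indicator \<omega> \<gamma>) \<le> ?R \<gamma>" .
  qed
  finally show ?thesis .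
qed

end

section \<open>The lines of the two conditions\<close>

text \<open>The lines are cyclic subgroups. Hence the convolution of \<open>K\<close> with the indicator of a line is constant on that
  line.\<close>

definition cyclic :: "nat \<Rightarrow> int^'d \<Rightarrow> (int^'d) set" where
  "cyclic \<mu> s = (\<lambda>y. red \<mu> (int y *s s)) ` {..<\<mu>}"

lemma in_cyclic_iff:
  assumes "\<mu> > 0"
  shows "red \<mu> w \<in> cyclic \<mu> s \<longleftrightarrow> (\<exists>k. red \<mu> w = red \<mu> (k *s s))"
proof
  assume "\<exists>k. red \<mu> w = red \<mu> (k *s s)"
  then obtain k where k: "red \<mu> w = red \<mu> (k *s s)" ..
  have "red \<mu> (k *s s) = red \<mu> (int (nat (k mod int \<mu>)) *s s)"
    using assms by (simp add: vec_eq_iff mod_simps)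
  moreover have "nat (k mod int \<mu>) < \<mu>" using assms by (simp add: nat_less_iff)
  ultimately show "red \<mu> w \<in> cyclic \<mu> s" unfolding cyclic_def k by blast
qed (auto simp: cyclic_def)

lemma cyclic_translate:
  assumes "\<mu> > 0"
  shows "red \<mu> (w + s) \<in> cyclic \<mu> s \<longleftrightarrow> red \<mu> w \<in> cyclic \<mu> s"
proof -
  have "red \<mu> (w + s) = red \<mu> (k *s s) \<longleftrightarrow> red \<mu> w = red \<mu> ((k - 1) *s s)" for k
    unfolding red_eq_iff by (simp add: algebra_simps)
  moreover have "(\<exists>k. red \<mu> w = red \<mu> ((k - 1) *s s)) \<longleftrightarrow> (\<exists>k. red \<mu> w = red \<mu> (k *s s))"
    by (metis add_diff_cancel_right')
  ultimately show ?thesis unfolding in_cyclic_iff [OF assms] by (simp only:)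
qed

lemma inj_cyclic:
  fixes s :: "int^'d"
  assumes "s $ c = 1"
  shows "inj_on (\<lambda>y. red \<mu> (int y *s s)) {..<\<mu>}"
proof (rule inj_onI)
  fix y y' assume y: "y \<in> {..<\<mu>}" "y' \<in> {..<\<mu>}" "red \<mu> (int y *s s) = red \<mu> (int y' *s s)"
  then have "red \<mu> (int y *s s) $ c = red \<mu> (int y' *s s) $ c" by (simp only:)
  then show "y = y'" using y(1,2) assms by simp
qed

lemma cyclic_diff:
  assumes "\<mu> > 0" "x \<in> cyclic \<mu> s" "z \<in> cyclic \<mu> s"
  shows "red \<mu> (x - z) \<in> cyclic \<mu> s"
proof -
  obtain a b where ab: "x = red \<mu> (int a *s s)" "z = red \<mu> (int b *s s)"
    using assms(2,3) unfolding cyclic_def by blast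
  have "red \<mu> (x - z) = red \<mu> ((int a - int b) *s s)"
    unfolding ab by (simp add: vec_eq_iff mod_simps algebra_simps)
  then show ?thesis using in_cyclic_iff [OF assms(1)] by blast
qed

lemma sum_cyclic_reflect:
  assumes "\<mu> > 0" "x \<in> cyclic \<mu> s"
  shows "(\<Sum>z\<in>cyclic \<mu> s. f (red \<mu> (x - z))) = (\<Sum>z\<in>cyclic \<mu> s. f z)"
proof -
  have r: "red \<mu> z = z" if "z \<in> cyclic \<mu> s" for z using that by (auto simp: cyclic_def)
  show ?thesis
    by (rule sum.reindex_bij_witness [of _ "\<lambda>z. red \<mu> (x - z)" "\<lambda>z. red \<mu> (x - z)"])
       (use cyclic_diff [OF assms] r in auto)
qed

text \<open>The cascades on one line, for all \<open>N\<close>, give \<open>N |\<kappa>| \<le> C |v|\<close>.\<close>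

lemma necessity_line:
  fixes \<mu> m :: nat and \<alpha> :: real and K :: "int^'d \<Rightarrow> complex^'d"
  assumes mu: "\<mu> \<ge> 2" and m: "m = \<mu> ^ CARD('d)" and \<alpha>: "\<alpha> = (real CARD('d) - 1) / real CARD('d)"
    and K0: "(\<Sum>x\<in>Zmu \<mu>. K x) = 0" and C: "C \<ge> 0"
    and ineq: "\<And>(F :: nat \<Rightarrow> (nat \<Rightarrow> int^'d) \<Rightarrow> complex^'d) \<nu>.
               F \<in> WW \<mu> (W_div \<mu>) \<and> simple_martingale \<mu> F \<and>
               sets \<nu> = sets (TT_borel \<mu>) \<and> finite_measure \<nu> \<and>
               (SUP n. SUP \<omega>\<in>AF \<mu> n. ennreal (real m powr ((1 - \<alpha>) * real n)) * emeasure \<nu> \<omega>) < \<infinity>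
               \<Longrightarrow>
               (\<integral>\<^sup>+ \<gamma>. ennreal (cmod (riesz_potential \<mu> (conv_op \<mu> K) \<alpha> F \<gamma>)) \<partial>\<nu>)
                 \<le> ennreal C *
                   (SUP n. SUP \<omega>\<in>AF \<mu> n. ennreal (real m powr ((1 - \<alpha>) * real n)) * emeasure \<nu> \<omega>) *
                   L1_norm \<mu> F"
    and s: "s $ c = 1"
    and div: "\<And>w. (\<Sum>j\<in>UNIV. v $ j * (of_bool (red \<mu> (w + axis j 1) \<in> cyclic \<mu> s) - of_bool (red \<mu> w \<in> cyclic \<mu> s))) = 0"
  shows "(\<Sum>y<\<mu>. pairing (K (red \<mu> (int y *s s))) v) = 0"
proof -
  have pos: "\<mu> > 0" using mu by simp
  define \<kappa> where "\<kappa> = (\<Sum>y<\<mu>. pairing (K (red \<mu> (int y *s s))) v)"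
  have \<kappa>: "(\<Sum>z\<in>cyclic \<mu> s. pairing (K (red \<mu> (x - z))) v) = \<kappa>" if "x \<in> cyclic \<mu> s" for x
    unfolding sum_cyclic_reflect [OF pos that, of "\<lambda>z. pairing (K z) v"] \<kappa>_def
    by (simp add: cyclic_def sum.reindex [OF inj_cyclic [of s c, OF s]])
  have "real N * norm \<kappa> \<le> C * norm v" for N
  proof -
    interpret line_cascade \<mu> N "cyclic \<mu> s" v
    proof
      show "cyclic \<mu> s \<subseteq> Zmu \<mu>" using pos by (auto simp: cyclic_def)
      show "card (cyclic \<mu> s) = \<mu>" unfolding cyclic_def by (simp add: card_image [OF inj_cyclic [of s c, OF s]])
      show "(\<Sum>j\<in>UNIV. v $ j * (of_bool (red \<mu> (x + axis j 1) \<in> cyclic \<mu> s) - of_bool (x \<in> cyclic \<mu> s))) = 0"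
        if "x \<in> Zmu \<mu>" for x using div [of x] by (simp only: red_Zmu [OF that])
    qed (rule mu)
    interpret fin: finite_measure \<nu> by (rule finite_\<nu>)
    have le1: "(SUP n. SUP \<omega>\<in>AF \<mu> n. ennreal (real m powr ((1 - \<alpha>) * real n)) * emeasure \<nu> \<omega>) \<le> 1"
    proof (intro SUP_least)
      fix n and \<omega> :: "(nat \<Rightarrow> int^'d) set" assume "\<omega> \<in> AF \<mu> n"
      from measure_\<nu>_le [OF this]
      have "ennreal (real \<mu> ^ n * measure \<nu> \<omega>) \<le> ennreal 1" by (rule ennreal_leI)
      then show "ennreal (real m powr ((1 - \<alpha>) * real n)) * emeasure \<nu> \<omega> \<le> 1"
        unfolding m \<alpha> powr_weights(1) [OF pos zero_less_card_finite]
        by (simp add: fin.emeasure_eq_measure ennreal_mult)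
    qed
    then have "(SUP n. SUP \<omega>\<in>AF \<mu> n. ennreal (real m powr ((1 - \<alpha>) * real n)) * emeasure \<nu> \<omega>) < \<infinity>"
      by (rule order_le_less_trans) simp
    then have "(\<integral>\<^sup>+ \<gamma>. ennreal (cmod (riesz_potential \<mu> (conv_op \<mu> K) \<alpha> F \<gamma>)) \<partial>\<nu>)
        \<le> ennreal C * (SUP n. SUP \<omega>\<in>AF \<mu> n. ennreal (real m powr ((1 - \<alpha>) * real n)) * emeasure \<nu> \<omega>) * L1_norm \<mu> F"
      by (intro ineq conjI F_in_WW simple_F sets_\<nu> finite_\<nu>)
    also have "\<dots> \<le> ennreal C * 1 * L1_norm \<mu> F"
      by (intro mult_right_mono mult_left_mono le1) auto
    also have "\<dots> = ennreal (C * norm v)"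
      using C by (simp add: L1_F ennreal_mult)
    finally have "ennreal (real N * norm \<kappa>) \<le> ennreal (C * norm v)"
      using riesz_integral_ge [OF \<alpha> K0 \<kappa>] by (rule order_trans [rotated])
    then show ?thesis using C by (simp add: ennreal_le_iff)
  qed
  then have "norm \<kappa> = 0"
    by (metis less_le_not_le norm_ge_zero reals_Archimedean3 order_le_less)
  then show ?thesis by (simp add: \<kappa>_def)
qed

lemma pairing_axis: "pairing k (axis j 1) = k $ j"
  by (simp add: pairing_def axis_def if_distrib [of "\<lambda>c. _ * c"] cong: if_cong)

lemma pairing_diff: "pairing k (v - w) = pairing k v - pairing k w"
  by (simp add: pairing_def right_diff_distrib sum_subtractf)

lemma sum_axis: "(\<Sum>k\<in>UNIV. axis j 1 $ k * f k) = (f j :: complex)"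
  by (simp add: axis_def if_distrib [of "\<lambda>c. c * _"] cong: if_cong)

theorem theorem7p2:
  fixes \<mu> m :: nat and \<alpha> :: real and K :: "int^'d \<Rightarrow> complex^'d"
  assumes "\<mu> \<ge> 4" and "CARD('d) \<ge> 2"
    and "m = \<mu> ^ CARD('d)" and "\<alpha> = (real CARD('d) - 1) / real CARD('d)"
    and "(\<Sum>x\<in>Zmu \<mu>. K x) = 0"
  shows "(\<exists>C::real. C \<ge> 0 \<and>
            (\<forall>(F :: nat \<Rightarrow> (nat \<Rightarrow> int^'d) \<Rightarrow> complex^'d) \<nu>.
               F \<in> WW \<mu> (W_div \<mu>) \<and> simple_martingale \<mu> F \<and>
               sets \<nu> = sets (TT_borel \<mu>) \<and> finite_measure \<nu> \<and>
               (SUP n. SUP \<omega>\<in>AF \<mu> n. ennreal (real m powr ((1 - \<alpha>) * real n)) * emeasure \<nu> \<omega>) < \<infinity>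
               \<longrightarrow>
               (\<integral>\<^sup>+ \<gamma>. ennreal (cmod (riesz_potential \<mu> (conv_op \<mu> K) \<alpha> F \<gamma>)) \<partial>\<nu>)
                 \<le> ennreal C *
                   (SUP n. SUP \<omega>\<in>AF \<mu> n. ennreal (real m powr ((1 - \<alpha>) * real n)) * emeasure \<nu> \<omega>) *
                   L1_norm \<mu> F))
         \<longleftrightarrow>
         (\<forall>j. (\<Sum>y\<in>{0..<int \<mu>}. K (red \<mu> (y *s axis j 1)) $ j) = 0) \<and>
         (\<forall>i j. i \<noteq> j \<longrightarrow>
            (\<Sum>y\<in>{0..<int \<mu>}. K (red \<mu> (y *s (axis j 1 - axis i 1))) $ j
                             - K (red \<mu> (y *s (axis j 1 - axis i 1))) $ i) = 0)"
  (is "?ineq \<longleftrightarrow> _")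
proof -
  have mu: "\<mu> \<ge> 2" and pos: "\<mu> > 0" using assms(1) by simp_all
  have "?ineq \<longleftrightarrow> line_conditions \<mu> K"
  proof
    assume "line_conditions \<mu> K"
    with mu assms(3-5) show ?ineq by (rule sufficiency)
  next
    assume ?ineq
    then obtain C :: real where C: "C \<ge> 0" and ineq: "\<And>(F :: nat \<Rightarrow> (nat \<Rightarrow> int^'d) \<Rightarrow> complex^'d) \<nu>.
               F \<in> WW \<mu> (W_div \<mu>) \<and> simple_martingale \<mu> F \<and>
               sets \<nu> = sets (TT_borel \<mu>) \<and> finite_measure \<nu> \<and>
               (SUP n. SUP \<omega>\<in>AF \<mu> n. ennreal (real m powr ((1 - \<alpha>) * real n)) * emeasure \<nu> \<omega>) < \<infinity>
               \<Longrightarrow>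
               (\<integral>\<^sup>+ \<gamma>. ennreal (cmod (riesz_potential \<mu> (conv_op \<mu> K) \<alpha> F \<gamma>)) \<partial>\<nu>)
                 \<le> ennreal C *
                   (SUP n. SUP \<omega>\<in>AF \<mu> n. ennreal (real m powr ((1 - \<alpha>) * real n)) * emeasure \<nu> \<omega>) *
                   L1_norm \<mu> F"
      by blast
    note line = necessity_line [OF mu assms(3-5) C ineq]
    show "line_conditions \<mu> K"
      unfolding line_conditions_def sum_int_lessThan
    proof (intro conjI allI impI)
      fix j :: 'd
      have "(\<Sum>y<\<mu>. pairing (K (red \<mu> (int y *s axis j 1))) (axis j 1)) = 0"
        by (rule line [where c = j]) (simp_all add: sum_axis cyclic_translate [OF pos])
      then show "(\<Sum>y<\<mu>. K (red \<mu> (int y *s axis j 1)) $ j) = 0"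
        by (simp add: pairing_axis)
    next
      fix i j :: 'd assume "i \<noteq> j"
      let ?s = "axis j 1 - axis i 1 :: int^'d"
      have "(\<Sum>y<\<mu>. pairing (K (red \<mu> (int y *s ?s))) (axis j 1 - axis i 1)) = 0"
      proof (rule line [where c = j])
        show "?s $ j = 1" using \<open>i \<noteq> j\<close> by (simp add: axis_def)
        fix w :: "int^'d"
        have "red \<mu> (w + axis i 1 + ?s) \<in> cyclic \<mu> ?s \<longleftrightarrow> red \<mu> (w + axis i 1) \<in> cyclic \<mu> ?s"
          by (rule cyclic_translate [OF pos])
        moreover have "w + axis i 1 + ?s = w + axis j 1" by simp
        ultimately have "red \<mu> (w + axis j 1) \<in> cyclic \<mu> ?s \<longleftrightarrow> red \<mu> (w + axis i 1) \<in> cyclic \<mu> ?s"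
          by (simp only:)
        then show "(\<Sum>k\<in>UNIV. (axis j 1 - axis i 1 :: complex^'d) $ k
            * (of_bool (red \<mu> (w + axis k 1) \<in> cyclic \<mu> ?s) - of_bool (red \<mu> w \<in> cyclic \<mu> ?s))) = 0"
          by (simp only: vector_minus_component left_diff_distrib sum_subtractf sum_axis) simp
      qed
      then show "(\<Sum>y<\<mu>. K (red \<mu> (int y *s ?s)) $ j - K (red \<mu> (int y *s ?s)) $ i) = 0"
        by (simp only: pairing_diff pairing_axis)
    qed
  qed
  then show ?thesis by (simp only: line_conditions_def)
qed

end
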